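(* Let $\mathsf R,\mathsf S\ge0$ and $\mathsf P,\mathsf k_1,\mathsf k_2>0$ (admissible parameters), let $\mathscr N_{\mathbf u}^{\tau}\subset\mathscr N_{\mathbf u}$ and $\mathscr N_\theta^{\tau}\subset\mathscr N_\theta$ be any finite index sets, and let $\mathbf X_0^{\tau}=(\mathbf u_0^\tau,\theta_0^\tau)$ be any initial condition in the associated finite-dimensional phase space. Then there exists a unique, globally (for all $t\ge0$) defined smooth solution $\mathbf X^\tau(t)=(\mathbf u^\tau(t),\theta^\tau(t))$ of the truncated ODE model described in the context with $\mathbf X^\tau(0)=\mathbf X^\tau_0$, and the semigroup $\mathcal S^\tau(t)[\mathbf X_0^\tau]:=\mathbf X^\tau(t)$ is well defined. Moreover, with $$\lambda_1^\tau=\min\{|\mathcal K\mathbf m|:\ \mathbf n=(\mathbf m,\mathbf p,c)\in\mathscr N_{\mathbf u}^\tau\cup\mathscr N_\theta^\tau\},$$ the origin is globally exponentially attractive whenever $\mathsf R<(\lambda_1^\tau)^4$.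
   Context: Domain. $\mathsf k_3=(\mathsf k_1\mathsf k_2)^{-1}$, $\Omega=[0,\frac{2\pi}{\mathsf k_1}]\times[0,\frac{2\pi}{\mathsf k_2}]\times[0,\frac{\pi}{\mathsf k_3}]$; functions are periodic in $x_1,x_2$. $\langle g\rangle=\int_\Omega g\,d\mathbf x$, $\hat{\mathbf e}^3=(0,0,1)$, $\mathcal K=\mathrm{diag}[\mathsf k_1,\mathsf k_2,\mathsf k_3]$. Indices. An index is $\mathbf n=(\mathbf m,\mathbf p,c)$ with $\mathbf m=(m_1,m_2,m_3)\in\mathbb Z_{\ge0}^3$, $\mathbf p=(p_1,p_2)\in\{0,1\}^2$, $c\in\{1,2\}$. Phase arithmetic is mod 2, $p_3:=0$. $s^{m,0}(x)=\cos(mx)$, $s^{m,1}(x)=\sin(mx)$; $\iota^{m}=0$ if $m=0$, $1$ if $m>0$; $\eta^{\mathbf m}=\prod_{k\le3}(\sqrt2)^{\iota^{m_k}}$; $V=(4\pi^3)^{1/2}$. Temperature modes. $\mathscr P^{m}=\{0\}$ if $m=0$ and $\{0,1\}$ if $m>0$; $\mathscr N_\theta=\{(\mathbf m,\mathbf p,1): m_1,m_2\ge0,\ m_3>0,\ \mathbf p\in\mathscr P^{m_1}\times\mathscr P^{m_2}\}$; $f^{\mathbf n}(\mathbf x)=\frac{\eta^{\mathbf m}}{V}s^{m_1,p_1}(\mathsf k_1x_1)s^{m_2,p_2}(\mathsf k_2x_2)s^{m_3,1}(\mathsf k_3x_3)$. Velocity modes. With $\boldsymbol\gamma=(1,1,-1)$: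 $\mathcal G^{(\mathbf m,\mathbf p,1)}=\mathrm{diag}[\boldsymbol\gamma\times\mathcal K\mathbf m]$, $\mathcal G^{(\mathbf m,\mathbf p,2)}=\mathrm{diag}[\mathcal K\mathbf m\times(\boldsymbol\gamma\times\mathcal K\mathbf m)]$, $\nu_i^{\mathbf n}=\prod_{j\le3}(\iota^{m_j})^{p_j+\delta^{i,j}}$ (exponents mod 2, $0^0=1$), $\varsigma^{\mathbf p}_{1,1}=(-1)^{p_1}$, $\varsigma^{\mathbf p}_{2,2}=(-1)^{p_2}$, $\varsigma^{\mathbf p}_{3,3}=1$, and $$v^{\mathbf n}_i(\mathbf x)=\frac{\eta^{\mathbf m}}{|\mathcal G^{\mathbf n}\boldsymbol\nu^{\mathbf n}|V}\mathcal G^{\mathbf n}_{i,i}\varsigma^{\mathbf p}_{i,i}\prod_{j\le3}s^{m_j,p_j+\delta^{i,j}}(\mathsf k_jx_j).$$ $\mathscr N_{\mathbf u}=\{(\mathbf m,\mathbf p,c):\mathbf m\in\mathbb Z_{\ge0}^3\setminus\{\mathbf 0\},\ \mathbf p\in\mathscr P^{\mathbf m}_{\mathbf u},\ c\in\mathscr C^{\mathbf m}_{\mathbf u}\}$, where $\mathscr P^{\mathbf m}_{\mathbf u}=\{0,1\}\times\{1\}$ if $m_1>0,m_2=m_3=0$; $\{1\}\times\{0,1\}$ if $m_2>0,m_1=m_3=0$; $\{(0,1),(1,0)\}$ if $m_3>0,m_1=m_2=0$; $\{0,1\}^2$ otherwise; $\mathscr C^{\mathbf m}_{\mathbf u}=\{1,2\}$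 if all $m_k>0$, else $\{1\}$. The $f^{\mathbf n}$ are $L^2$-orthonormal; the $\mathbf v^{\mathbf n}$ are $L^2$-orthonormal, divergence-free, with $v_3^{\mathbf n}=0$ at $x_3=0,\pi/\mathsf k_3$. Truncated ODE model. For finite $\mathscr N_{\mathbf u}^\tau\subset\mathscr N_{\mathbf u}$, $\mathscr N_\theta^\tau\subset\mathscr N_\theta$ put $\mathbf u^\tau=\sum_{\mathbf n\in\mathscr N_{\mathbf u}^\tau}u^{\tau,\mathbf n}(t)\mathbf v^{\mathbf n}$, $\theta^\tau=\sum_{\mathbf n\in\mathscr N_\theta^\tau}\theta^{\tau,\mathbf n}(t)f^{\mathbf n}$, $\mathcal P^\tau_{\mathbf u}[\mathbf v]=\sum_{\mathbf n\in\mathscr N_{\mathbf u}^\tau}\langle\mathbf v\cdot\mathbf v^{\mathbf n}\rangle\mathbf v^{\mathbf n}$, $\mathcal P_\theta^\tau[g]=\sum_{\mathbf n\in\mathscr N_\theta^\tau}\langle gf^{\mathbf n}\rangle f^{\mathbf n}$. The model is the ODE system for the coefficients $(u^{\tau,\mathbf n},\theta^{\tau,\mathbf n})\in\mathbb R^{|\mathscr N_{\mathbf u}^\tau|}\times\mathbb R^{|\mathscr N_\theta^\tau|}$ given by $$\partial_t\mathbf u^\tau=\mathsf P\Delta\mathbf u^\tau+\mathsf P\mathsf R\,\mathcal P^\tau_{\mathbf u}[\theta^\tau\hat{\mathbf e}^3]-\mathsf P\mathsf S\,\mathcal P^\tau_{\mathbf u}[\hat{\mathbf e}^3\times\mathbf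 u^\tau]-\mathcal P^\tau_{\mathbf u}[\mathbf u^\tau\cdot\nabla\mathbf u^\tau],$$ $$\partial_t\theta^\tau=\Delta\theta^\tau+\mathcal P^\tau_\theta[u_3^\tau]-\mathcal P^\tau_\theta[\mathbf u^\tau\cdot\nabla\theta^\tau].$$ *)

theory Defs
  imports "HOL-Analysis.Analysis" "HOL-Analysis.Cross3"
begin

text \<open>The horizontal wave numbers \<open>k1, k2\<close> are the free parameters; the third one is normalised
  so that \<open>k1 * k2 * k3 = 1\<close>.\<close>

definition wavenum :: "real \<Rightarrow> real \<Rightarrow> real^3" where
  "wavenum k1 k2 = vector [k1, k2, inverse (k1 * k2)]"

definition Omega :: "real \<Rightarrow> real \<Rightarrow> (real^3) set" where
  "Omega k1 k2 = cbox 0 (vector [2 * pi / k1, 2 * pi / k2, pi / (wavenum k1 k2 $ 3)])"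

definition bracket :: "real \<Rightarrow> real \<Rightarrow> (real^3 \<Rightarrow> real) \<Rightarrow> real" where
  "bracket k1 k2 g = integral (Omega k1 k2) g"

text \<open>All fields below are trigonometric polynomials on the whole of \<open>real^3\<close>, so the full
  derivative makes sense also at boundary points of the domain.\<close>

definition pd :: "3 \<Rightarrow> (real^3 \<Rightarrow> 'b::real_normed_vector) \<Rightarrow> real^3 \<Rightarrow> 'b" where
  "pd i g x = frechet_derivative g (at x) (axis i 1)"

definition laplacian :: "(real^3 \<Rightarrow> 'b::real_normed_vector) \<Rightarrow> real^3 \<Rightarrow> 'b" where
  "laplacian g x = (\<Sum>i\<in>UNIV. pd i (pd i g) x)"

definition advect :: "(real^3 \<Rightarrow> real^3) \<Rightarrow> (real^3 \<Rightarrow> 'b::real_normed_vector) \<Rightarrow> real^3 \<Rightarrow> 'b" where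
  "advect w g x = (\<Sum>i\<in>UNIV. (w x $ i) *\<^sub>R pd i g x)"

definition e3 :: "real^3" where
  "e3 = axis 3 1"

text \<open>An index is \<open>(m, p, c)\<close> with \<open>p = (p1, p2)\<close>; phases are natural numbers read mod 2.\<close>

type_synonym index = "(nat^3) \<times> (nat \<times> nat) \<times> nat"

fun phase :: "nat \<times> nat \<Rightarrow> 3 \<Rightarrow> nat" where
  "phase (p1, p2) j = (if j = 1 then p1 else if j = 2 then p2 else 0)"

definition trig :: "nat \<Rightarrow> nat \<Rightarrow> real \<Rightarrow> real" where
  "trig m p x = (if even p then cos (real m * x) else sin (real m * x))"

definition iota :: "nat \<Rightarrow> nat" where
  "iota m = (if m = 0 then 0 else 1)"

definition eta :: "nat^3 \<Rightarrow> real" where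
  "eta m = (\<Prod>k\<in>UNIV. sqrt 2 ^ iota (m $ k))"

definition Vconst :: real where
  "Vconst = sqrt (4 * pi ^ 3)"

definition diag3 :: "real^3 \<Rightarrow> real^3^3" where
  "diag3 d = (\<chi> i j. if i = j then d $ i else 0)"

definition Kmat :: "real \<Rightarrow> real \<Rightarrow> real^3^3" where
  "Kmat k1 k2 = diag3 (wavenum k1 k2)"

definition Kvec :: "real \<Rightarrow> real \<Rightarrow> nat^3 \<Rightarrow> real^3" where
  "Kvec k1 k2 m = Kmat k1 k2 *v (\<chi> i. real (m $ i))"

definition phases1 :: "nat \<Rightarrow> nat set" where
  "phases1 m = (if m = 0 then {0} else {0, 1})"

definition N_theta :: "index set" where
  "N_theta = {(m, p, c). m $ 3 > 0 \<and> p \<in> phases1 (m $ 1) \<times> phases1 (m $ 2) \<and> c = 1}"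

fun fmode :: "real \<Rightarrow> real \<Rightarrow> index \<Rightarrow> real^3 \<Rightarrow> real" where
  "fmode k1 k2 (m, (p1, p2), c) x =
     eta m / Vconst * trig (m $ 1) p1 (wavenum k1 k2 $ 1 * x $ 1)
       * trig (m $ 2) p2 (wavenum k1 k2 $ 2 * x $ 2)
       * trig (m $ 3) 1 (wavenum k1 k2 $ 3 * x $ 3)"

definition gam :: "real^3" where
  "gam = vector [1, 1, -1]"

fun Gmat :: "real \<Rightarrow> real \<Rightarrow> index \<Rightarrow> real^3^3" where
  "Gmat k1 k2 (m, p, c) =
     (if c = 1 then diag3 (cross3 gam (Kvec k1 k2 m))
      else diag3 (cross3 (Kvec k1 k2 m) (cross3 gam (Kvec k1 k2 m))))"

text \<open>Exponents are reduced mod 2, and \<open>0 ^ 0 = 1\<close>; so \<open>nu n $ i\<close> is 0 exactly when the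
  \<open>i\<close>-th component of the mode contains a factor \<open>sin 0\<close>.\<close>

fun nu :: "index \<Rightarrow> real^3" where
  "nu (m, p, c) =
     (\<chi> i. \<Prod>j\<in>UNIV. real (iota (m $ j)) ^ ((phase p j + of_bool (i = j)) mod 2))"

fun varsig :: "nat \<times> nat \<Rightarrow> real^3^3" where
  "varsig (p1, p2) = diag3 (vector [(-1) ^ p1, (-1) ^ p2, 1])"

fun vmode :: "real \<Rightarrow> real \<Rightarrow> index \<Rightarrow> real^3 \<Rightarrow> real^3" where
  "vmode k1 k2 (m, p, c) x =
     (\<chi> i. eta m / (norm (Gmat k1 k2 (m, p, c) *v nu (m, p, c)) * Vconst)
        * Gmat k1 k2 (m, p, c) $ i $ i * varsig p $ i $ i
        * (\<Prod>j\<in>UNIV. trig (m $ j) (phase p j + of_bool (i = j)) (wavenum k1 k2 $ j * x $ j)))"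

definition phases_u :: "nat^3 \<Rightarrow> (nat \<times> nat) set" where
  "phases_u m =
     (if m $ 1 > 0 \<and> m $ 2 = 0 \<and> m $ 3 = 0 then {0, 1} \<times> {1}
      else if m $ 2 > 0 \<and> m $ 1 = 0 \<and> m $ 3 = 0 then {1} \<times> {0, 1}
      else if m $ 3 > 0 \<and> m $ 1 = 0 \<and> m $ 2 = 0 then {(0, 1), (1, 0)}
      else {0, 1} \<times> {0, 1})"

definition comps_u :: "nat^3 \<Rightarrow> nat set" where
  "comps_u m = (if \<forall>k. m $ k > 0 then {1, 2} else {1})"

definition N_u :: "index set" where
  "N_u = {(m, p, c). m \<noteq> 0 \<and> p \<in> phases_u m \<and> c \<in> comps_u m}"

text \<open>A state is the pair of coefficient families; coefficients outside the truncation are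
  pinned to 0, which makes the phase space a copy of \<open>\<real>\<^bsup>|Nu|\<^esup> \<times> \<real>\<^bsup>|Nt|\<^esup>\<close>.\<close>

type_synonym state = "(index \<Rightarrow> real) \<times> (index \<Rightarrow> real)"

definition phase_space :: "index set \<Rightarrow> index set \<Rightarrow> state set" where
  "phase_space Nu Nt = {(a, b). (\<forall>n. n \<notin> Nu \<longrightarrow> a n = 0) \<and> (\<forall>n. n \<notin> Nt \<longrightarrow> b n = 0)}"

definition state_norm :: "index set \<Rightarrow> index set \<Rightarrow> state \<Rightarrow> real" where
  "state_norm Nu Nt Z = sqrt ((\<Sum>n\<in>Nu. (fst Z n)\<^sup>2) + (\<Sum>n\<in>Nt. (snd Z n)\<^sup>2))"

definition u_field :: "real \<Rightarrow> real \<Rightarrow> index set \<Rightarrow> state \<Rightarrow> real^3 \<Rightarrow> real^3" where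
  "u_field k1 k2 Nu Z x = (\<Sum>n\<in>Nu. fst Z n *\<^sub>R vmode k1 k2 n x)"

definition theta_field :: "real \<Rightarrow> real \<Rightarrow> index set \<Rightarrow> state \<Rightarrow> real^3 \<Rightarrow> real" where
  "theta_field k1 k2 Nt Z x = (\<Sum>n\<in>Nt. snd Z n * fmode k1 k2 n x)"

definition proj_u :: "real \<Rightarrow> real \<Rightarrow> index set \<Rightarrow> (real^3 \<Rightarrow> real^3) \<Rightarrow> real^3 \<Rightarrow> real^3" where
  "proj_u k1 k2 Nu w x = (\<Sum>n\<in>Nu. bracket k1 k2 (\<lambda>y. w y \<bullet> vmode k1 k2 n y) *\<^sub>R vmode k1 k2 n x)"

definition proj_theta :: "real \<Rightarrow> real \<Rightarrow> index set \<Rightarrow> (real^3 \<Rightarrow> real) \<Rightarrow> real^3 \<Rightarrow> real" where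
  "proj_theta k1 k2 Nt g x = (\<Sum>n\<in>Nt. bracket k1 k2 (\<lambda>y. g y * fmode k1 k2 n y) * fmode k1 k2 n x)"

definition rhs_u ::
  "real \<Rightarrow> real \<Rightarrow> real \<Rightarrow> real \<Rightarrow> real \<Rightarrow> index set \<Rightarrow> index set \<Rightarrow> state \<Rightarrow> real^3 \<Rightarrow> real^3" where
  "rhs_u R S P k1 k2 Nu Nt Z x =
     (let u = u_field k1 k2 Nu Z; \<theta> = theta_field k1 k2 Nt Z in
        P *\<^sub>R laplacian u x
        + (P * R) *\<^sub>R proj_u k1 k2 Nu (\<lambda>y. \<theta> y *\<^sub>R e3) x
        - (P * S) *\<^sub>R proj_u k1 k2 Nu (\<lambda>y. cross3 e3 (u y)) x
        - proj_u k1 k2 Nu (advect u u) x)"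

definition rhs_theta ::
  "real \<Rightarrow> real \<Rightarrow> index set \<Rightarrow> index set \<Rightarrow> state \<Rightarrow> real^3 \<Rightarrow> real" where
  "rhs_theta k1 k2 Nu Nt Z x =
     (let u = u_field k1 k2 Nu Z; \<theta> = theta_field k1 k2 Nt Z in
        laplacian \<theta> x
        + proj_theta k1 k2 Nt (\<lambda>y. u y $ 3) x
        - proj_theta k1 k2 Nt (advect u \<theta>) x)"

text \<open>A (forward, global) solution is a curve of coefficients, differentiable on \<open>[0, \<infinity>)\<close>
  (one-sidedly at 0), whose fields satisfy the evolution equations at every point of the domain.
  The values of the curve at negative times are irrelevant.\<close>

definition is_solution ::
  "real \<Rightarrow> real \<Rightarrow> real \<Rightarrow> real \<Rightarrow> real \<Rightarrow> index set \<Rightarrow> index set \<Rightarrow> (real \<Rightarrow> state) \<Rightarrow> bool" where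
  "is_solution R S P k1 k2 Nu Nt X \<longleftrightarrow>
     (\<forall>t\<ge>0. X t \<in> phase_space Nu Nt
        \<and> (\<forall>n\<in>Nu. (\<lambda>s. fst (X s) n) differentiable (at t within {0..}))
        \<and> (\<forall>n\<in>Nt. (\<lambda>s. snd (X s) n) differentiable (at t within {0..}))
        \<and> (\<forall>x\<in>Omega k1 k2.
             ((\<lambda>s. u_field k1 k2 Nu (X s) x) has_vector_derivative
                rhs_u R S P k1 k2 Nu Nt (X t) x) (at t within {0..})
           \<and> ((\<lambda>s. theta_field k1 k2 Nt (X s) x) has_real_derivative
                rhs_theta k1 k2 Nu Nt (X t) x) (at t within {0..})))"

definition smooth_nonneg :: "(real \<Rightarrow> real) \<Rightarrow> bool" where
  "smooth_nonneg g \<longleftrightarrow>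
     (\<exists>D :: nat \<Rightarrow> real \<Rightarrow> real. (\<forall>t\<ge>0. D 0 t = g t) \<and>
        (\<forall>k. \<forall>t\<ge>0. (D k has_real_derivative D (Suc k) t) (at t within {0..})))"

definition smooth_curve :: "(real \<Rightarrow> state) \<Rightarrow> bool" where
  "smooth_curve X \<longleftrightarrow> (\<forall>n. smooth_nonneg (\<lambda>t. fst (X t) n) \<and> smooth_nonneg (\<lambda>t. snd (X t) n))"

text \<open>The solution semigroup: the value at time \<open>t\<close> of a solution starting at \<open>X0\<close>.  The
  description is meaningful only once existence and uniqueness of that value are known.\<close>

definition semiflow ::
  "real \<Rightarrow> real \<Rightarrow> real \<Rightarrow> real \<Rightarrow> real \<Rightarrow> index set \<Rightarrow> index set \<Rightarrow> real \<Rightarrow> state \<Rightarrow> state" where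
  "semiflow R S P k1 k2 Nu Nt t X0 =
     (THE Z. \<exists>X. is_solution R S P k1 k2 Nu Nt X \<and> X 0 = X0 \<and> Z = X t)"

definition is_semigroup_on :: "state set \<Rightarrow> (real \<Rightarrow> state \<Rightarrow> state) \<Rightarrow> bool" where
  "is_semigroup_on H T \<longleftrightarrow>
     (\<forall>Z\<in>H. T 0 Z = Z \<and> (\<forall>t\<ge>0. T t Z \<in> H \<and> (\<forall>s\<ge>0. T (s + t) Z = T s (T t Z))))"

definition origin_globally_exp_attractive ::
  "index set \<Rightarrow> index set \<Rightarrow> (real \<Rightarrow> state \<Rightarrow> state) \<Rightarrow> bool" where
  "origin_globally_exp_attractive Nu Nt T \<longleftrightarrow>
     (\<exists>C>0. \<exists>\<alpha>>0. \<forall>Z\<in>phase_space Nu Nt. \<forall>t\<ge>0.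
        state_norm Nu Nt (T t Z) \<le> C * exp (- \<alpha> * t) * state_norm Nu Nt Z)"

text \<open>The minimum has no meaning when both index sets are empty; the phase space is then a
  single point.\<close>

definition lambda1 :: "real \<Rightarrow> real \<Rightarrow> index set \<Rightarrow> index set \<Rightarrow> real" where
  "lambda1 k1 k2 Nu Nt = Min ((\<lambda>(m, p, c). norm (Kvec k1 k2 m)) ` (Nu \<union> Nt))"

end

theory Submission
  imports Defs "HOL-Probability.Discrete_Topology"
begin

text \<open>Because the modes are orthonormal, the evolution equations for the fields amount to an ODE
  with a quadratic right-hand side for the coefficients.  The fields \<open>u\<close> are divergence free and
  do not cross the horizontal walls, so advection is skew-symmetric and drops out of the balance of
  \<open>\<bar>u\<bar>\<^sup>2 / P + \<beta> * \<bar>\<theta>\<bar>\<^sup>2\<close>, as does the rotation; what is left is the dissipation and the buoyancy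
  coupling.  This a priori bound excludes blow-up, and for \<open>R < lambda1 ^ 4\<close> and a suitable \<open>\<beta>\<close> the
  dissipation dominates the coupling, which gives exponential decay.\<close>

section \<open>Polynomial differential equations with an energy inequality\<close>

text \<open>The threshold comes from optimising the weights. The same buoyancy matrix couples both
  equations, so the weights \<open>1 / P\<close> and \<open>\<beta>\<close> merge the two couplings
  into \<open>R + \<beta>\<close> times one flux. With U and Theta the two squared norms, Young's
  inequality bounds that flux by \<open>1 / (2 * sqrt \<beta>)\<close> times U + \<beta> Theta,
  while the dissipation is at least \<open>lambda1\<^sup>2\<close> times the same form. The ratio
  \<open>(R + \<beta>) / (2 * sqrt \<beta>)\<close> is least at \<open>\<beta> = R\<close>, which
  gives \<open>sqrt R < lambda1\<^sup>2\<close>; that choice degenerates at \<open>R = 0\<close>, so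
  a larger \<open>\<beta>\<close> is taken. Existence requires no smallness:
  \<open>\<beta> = 1\<close> suffices and the dissipation is discarded. Three obstacles shape the
  rest. A quadratic field is not globally Lipschitz, so Picard iteration is run on a clamped and
  cut-off field. A finite index set is not a type, so states are functions on all indices that
  vanish off the set. And \<open>is_solution\<close> speaks of fields at points of
  \<open>Omega\<close>; returning to coefficients takes orthonormality for every admissible index,
  including that no normalising denominator vanishes.\<close>

lemma gronwall:
  fixes E E' :: "real \<Rightarrow> real"
  assumes der: "\<And>t. 0 \<le> t \<Longrightarrow> t \<le> T \<Longrightarrow> (E has_real_derivative E' t) (at t within {0..T})"
    and le: "\<And>t. 0 \<le> t \<Longrightarrow> t \<le> T \<Longrightarrow> E' t \<le> c * E t"
    and t: "0 \<le> t" "t \<le> T"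
  shows "E t \<le> exp (c * t) * E 0"
proof -
  \<comment> \<open>The integrating factor leaves the sign of \<open>c\<close> free: growth bounds
    use a nonnegative \<open>c\<close>, exponential decay a negative one.\<close>
  define g where "g s = exp (- c * s) * E s" for s
  have g: "(g has_real_derivative exp (- c * s) * (E' s - c * E s)) (at s within {0..T})"
    if "0 \<le> s" "s \<le> T" for s
    unfolding g_def
    by (rule derivative_eq_intros der that refl)+ (auto simp: algebra_simps)
  have "continuous_on {0..t} g"
    by (rule continuous_on_subset[OF DERIV_continuous_on[OF g]]) (use t in auto)
  moreover have "(g has_real_derivative exp (- c * s) * (E' s - c * E s)) (at s)"
    if "0 < s" "s < t" for s
    using g[of s] that t by (simp add: at_within_Icc_at)
  moreover have "exp (- c * s) * (E' s - c * E s) \<le> 0" if "0 < s" "s < t" for s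
    using le[of s] that t by (simp add: mult_nonneg_nonpos)
  ultimately have "g t \<le> g 0"
    using t by (intro DERIV_nonpos_imp_decreasing_open[of 0 t g]) blast+
  then have "exp (c * t) * g t \<le> exp (c * t) * E 0"
    by (simp add: g_def)
  then show ?thesis
    by (simp add: g_def mult.assoc[symmetric] exp_add[symmetric])
qed

text \<open>The weight \<open>exp (- K t)\<close> with \<open>K\<close> above the Lipschitz constant makes the Picard operator a
  contraction on an interval of any length.\<close>

lemma picard_lipschitz:
  fixes f :: "'a::banach \<Rightarrow> 'a"
  assumes lip: "\<And>x y. dist (f x) (f y) \<le> L * dist x y" and L: "0 \<le> L" and T: "0 \<le> T"
  shows "\<exists>z. z 0 = z0 \<and> (\<forall>t\<in>{0..T}. (z has_vector_derivative f (z t)) (at t within {0..T}))"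
proof -
  \<comment> \<open>\<open>K \<ge> 2 * L\<close> brings the contraction factor \<open>L / K\<close>
    down to 1/2; the \<open>+ 1\<close> keeps \<open>K\<close> positive for
    \<open>L = 0\<close>.\<close>
  define K where "K = 2 * L + 1"
  have K: "K > 0" "2 * L \<le> K" using L by (auto simp: K_def)
  have contf: "continuous_on S f" for S
    using L lip by (intro lipschitz_on_continuous_on[of L] lipschitz_onI) auto
  \<comment> \<open>A fixed point \<open>g\<close> will stand for \<open>exp (- K * s)\<close> times
    the solution, so that the weighted norm becomes the plain sup norm of bounded continuous
    functions; \<open>F\<close> undoes the weight.\<close>
  define F where "F g s = f (exp (K * s) *\<^sub>R apply_bcontfun g s)" for g :: "real \<Rightarrow>\<^sub>C 'a" and s
  have contF: "continuous_on S (F g)" for g S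
    unfolding F_def
    by (rule continuous_on_compose2[OF contf[of UNIV]]) (auto intro!: continuous_intros)
  have intF: "F g integrable_on {a..b}" for g a b
    by (intro integrable_continuous_real contF)
  define H where "H g t = exp (- K * t) *\<^sub>R (z0 + integral {0..t} (F g))" for g t
  have contH: "continuous_on {0..T} (H g)" for g
    unfolding H_def by (intro continuous_intros indefinite_integral_continuous_1 intF)
  \<comment> \<open>Elements of the function space live on the whole line, so the Picard image is
    continued by its end values outside \<open>{0..T}\<close>.\<close>
  define c where "c t = max 0 (min T t)" for t
  have c: "c t \<in> {0..T}" for t using T by (auto simp: c_def)
  have contHc: "continuous_on UNIV (\<lambda>t. H g (c t))" for g
    by (rule continuous_on_compose2[OF contH]) (use c in \<open>auto simp: c_def intro!: continuous_intros\<close>)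
  have "compact (H g ` {0..T})" for g
    using contH by (intro compact_continuous_image) auto
  then have "bounded (H g ` {0..T})" for g by (rule compact_imp_bounded)
  then have bddH: "bounded (range (\<lambda>t. H g (c t)))" for g
    by (rule bounded_subset) (use c in auto)
  define \<Phi> where "\<Phi> g = Bcontfun (\<lambda>t. H g (c t))" for g
  have \<Phi>: "apply_bcontfun (\<Phi> g) t = H g (c t)" for g t
    unfolding \<Phi>_def using contHc bddH by (subst Bcontfun_inverse) (auto simp: bcontfun_def)
  have contr: "dist (\<Phi> g) (\<Phi> h) \<le> 1/2 * dist g h" for g h
  proof (rule dist_bound)
    fix t
    define s where "s = c t"
    have s: "0 \<le> s" "s \<le> T" using c[of t] by (auto simp: s_def)
    have "norm (integral {0..s} (\<lambda>r. F g r - F h r)) \<le> integral {0..s} (\<lambda>r. L * exp (K * r) * dist g h)"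
    proof (rule integral_norm_bound_integral)
      show "(\<lambda>r. F g r - F h r) integrable_on {0..s}" by (intro integrable_diff intF)
      show "(\<lambda>r. L * exp (K * r) * dist g h) integrable_on {0..s}"
        by (intro integrable_continuous_real continuous_intros)
      fix r assume "r \<in> {0..s}"
      have "norm (F g r - F h r) \<le> L * dist (exp (K * r) *\<^sub>R g r) (exp (K * r) *\<^sub>R h r)"
        unfolding F_def using lip by (simp add: dist_norm)
      also have "\<dots> = L * exp (K * r) * dist (g r) (h r)"
        by (simp add: dist_norm scaleR_diff_right[symmetric])
      also have "\<dots> \<le> L * exp (K * r) * dist g h"
        using L by (intro mult_left_mono dist_bounded) auto
      finally show "norm (F g r - F h r) \<le> L * exp (K * r) * dist g h" .
    qed
    also have "integral {0..s} (\<lambda>r. L * exp (K * r) * dist g h) = L * (exp (K * s) - 1) / K * dist g h"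
    proof -
      have "((\<lambda>r. L * exp (K * r) * dist g h) has_integral
          L * exp (K * s) / K * dist g h - L * exp (K * 0) / K * dist g h) {0..s}"
        using s K by (intro fundamental_theorem_of_calculus)
         (auto simp: has_real_derivative_iff_has_vector_derivative[symmetric] intro!: derivative_eq_intros)
      then show ?thesis by (subst integral_unique) (auto simp: algebra_simps diff_divide_distrib)
    qed
    also have "\<dots> \<le> L * exp (K * s) / K * dist g h"
      using L K by (intro mult_right_mono divide_right_mono mult_left_mono) auto
    finally have *: "norm (integral {0..s} (\<lambda>r. F g r - F h r)) \<le> L * exp (K * s) / K * dist g h" .
    have "dist (\<Phi> g t) (\<Phi> h t) = exp (- K * s) * norm (integral {0..s} (\<lambda>r. F g r - F h r))"
      by (simp add: \<Phi> H_def s_def[symmetric] dist_norm scaleR_diff_right[symmetric] integral_diff[OF intF intF])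
    also have "\<dots> \<le> exp (- K * s) * (L * exp (K * s) / K * dist g h)"
      by (intro mult_left_mono *) auto
    also have "\<dots> = L / K * dist g h" by (simp add: exp_minus field_simps)
    also have "\<dots> \<le> 1/2 * dist g h"
      using K by (intro mult_right_mono) (auto simp: field_simps)
    finally show "dist (\<Phi> g t) (\<Phi> h t) \<le> 1/2 * dist g h" .
  qed
  then obtain g where g: "\<Phi> g = g" using banach_fix_type[of "1/2" \<Phi>] by auto
  define z where "z t = z0 + integral {0..t} (F g)" for t
  have "apply_bcontfun g t = exp (- K * t) *\<^sub>R z t" if "t \<in> {0..T}" for t
  proof -
    have "c t = t" using that by (auto simp: c_def)
    then show ?thesis using \<Phi>[of g t] g by (simp add: H_def z_def)
  qed
  then have Fz: "F g t = f (z t)" if "t \<in> {0..T}" for t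
    using that by (simp add: F_def exp_add[symmetric])
  have "(z has_vector_derivative f (z t)) (at t within {0..T})" if "t \<in> {0..T}" for t
    unfolding z_def
    using integral_has_vector_derivative[OF contF that, of g] Fz[OF that]
    by (auto simp: z_def intro!: derivative_eq_intros)
  moreover have "z 0 = z0" by (simp add: z_def)
  ultimately show ?thesis by blast
qed

instance bcontfun :: (metric_space, banach) banach ..

text \<open>The coordinate space over \<open>I\<close> is realised inside the Banach space of
  bounded functions on the discrete copy of \<open>'i\<close>, where every function is continuous.
  Its sup norm turns the coordinatewise Lipschitz hypothesis into that of
  \<open>picard_lipschitz\<close>.\<close>

lemma picard_coordinates:
  fixes G :: "'i \<Rightarrow> ('i \<Rightarrow> real) \<Rightarrow> real"
  assumes I: "finite I" and T: "0 \<le> T" and z0: "\<And>i. i \<notin> I \<Longrightarrow> z0 i = 0"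
    and lip: "\<And>i y z d. i \<in> I \<Longrightarrow> (\<And>j. \<bar>y j - z j\<bar> \<le> d) \<Longrightarrow> \<bar>G i y - G i z\<bar> \<le> L * d"
    and L: "0 \<le> L"
  shows "\<exists>z. z 0 = z0 \<and> (\<forall>t\<in>{0..T}. (\<forall>i. i \<notin> I \<longrightarrow> z t i = 0) \<and>
     (\<forall>i\<in>I. ((\<lambda>s. z s i) has_real_derivative G i (z t)) (at t within {0..T})))"
proof -
  have cont: "continuous_on UNIV (h :: 'i discrete \<Rightarrow> real)" for h
    by (simp add: continuous_on_open_vimage open_discrete)
  \<comment> \<open>Values off \<open>I\<close> are set to 0: the range is then finite, hence
    bounded, and the coordinates off \<open>I\<close> get derivative 0.\<close>
  define B where "B h = Bcontfun (\<lambda>i. if of_discrete i \<in> I then h (of_discrete i) else 0)"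
    for h :: "'i \<Rightarrow> real"
  have B: "apply_bcontfun (B h) i = (if of_discrete i \<in> I then h (of_discrete i) else 0)" for h i
  proof -
    have "finite (range (\<lambda>i. if of_discrete i \<in> I then h (of_discrete i) else 0))"
      by (rule finite_subset[of _ "insert 0 (h ` I)"]) (use I in auto)
    then show ?thesis unfolding B_def using cont
      by (subst Bcontfun_inverse) (auto simp: bcontfun_def finite_imp_bounded)
  qed
  define f where "f x = B (\<lambda>i. G i (\<lambda>j. apply_bcontfun x (discrete j)))" for x
  have "dist (f x) (f y) \<le> L * dist x y" for x y
  proof (rule dist_bound)
    fix i
    have "\<bar>apply_bcontfun x j - apply_bcontfun y j\<bar> \<le> dist x y" for j
      using dist_bounded[of x j y] by (simp add: dist_real_def)
    then show "dist (apply_bcontfun (f x) i) (apply_bcontfun (f y) i) \<le> L * dist x y"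
      using L by (auto simp: f_def B dist_real_def intro!: lip)
  qed
  from picard_lipschitz[OF this L T, of "B z0"] obtain x where x0: "x 0 = B z0"
    and x: "\<And>t. t \<in> {0..T} \<Longrightarrow> (x has_vector_derivative f (x t)) (at t within {0..T})" by blast
  define z where "z t i = apply_bcontfun (x t) (discrete i)" for t i
  have bl: "bounded_linear (\<lambda>x. apply_bcontfun x (i :: 'i discrete) :: real)" for i
    by (rule bounded_linear_intro[where K=1]) (use norm_bounded[where 'b=real, of _ i] in auto)
  have der: "((\<lambda>s. z s i) has_real_derivative (if i \<in> I then G i (z t) else 0)) (at t within {0..T})"
    if "t \<in> {0..T}" for t i
    unfolding z_def has_real_derivative_iff_has_vector_derivative
    using bounded_linear.has_vector_derivative[OF bl x[OF that], of "discrete i"]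
    by (cases "i \<in> I") (simp_all add: f_def B discrete_inverse)
  have z0': "z 0 = z0"
    using z0 by (auto simp: z_def x0 B discrete_inverse)
  have "z t i = 0" if "t \<in> {0..T}" "i \<notin> I" for t i
  proof -
    have "((\<lambda>s. z s i) has_derivative (\<lambda>_. 0)) (at s within {0..T})" if "s \<in> {0..T}" for s
      using der[OF that, of i] \<open>i \<notin> I\<close> unfolding lambda_zero by (simp add: has_field_derivative_def)
    then obtain k where "\<And>s. s \<in> {0..T} \<Longrightarrow> z s i = k"
      using has_derivative_zero_constant[of "{0..T}" "\<lambda>s. z s i"] by auto
    then have "z t i = z 0 i" using that T by auto
    then show ?thesis using z0' z0 that by simp
  qed
  moreover have "((\<lambda>s. z s i) has_real_derivative G i (z t)) (at t within {0..T})"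
    if "t \<in> {0..T}" "i \<in> I" for t i
    using der[OF that(1), of i] that by simp
  ultimately show ?thesis using z0' by blast
qed

section \<open>Polynomial vector fields, clamping and cut-offs\<close>

inductive polyfun :: "(('i \<Rightarrow> real) \<Rightarrow> real) \<Rightarrow> bool" where
  const: "polyfun (\<lambda>z. c)"
| coord: "polyfun (\<lambda>z. z j)"
| add: "polyfun p \<Longrightarrow> polyfun q \<Longrightarrow> polyfun (\<lambda>z. p z + q z)"
| mult: "polyfun p \<Longrightarrow> polyfun q \<Longrightarrow> polyfun (\<lambda>z. p z * q z)"

lemma polyfun_cmult: "polyfun p \<Longrightarrow> polyfun (\<lambda>z. c * p z)"
  by (intro polyfun.mult polyfun.const)

lemma polyfun_diff: "polyfun p \<Longrightarrow> polyfun q \<Longrightarrow> polyfun (\<lambda>z. p z - q z)"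
  using polyfun.add[OF _ polyfun_cmult[of q "-1"]] by simp

lemma polyfun_sum: "(\<And>k. k \<in> A \<Longrightarrow> polyfun (p k)) \<Longrightarrow> polyfun (\<lambda>z. \<Sum>k\<in>A. p k z)"
  by (induction A rule: infinite_finite_induct) (auto intro: polyfun.intros)

text \<open>Boundedness is part of the notion because a product of Lipschitz functions is controlled
  through bounds on its factors. Distances enter as a uniform bound \<open>d\<close>, since a
  supremum over an infinite index type may fail to exist.\<close>

definition bdd_lip :: "(('i \<Rightarrow> real) \<Rightarrow> real) \<Rightarrow> bool" where
  "bdd_lip g \<longleftrightarrow> (\<exists>B. \<forall>z. \<bar>g z\<bar> \<le> B) \<and>
     (\<exists>L\<ge>0. \<forall>y z d. (\<forall>j. \<bar>y j - z j\<bar> \<le> d) \<longrightarrow> \<bar>g y - g z\<bar> \<le> L * d)"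

lemma bdd_lip_const: "bdd_lip (\<lambda>z. c)"
proof -
  have "\<bar>c - c\<bar> \<le> 0 * d" for d by simp
  then show ?thesis unfolding bdd_lip_def by (metis order_refl)
qed

lemma bdd_lip_add:
  assumes "bdd_lip p" "bdd_lip q" shows "bdd_lip (\<lambda>z. p z + q z)"
proof -
  obtain B L where p: "\<And>z. \<bar>p z\<bar> \<le> B" "L \<ge> 0"
    "\<And>y z d. (\<And>j. \<bar>y j - z j\<bar> \<le> d) \<Longrightarrow> \<bar>p y - p z\<bar> \<le> L * d" using assms(1) unfolding bdd_lip_def by blast
  obtain B' L' where q: "\<And>z. \<bar>q z\<bar> \<le> B'" "L' \<ge> 0"
    "\<And>y z d. (\<And>j. \<bar>y j - z j\<bar> \<le> d) \<Longrightarrow> \<bar>q y - q z\<bar> \<le> L' * d" using assms(2) unfolding bdd_lip_def by blast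
  have "\<bar>p z + q z\<bar> \<le> B + B'" for z using p(1)[of z] q(1)[of z] by linarith
  moreover have "\<bar>p y + q y - (p z + q z)\<bar> \<le> (L + L') * d" if "\<forall>j. \<bar>y j - z j\<bar> \<le> d" for y z d
    using p(3)[of y z d] q(3)[of y z d] that by (auto simp: distrib_right)
  moreover have "L + L' \<ge> 0" using p q by simp
  ultimately show ?thesis unfolding bdd_lip_def by blast
qed

lemma bdd_lip_mult:
  assumes "bdd_lip p" "bdd_lip q" shows "bdd_lip (\<lambda>z. p z * q z)"
proof -
  obtain B L where p: "\<And>z. \<bar>p z\<bar> \<le> B" "L \<ge> 0"
    "\<And>y z d. (\<And>j. \<bar>y j - z j\<bar> \<le> d) \<Longrightarrow> \<bar>p y - p z\<bar> \<le> L * d" using assms(1) unfolding bdd_lip_def by blast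
  obtain B' L' where q: "\<And>z. \<bar>q z\<bar> \<le> B'" "L' \<ge> 0"
    "\<And>y z d. (\<And>j. \<bar>y j - z j\<bar> \<le> d) \<Longrightarrow> \<bar>q y - q z\<bar> \<le> L' * d" using assms(2) unfolding bdd_lip_def by blast
  have B: "B \<ge> 0" "B' \<ge> 0" using p(1)[of undefined] q(1)[of undefined] by linarith+
  have "\<bar>p z * q z\<bar> \<le> B * B'" for z
    unfolding abs_mult using B by (intro mult_mono p q) auto
  moreover have "\<bar>p y * q y - p z * q z\<bar> \<le> (B * L' + L * B') * d" if "\<forall>j. \<bar>y j - z j\<bar> \<le> d" for y z d
  proof -
    have d: "0 \<le> d" using that[rule_format, of undefined] by linarith
    have "p y * q y - p z * q z = p y * (q y - q z) + (p y - p z) * q z" by (simp add: algebra_simps)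
    also have "\<bar>\<dots>\<bar> \<le> \<bar>p y\<bar> * \<bar>q y - q z\<bar> + \<bar>p y - p z\<bar> * \<bar>q z\<bar>"
      by (metis abs_mult abs_triangle_ineq)
    also have "\<dots> \<le> B * (L' * d) + (L * d) * B'"
      using B p(2) q(2) d that by (intro add_mono mult_mono p q) auto
    finally show ?thesis by (simp add: algebra_simps)
  qed
  moreover have "B * L' + L * B' \<ge> 0" using p q B by simp
  ultimately show ?thesis unfolding bdd_lip_def by blast
qed

definition box_clamp :: "real \<Rightarrow> ('i \<Rightarrow> real) \<Rightarrow> 'i \<Rightarrow> real" where
  "box_clamp \<rho> z j = max (- \<rho>) (min \<rho> (z j))"

lemma box_clamp_id: "(\<And>j. \<bar>z j\<bar> \<le> \<rho>) \<Longrightarrow> box_clamp \<rho> z = z"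
proof (rule ext)
  fix j assume "\<And>j. \<bar>z j\<bar> \<le> \<rho>"
  then have "\<bar>z j\<bar> \<le> \<rho>" .
  then show "box_clamp \<rho> z j = z j" by (auto simp: box_clamp_def)
qed

text \<open>Clamping confines the argument to a box, on which a polynomial is bounded and Lipschitz
  although in general it is neither globally.\<close>

lemma bdd_lip_polyfun:
  assumes "polyfun p" shows "bdd_lip (\<lambda>z. p (box_clamp \<rho> z))"
  using assms
proof induction
  case (coord j)
  have "\<bar>box_clamp \<rho> z j\<bar> \<le> \<bar>\<rho>\<bar>" for z :: "'a \<Rightarrow> real" by (auto simp: box_clamp_def)
  moreover have "\<bar>box_clamp \<rho> y j - box_clamp \<rho> z j\<bar> \<le> 1 * d" if "\<forall>j. \<bar>y j - z j\<bar> \<le> d" for y z d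
    using that[rule_format, of j] by (auto simp: box_clamp_def min_def max_def abs_le_iff)
  ultimately show ?case unfolding bdd_lip_def by (meson zero_le_one)
qed (auto intro: bdd_lip_const bdd_lip_add bdd_lip_mult)

lemma bdd_lip_cut:
  assumes "bdd_lip p" shows "bdd_lip (\<lambda>z. max 0 (min 1 (p z)))"
proof -
  obtain L where p: "L \<ge> 0"
    "\<And>y z d. (\<And>j. \<bar>y j - z j\<bar> \<le> d) \<Longrightarrow> \<bar>p y - p z\<bar> \<le> L * d" using assms unfolding bdd_lip_def by blast
  have "\<bar>max 0 (min 1 (p y)) - max 0 (min 1 (p z))\<bar> \<le> L * d" if "\<forall>j. \<bar>y j - z j\<bar> \<le> d" for y z d
  proof -
    have "\<bar>max 0 (min 1 (p y)) - max 0 (min 1 (p z))\<bar> \<le> \<bar>p y - p z\<bar>"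
      by (auto simp: min_def max_def)
    then show ?thesis using p(2)[of y z d] that by auto
  qed
  moreover have "\<bar>max 0 (min 1 (p z))\<bar> \<le> 1" for z by auto
  ultimately show ?thesis unfolding bdd_lip_def using p(1) by blast
qed

lemma bdd_lip_uniform:
  assumes "finite I" "\<forall>i\<in>I. bdd_lip (G i)"
  shows "\<exists>L\<ge>0. \<forall>i\<in>I. \<forall>y z d. (\<forall>j. \<bar>y j - z j\<bar> \<le> d) \<longrightarrow> \<bar>G i y - G i z\<bar> \<le> L * d"
proof -
  have "\<forall>i\<in>I. \<exists>L\<ge>0. \<forall>y z d. (\<forall>j. \<bar>y j - z j\<bar> \<le> d) \<longrightarrow> \<bar>G i y - G i z\<bar> \<le> L * d"
    using assms unfolding bdd_lip_def by blast
  then obtain L where L: "\<And>i. i \<in> I \<Longrightarrow> L i \<ge> 0"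
    "\<And>i y z d. i \<in> I \<Longrightarrow> (\<forall>j. \<bar>y j - z j\<bar> \<le> d) \<Longrightarrow> \<bar>G i y - G i z\<bar> \<le> L i * d" by metis
  have "\<bar>G i y - G i z\<bar> \<le> sum L I * d" if "i \<in> I" "\<forall>j. \<bar>y j - z j\<bar> \<le> d" for i y z d
  proof -
    have "0 \<le> d" using that(2)[rule_format, of undefined] by linarith
    moreover have "L i \<le> sum L I" using assms(1) that L by (intro member_le_sum) auto
    ultimately have "L i * d \<le> sum L I * d" by (rule mult_right_mono[rotated])
    then show ?thesis using L(2)[OF that] by linarith
  qed
  moreover have "sum L I \<ge> 0" using L by (intro sum_nonneg) auto
  ultimately show ?thesis by blast
qed


text \<open>\<open>q\<close> is the Lie derivative of \<open>p\<close> along \<open>F\<close>, again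
  a polynomial. It is chosen before the trajectory and can therefore be iterated; the arbitrary set
  \<open>S\<close> covers one-sided derivatives.\<close>

lemma polyfun_lie_derivative:
  assumes p: "polyfun p" and F: "\<forall>i. polyfun (F i)"
  shows "\<exists>q. polyfun q \<and> (\<forall>x t S. (\<forall>i. ((\<lambda>s. x s i) has_real_derivative F i (x t)) (at t within S)) \<longrightarrow>
     ((\<lambda>s. p (x s)) has_real_derivative q (x t)) (at t within S))"
  using p
proof induction
  case (const c)
  show ?case by (rule exI[of _ "\<lambda>_. 0"]) (auto intro: polyfun.const)
next
  case (coord j)
  show ?case using F by (intro exI[of _ "F j"]) auto
next
  case (add p q)
  then obtain p' q' where *: "polyfun p'" "polyfun q'"
    "\<And>x t S. (\<forall>i. ((\<lambda>s. x s i) has_real_derivative F i (x t)) (at t within S)) \<Longrightarrow>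
       ((\<lambda>s. p (x s)) has_real_derivative p' (x t)) (at t within S)"
    "\<And>x t S. (\<forall>i. ((\<lambda>s. x s i) has_real_derivative F i (x t)) (at t within S)) \<Longrightarrow>
       ((\<lambda>s. q (x s)) has_real_derivative q' (x t)) (at t within S)" by metis
  show ?case
    by (rule exI[of _ "\<lambda>z. p' z + q' z"]) (auto intro!: polyfun.intros * DERIV_add)
next
  case (mult p q)
  then obtain p' q' where *: "polyfun p'" "polyfun q'"
    "\<And>x t S. (\<forall>i. ((\<lambda>s. x s i) has_real_derivative F i (x t)) (at t within S)) \<Longrightarrow>
       ((\<lambda>s. p (x s)) has_real_derivative p' (x t)) (at t within S)"
    "\<And>x t S. (\<forall>i. ((\<lambda>s. x s i) has_real_derivative F i (x t)) (at t within S)) \<Longrightarrow>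
       ((\<lambda>s. q (x s)) has_real_derivative q' (x t)) (at t within S)" by metis
  show ?case
    by (rule exI[of _ "\<lambda>z. p' z * q z + q' z * p z"])
       (use mult.hyps in \<open>auto intro!: polyfun.intros * DERIV_mult\<close>)
qed

section \<open>Well-posedness of polynomial systems\<close>

definition solves_on :: "real set \<Rightarrow> 'i set \<Rightarrow> ('i \<Rightarrow> ('i \<Rightarrow> real) \<Rightarrow> real) \<Rightarrow> (real \<Rightarrow> 'i \<Rightarrow> real) \<Rightarrow> bool" where
  "solves_on J I F x \<longleftrightarrow> (\<forall>t\<in>J. (\<forall>i. i \<notin> I \<longrightarrow> x t i = 0) \<and>
     (\<forall>i\<in>I. ((\<lambda>s. x s i) has_real_derivative F i (x t)) (at t within J)))"

lemma solves_on_subset: "solves_on J I F x \<Longrightarrow> J' \<subseteq> J \<Longrightarrow> solves_on J' I F x"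
  unfolding solves_on_def by (blast intro: DERIV_subset)

text \<open>On a compact interval both trajectories stay in one box, where clamping is invisible and
  the field is Lipschitz; Gronwall for the squared distance then keeps it at 0.\<close>

lemma solves_on_unique:
  assumes I: "finite I" and F: "\<And>i. i \<in> I \<Longrightarrow> polyfun (F i)"
    and x: "solves_on {0..T} I F x" and y: "solves_on {0..T} I F y" and eq: "x 0 = y 0"
    and t: "t \<in> {0..T}"
  shows "x t = y t"
proof -
  have bdd: "\<exists>B. \<forall>s\<in>{0..T}. \<bar>z s i\<bar> \<le> B" if "solves_on {0..T} I F z" "i \<in> I" for z i
  proof -
    have "continuous_on {0..T} (\<lambda>s. z s i)"
      by (rule DERIV_continuous_on) (use that in \<open>auto simp: solves_on_def\<close>)
    then have "compact ((\<lambda>s. z s i) ` {0..T})" by (intro compact_continuous_image) auto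
    then show ?thesis by (force dest: compact_imp_bounded simp: bounded_iff)
  qed
  have "\<exists>B. \<forall>s\<in>{0..T}. \<forall>i. \<bar>z s i\<bar> \<le> B" if z: "solves_on {0..T} I F z" for z
  proof -
    from bdd[OF z] obtain B where B: "\<And>i s. i \<in> I \<Longrightarrow> s \<in> {0..T} \<Longrightarrow> \<bar>z s i\<bar> \<le> B i" by metis
    have "\<bar>z s i\<bar> \<le> (\<Sum>i\<in>I. \<bar>B i\<bar>)" if s: "s \<in> {0..T}" for s i
    proof (cases "i \<in> I")
      case True
      then have "\<bar>z s i\<bar> \<le> \<bar>B i\<bar>" using B[OF True s] by linarith
      also have "\<dots> \<le> (\<Sum>i\<in>I. \<bar>B i\<bar>)" using I True by (intro member_le_sum) auto
      finally show ?thesis .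
    next
      case False
      then have "z s i = 0" using z s by (auto simp: solves_on_def)
      then show ?thesis by (simp add: sum_nonneg)
    qed
    then show ?thesis by blast
  qed
  then obtain B B' where B: "\<And>s i. s \<in> {0..T} \<Longrightarrow> \<bar>x s i\<bar> \<le> B" "\<And>s i. s \<in> {0..T} \<Longrightarrow> \<bar>y s i\<bar> \<le> B'"
    using x y by metis
  define \<rho> where "\<rho> = max B B'"
  have \<rho>: "box_clamp \<rho> (x s) = x s" "box_clamp \<rho> (y s) = y s" if "s \<in> {0..T}" for s
    using B[OF that] by (auto intro!: box_clamp_id simp: \<rho>_def le_max_iff_disj)
  have "\<forall>i\<in>I. bdd_lip (\<lambda>z. F i (box_clamp \<rho> z))"
    by (auto intro: bdd_lip_polyfun F)
  from bdd_lip_uniform[OF I this]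
  obtain L where L: "L \<ge> 0" "\<forall>i\<in>I. \<forall>y z d. (\<forall>j. \<bar>y j - z j\<bar> \<le> d) \<longrightarrow>
      \<bar>F i (box_clamp \<rho> y) - F i (box_clamp \<rho> z)\<bar> \<le> L * d" by (elim exE conjE)
  define D where "D s = (\<Sum>i\<in>I. (x s i - y s i)\<^sup>2)" for s
  have D0: "D s \<ge> 0" for s by (auto simp: D_def intro: sum_nonneg)
  have comp: "\<bar>x s i - y s i\<bar> \<le> sqrt (D s)" if "s \<in> {0..T}" for s i
  proof (cases "i \<in> I")
    case True
    then have "(x s i - y s i)\<^sup>2 \<le> D s"
      unfolding D_def using I by (intro member_le_sum) auto
    then show ?thesis by (simp add: real_le_rsqrt)
  next
    case False
    then show ?thesis using x y that by (auto simp: solves_on_def D0)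
  qed
  \<comment> \<open>Each of the \<open>card I\<close> terms of the derivative is at most
    \<open>2 * L * D s\<close>: the coordinate differences are bounded by \<open>sqrt (D s)\<close>,
    those of the fields by \<open>L\<close> times that.\<close>
  have "D t \<le> exp ((2 * L * card I) * t) * D 0"
  proof (rule gronwall)
    fix s assume s: "0 \<le> s" "s \<le> T"
    show "(D has_real_derivative (\<Sum>i\<in>I. 2 * (x s i - y s i) * (F i (x s) - F i (y s)))) (at s within {0..T})"
      unfolding D_def using x y s
      by (auto simp: solves_on_def intro!: derivative_eq_intros sum.cong)
    have "2 * (x s i - y s i) * (F i (x s) - F i (y s)) \<le> 2 * L * D s" if "i \<in> I" for i
    proof -
      have "(x s i - y s i) * (F i (x s) - F i (y s)) \<le> \<bar>x s i - y s i\<bar> * \<bar>F i (x s) - F i (y s)\<bar>"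
        by (metis abs_ge_self abs_mult)
      also have "\<dots> \<le> sqrt (D s) * (L * sqrt (D s))"
        using comp[of s] L(2)[rule_format, OF that, of "x s" "y s" "sqrt (D s)"] \<rho>[of s] s D0[of s]
        by (intro mult_mono) auto
      also have "\<dots> = L * D s" using D0[of s] by simp
      finally show ?thesis unfolding mult.assoc by linarith
    qed
    then have "(\<Sum>i\<in>I. 2 * (x s i - y s i) * (F i (x s) - F i (y s))) \<le> of_nat (card I) * (2 * L * D s)"
      by (rule sum_bounded_above)
    then show "(\<Sum>i\<in>I. 2 * (x s i - y s i) * (F i (x s) - F i (y s))) \<le> 2 * L * card I * D s"
      by (simp add: mult_ac)
  qed (use t in auto)
  then have "D t = 0" using D0[of t] eq by (simp add: D_def)
  then have "sqrt (D t) = 0" by simp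
  then show ?thesis using comp[OF t] by (intro ext) (metis abs_le_zero_iff eq_iff_diff_eq_0)
qed

text \<open>The cut-off multiplies the whole vector field by a scalar, so it does not spoil the energy
  inequality; the latter then confines the solution to the region where the cut-off is 1.\<close>

lemma solves_on_exists_Icc:
  assumes I: "finite I" and F: "\<And>i. i \<in> I \<Longrightarrow> polyfun (F i)"
    and w: "\<And>i. i \<in> I \<Longrightarrow> w i > 0"
    and energy: "\<And>z. (\<forall>i. i \<notin> I \<longrightarrow> z i = 0) \<Longrightarrow> (\<Sum>i\<in>I. w i * z i * F i z) \<le> C * (\<Sum>i\<in>I. w i * (z i)\<^sup>2)"
    and C: "C \<ge> 0" and T: "T \<ge> 0" and z0: "\<And>i. i \<notin> I \<Longrightarrow> z0 i = 0"
  shows "\<exists>x. x 0 = z0 \<and> solves_on {0..T} I F x"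
proof -
  define E where "E z = (\<Sum>i\<in>I. w i * (z i)\<^sup>2)" for z
  have E0: "E z \<ge> 0" for z unfolding E_def
    by (intro sum_nonneg mult_nonneg_nonneg less_imp_le[OF w]) auto
  \<comment> \<open>The energy that Gronwall allows up to time \<open>T\<close>; the
    \<open>+ 1\<close> makes \<open>M\<close> positive even for zero data, as the division in
    \<open>cut\<close> demands.\<close>
  define M where "M = exp (2 * C * T) * E z0 + 1"
  have M: "M > 0" using E0[of z0] by (simp add: M_def add_nonneg_pos)
  \<comment> \<open>A single coordinate of size \<open>\<rho>\<close> already carries energy at
    least \<open>2 * M\<close>; the leading 1 gives \<open>\<rho> \<le> \<rho>\<^sup>2\<close>,
    which replaces a square root.\<close>
  define \<rho> where "\<rho> = 1 + (\<Sum>i\<in>I. 2 * M / w i)"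
  have \<rho>: "\<rho> \<ge> 1" "w i * \<rho>\<^sup>2 \<ge> 2 * M" if "i \<in> I" for i
  proof -
    have "2 * M / w i \<le> (\<Sum>i\<in>I. 2 * M / w i)"
      using I that w M by (intro member_le_sum) (auto intro!: divide_nonneg_pos)
    moreover have "0 \<le> 2 * M / w i" using w[OF that] M by simp
    ultimately have *: "2 * M / w i \<le> \<rho>" "1 \<le> \<rho>" by (auto simp: \<rho>_def)
    then have "2 * M / w i \<le> \<rho>\<^sup>2" using self_le_power[of \<rho> 2] by simp
    then show "w i * \<rho>\<^sup>2 \<ge> 2 * M" "\<rho> \<ge> 1" using w[OF that] * by (auto simp: field_simps)
  qed
  \<comment> \<open>A coordinate that is really clamped ends up with size \<open>\<rho>\<close>,
    hence with energy at least \<open>2 * M\<close>; below that level nothing has been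
    clamped.\<close>
  have inside: "box_clamp \<rho> z = z" if "\<forall>i. i \<notin> I \<longrightarrow> z i = 0" "E (box_clamp \<rho> z) < 2 * M" for z
  proof (rule box_clamp_id)
    fix i show "\<bar>z i\<bar> \<le> \<rho>"
    proof (cases "i \<in> I")
      case False
      moreover have "0 \<le> \<rho>" unfolding \<rho>_def
        using M w by (intro add_nonneg_nonneg sum_nonneg) (auto intro!: divide_nonneg_pos)
      ultimately show ?thesis using that by simp
    next
      case True
      show ?thesis
      proof (rule ccontr)
        assume "\<not> \<bar>z i\<bar> \<le> \<rho>"
        then have "(box_clamp \<rho> z i)\<^sup>2 = \<rho>\<^sup>2"
          using \<rho>(1)[OF True] by (cases "z i \<ge> 0") (auto simp: box_clamp_def power2_eq_square)
        then have "2 * M \<le> w i * (box_clamp \<rho> z i)\<^sup>2" using \<rho>(2)[OF True] by simp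
        also have "\<dots> \<le> E (box_clamp \<rho> z)"
          unfolding E_def using I True
          by (intro member_le_sum[of i I "\<lambda>i. w i * (box_clamp \<rho> z i)\<^sup>2"] mult_nonneg_nonneg less_imp_le[OF w]) auto
        finally show False using that by simp
      qed
    qed
  qed
  \<comment> \<open>Equals 1 where the energy of the clamped point is at most \<open>M\<close>, 0
    from \<open>2 * M\<close> on, and is affine in the energy between; evaluation at the clamped
    point makes it Lipschitz.\<close>
  define cut where "cut z = max 0 (min 1 (2 - (1/M) * E (box_clamp \<rho> z)))" for z
  define G where "G i z = cut z * F i (box_clamp \<rho> z)" for i z
  have "polyfun E"
    unfolding E_def power2_eq_square by (intro polyfun_sum polyfun.intros)
  then have "polyfun (\<lambda>z. 2 - (1/M) * E z)"
    by (intro polyfun_diff polyfun.const polyfun_cmult)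
  then have "bdd_lip cut"
    unfolding cut_def using bdd_lip_cut[OF bdd_lip_polyfun, of "\<lambda>z. 2 - (1/M) * E z" \<rho>] by simp
  then have "\<forall>i\<in>I. bdd_lip (G i)"
    unfolding G_def using F by (auto intro!: bdd_lip_mult bdd_lip_polyfun)
  from bdd_lip_uniform[OF I this] obtain L where L: "L \<ge> 0"
    "\<forall>i\<in>I. \<forall>y z d. (\<forall>j. \<bar>y j - z j\<bar> \<le> d) \<longrightarrow> \<bar>G i y - G i z\<bar> \<le> L * d"
    by (elim exE conjE)
  obtain x where x0: "x 0 = z0" and x: "solves_on {0..T} I G x"
    using picard_coordinates[where G=G and L=L and T=T and ?z0.0=z0, OF I T z0 L(2)[rule_format] L(1)] unfolding solves_on_def by blast
  have Ex: "E (x t) \<le> M" if t: "t \<in> {0..T}" for t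
  proof -
    have "E (x t) \<le> exp (2 * C * t) * E (x 0)"
    proof (rule gronwall)
      fix s assume s: "0 \<le> s" "s \<le> T"
      show "((\<lambda>s. E (x s)) has_real_derivative (\<Sum>i\<in>I. 2 * w i * x s i * G i (x s))) (at s within {0..T})"
        unfolding E_def using x s
        by (auto simp: solves_on_def intro!: derivative_eq_intros sum.cong)
      have supp: "\<forall>i. i \<notin> I \<longrightarrow> x s i = 0" using x s by (auto simp: solves_on_def)
      have cut01: "0 \<le> cut (x s)" "cut (x s) \<le> 1" by (auto simp: cut_def)
      have "(\<Sum>i\<in>I. 2 * w i * x s i * G i (x s)) = 2 * cut (x s) * (\<Sum>i\<in>I. w i * x s i * F i (box_clamp \<rho> (x s)))"
        by (simp add: G_def sum_distrib_left mult_ac)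
      \<comment> \<open>The energy hypothesis concerns the unclamped field: below level
        \<open>2 * M\<close> the clamp is the identity, and from that level on the cut-off
        vanishes.\<close>
      also have "\<dots> \<le> 2 * C * E (x s)"
      proof (cases "E (box_clamp \<rho> (x s)) < 2 * M")
        case True
        have "cut (x s) * (\<Sum>i\<in>I. w i * x s i * F i (x s)) \<le> cut (x s) * (C * E (x s))"
          using energy[OF supp] cut01 by (intro mult_left_mono) (auto simp: E_def)
        also have "\<dots> \<le> 1 * (C * E (x s))"
          using cut01 C E0[of "x s"] by (intro mult_right_mono) auto
        finally show ?thesis using inside[OF supp True] by simp
      next
        case False
        then have "cut (x s) = 0" using M by (auto simp: cut_def field_simps)
        then show ?thesis using C E0[of "x s"] by simp
      qed
      finally show "(\<Sum>i\<in>I. 2 * w i * x s i * G i (x s)) \<le> 2 * C * E (x s)" .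
    qed (use t in auto)
    also have "\<dots> \<le> exp (2 * C * T) * E (x 0)"
      using C t E0[of "x 0"] by (intro mult_right_mono) (auto intro!: mult_left_mono)
    finally show ?thesis by (simp add: M_def x0)
  qed
  \<comment> \<open>The energy never exceeds \<open>M\<close>, so along this trajectory both the
    clamp and the cut-off are trivial.\<close>
  have "G i (x t) = F i (x t)" if t: "t \<in> {0..T}" for i t
  proof -
    have supp: "\<forall>i. i \<notin> I \<longrightarrow> x t i = 0" using x t by (auto simp: solves_on_def)
    have "E (box_clamp \<rho> (x t)) \<le> E (x t)"
      unfolding E_def
    proof (intro sum_mono mult_left_mono less_imp_le[OF w])
      fix i assume "i \<in> I"
      with \<rho>(1) have "1 \<le> \<rho>" .
      then have "\<bar>box_clamp \<rho> (x t) i\<bar> \<le> \<bar>x t i\<bar>"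
        by (auto simp: box_clamp_def max_def min_def abs_if)
      then show "(box_clamp \<rho> (x t) i)\<^sup>2 \<le> (x t i)\<^sup>2" by (simp add: abs_le_square_iff)
    qed
    then have "E (box_clamp \<rho> (x t)) \<le> M" using Ex[OF t] by linarith
    moreover from this have "box_clamp \<rho> (x t) = x t" using M by (intro inside[OF supp]) auto
    ultimately show ?thesis using M by (auto simp: G_def cut_def field_simps)
  qed
  then have "solves_on {0..T} I F x" using x unfolding solves_on_def by metis
  then show ?thesis using x0 by blast
qed

lemma at_within_Icc_Ici: "t < (T::real) \<Longrightarrow> at t within {a..T} = at t within {a..}"
  by (rule at_within_nhd[of _ "{..<T}"]) auto

text \<open>By uniqueness the solutions on the intervals \<open>{0..n}\<close> extend one another
  and can be glued.\<close>

lemma solves_on_exists: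
  assumes I: "finite I" and F: "\<And>i. i \<in> I \<Longrightarrow> polyfun (F i)"
    and w: "\<And>i. i \<in> I \<Longrightarrow> w i > 0"
    and energy: "\<And>z. (\<forall>i. i \<notin> I \<longrightarrow> z i = 0) \<Longrightarrow> (\<Sum>i\<in>I. w i * z i * F i z) \<le> C * (\<Sum>i\<in>I. w i * (z i)\<^sup>2)"
    and C: "C \<ge> 0" and z0: "\<And>i. i \<notin> I \<Longrightarrow> z0 i = 0"
  shows "\<exists>x. x 0 = z0 \<and> solves_on {0..} I F x"
proof -
  have "\<forall>n::nat. \<exists>x. x 0 = z0 \<and> solves_on {0..real n} I F x"
    using solves_on_exists_Icc[OF I F w energy C _ z0] by auto
  then obtain Y where Y0: "\<And>n. Y n 0 = z0" and Y: "\<And>n. solves_on {0..real n} I F (Y n)" by metis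
  have Yeq: "Y m s = Y n s" if "0 \<le> s" "s \<le> real m" "s \<le> real n" for m n s
    by (rule solves_on_unique[of I F "min (real m) (real n)"])
       (use that I F Y0 in \<open>auto intro!: solves_on_subset[OF Y]\<close>)
  define x where "x t = Y (nat \<lceil>t\<rceil>) t" for t
  have xY: "x s = Y n s" if "0 \<le> s" "s \<le> real n" for s n
    unfolding x_def by (rule Yeq) (use that in linarith)+
  have "solves_on {0..} I F x"
    unfolding solves_on_def
  proof safe
    fix t :: real and i assume t: "t \<ge> 0"
    \<comment> \<open>One more than the ceiling puts \<open>t\<close> strictly below the right end
      point, so that the derivative within \<open>{0..n}\<close> is the one within
      \<open>{0..}\<close>.\<close>
    define n where "n = nat \<lceil>t\<rceil> + 1"
    have n: "t < real n" using t unfolding n_def by linarith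
    show "x t i = 0" if "i \<notin> I"
      using Y[of n] that t n xY[of t n] by (auto simp: solves_on_def)
    assume i: "i \<in> I"
    have "((\<lambda>s. Y n s i) has_real_derivative F i (Y n t)) (at t within {0..real n})"
      using Y[of n] i t n by (auto simp: solves_on_def)
    then have "((\<lambda>s. x s i) has_real_derivative F i (x t)) (at t within {0..real n})"
      unfolding xY[OF t less_imp_le[OF n]]
      by (rule has_field_derivative_transform_within[OF _ zero_less_one]) (use xY[of _ n] t n in simp_all)
    then show "((\<lambda>s. x s i) has_real_derivative F i (x t)) (at t within {0..})"
      using n by (simp add: at_within_Icc_Ici)
  qed
  moreover have "x 0 = z0" using Y0 by (simp add: x_def)
  ultimately show ?thesis by blast
qed

text \<open>Iterating the Lie derivative on a coordinate function yields polynomials whose values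
  along the trajectory are the successive derivatives.\<close>

lemma solves_on_smooth:
  assumes F: "\<And>i. i \<in> I \<Longrightarrow> polyfun (F i)" and x: "solves_on J I F x"
  shows "\<exists>D. (\<forall>t\<in>J. D 0 t = x t i) \<and>
     (\<forall>k. \<forall>t\<in>J. (D k has_real_derivative D (Suc k) t) (at t within J))"
proof -
  \<comment> \<open>Coordinates off \<open>I\<close> are identically 0 along \<open>x\<close>; the
    zero field there supplies the derivative in every coordinate that
    \<open>polyfun_lie_derivative\<close> asks for.\<close>
  define F' where "F' i = (if i \<in> I then F i else (\<lambda>_. 0))" for i
  have F': "\<forall>i. polyfun (F' i)" using F by (auto simp: F'_def intro: polyfun.const)
  have x': "((\<lambda>s. x s i) has_real_derivative F' i (x t)) (at t within J)" if "t \<in> J" for t i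
  proof (cases "i \<in> I")
    case False
    show ?thesis
      by (rule has_field_derivative_transform_within[OF _ zero_less_one that, of "\<lambda>_. 0"])
         (use False x in \<open>auto simp: solves_on_def F'_def\<close>)
  qed (use x that in \<open>auto simp: solves_on_def F'_def\<close>)
  define lie where "lie p = (SOME q. polyfun q \<and> (\<forall>x t S. (\<forall>i. ((\<lambda>s. x s i) has_real_derivative F' i (x t)) (at t within S)) \<longrightarrow>
     ((\<lambda>s. p (x s)) has_real_derivative q (x t)) (at t within S)))" for p
  have lie: "polyfun (lie p)"
    "\<And>x t S. (\<forall>i. ((\<lambda>s. x s i) has_real_derivative F' i (x t)) (at t within S)) \<Longrightarrow>
     ((\<lambda>s. p (x s)) has_real_derivative lie p (x t)) (at t within S)" if "polyfun p" for p
    using someI_ex[OF polyfun_lie_derivative[OF that F']] unfolding lie_def[symmetric] by blast+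
  have pw: "polyfun ((lie ^^ k) (\<lambda>z. z i))" for k
    by (induction k) (auto intro: polyfun.coord lie)
  show ?thesis
    using x' lie(2)[OF pw]
    by (intro exI[of _ "\<lambda>k t. (lie ^^ k) (\<lambda>z. z i) (x t)"]) auto
qed

lemma solves_on_shift:
  assumes x: "solves_on {0..} I F x" and t: "0 \<le> t"
  shows "solves_on {0..} I F (\<lambda>s. x (s + t))"
  unfolding solves_on_def
proof safe
  fix s :: real and i assume s: "0 \<le> s"
  show "x (s + t) i = 0" if "i \<notin> I" using x that s t by (auto simp: solves_on_def)
  assume "i \<in> I"
  then have "((\<lambda>r. x r i) has_real_derivative F i (x (s + t))) (at (s + t) within {0..})"
    using x s t by (auto simp: solves_on_def)
  then have "((\<lambda>r. x r i) has_real_derivative F i (x (s + t))) (at (s + t) within (\<lambda>s. s + t) ` {0..})"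
    by (rule DERIV_subset) (use t in auto)
  moreover have "((\<lambda>s. s + t) has_real_derivative 1) (at s within {0..})"
    by (auto intro!: derivative_eq_intros)
  ultimately show "((\<lambda>s. x (s + t) i) has_real_derivative F i (x (s + t))) (at s within {0..})"
    using DERIV_image_chain[where g="\<lambda>s. s + t" and f="\<lambda>r. x r i"] by (fastforce simp: o_def)
qed

section \<open>Trigonometric products\<close>

text \<open>Fubini: Lebesgue measure is the image of the product of one-dimensional Lebesgue
  measures, and the indicator of a box factors in the same way as the integrand.\<close>

lemma integral_cbox_prod_Basis:
  fixes a b :: "'a::euclidean_space" and g :: "'a \<Rightarrow> real \<Rightarrow> real"
  assumes g: "\<And>i. i \<in> Basis \<Longrightarrow> continuous_on UNIV (g i)"
  shows "integral (cbox a b) (\<lambda>x. \<Prod>i\<in>Basis. g i (x \<bullet> i)) =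
    (\<Prod>i\<in>Basis. integral {a \<bullet> i..b \<bullet> i} (g i))"
proof -
  interpret product_sigma_finite "\<lambda>_::'a. lborel :: real measure" ..
  have cont: "continuous_on UNIV (\<lambda>x. \<Prod>i\<in>Basis. g i (x \<bullet> i))"
    by (intro continuous_on_prod continuous_on_compose2[OF g]) (auto intro!: continuous_intros)
  have int1: "integrable lborel (\<lambda>s. indicator {a \<bullet> i..b \<bullet> i} s * g i s)" if "i \<in> Basis" for i
    using borel_integrable_compact[of "{a \<bullet> i..b \<bullet> i}" "g i"] continuous_on_subset[OF g[OF that]]
    by simp
  have int: "set_integrable lborel (cbox a b) (\<lambda>x. \<Prod>i\<in>Basis. g i (x \<bullet> i))"
    unfolding set_integrable_def
    by (rule borel_integrable_compact) (auto intro: continuous_on_subset[OF cont])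
  have ind: "indicator (cbox a b) x = (\<Prod>i\<in>Basis. indicator {a \<bullet> i..b \<bullet> i} (x \<bullet> i) :: real)" for x
    by (auto simp: indicator_def mem_box prod.neutral)
  have "integral (cbox a b) (\<lambda>x. \<Prod>i\<in>Basis. g i (x \<bullet> i)) =
      (LINT x|lborel. (\<Prod>i\<in>Basis. indicator {a \<bullet> i..b \<bullet> i} (x \<bullet> i) * g i (x \<bullet> i)))"
    using set_borel_integral_eq_integral(2)[OF int]
    by (simp add: set_lebesgue_integral_def ind prod.distrib)
  also have "\<dots> = (LINT f|(\<Pi>\<^sub>M i\<in>Basis. lborel). (\<Prod>i\<in>Basis. indicator {a \<bullet> i..b \<bullet> i} (f i) * g i (f i)))"
  proof -
    have [measurable]: "g i \<in> borel_measurable borel" if "i \<in> Basis" for i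
      using g[OF that] by (rule borel_measurable_continuous_onI)
    show ?thesis
      by (subst lborel_eq, subst integral_distr) (auto simp: inner_sum_left_Basis cong: prod.cong)
  qed
  also have "\<dots> = (\<Prod>i\<in>Basis. LINT s|lborel. indicator {a \<bullet> i..b \<bullet> i} s * g i s)"
    using int1 by (intro product_integral_prod) auto
  also have "\<dots> = (\<Prod>i\<in>Basis. integral {a \<bullet> i..b \<bullet> i} (g i))"
  proof (rule prod.cong[OF refl])
    fix i :: 'a assume "i \<in> Basis"
    then have "set_integrable lborel {a \<bullet> i..b \<bullet> i} (g i)"
      using int1 by (simp add: set_integrable_def)
    then show "(LINT s|lborel. indicator {a \<bullet> i..b \<bullet> i} s * g i s) = integral {a \<bullet> i..b \<bullet> i} (g i)"
      using set_borel_integral_eq_integral(2) by (fastforce simp: set_lebesgue_integral_def)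
  qed
  finally show ?thesis .
qed

lemma integral_cbox_prod:
  fixes a b :: "real^'n" and g :: "'n \<Rightarrow> real \<Rightarrow> real"
  assumes g: "\<And>i. continuous_on UNIV (g i)"
  shows "integral (cbox a b) (\<lambda>x. \<Prod>i\<in>UNIV. g i (x $ i)) = (\<Prod>i\<in>UNIV. integral {a $ i..b $ i} (g i))"
proof -
  have B: "(Basis :: (real^'n) set) = range (\<lambda>i. axis i 1)" by (auto simp: Basis_vec_def)
  have inj: "inj (\<lambda>i::'n. axis i (1::real))" by (auto simp: inj_on_def axis_eq_axis)
  have *: "inv (\<lambda>i::'n. axis i (1::real)) (axis i 1) = i" for i using inj by (rule inv_f_f)
  show ?thesis
    using integral_cbox_prod_Basis[of "\<lambda>b. g (inv (\<lambda>i. axis i 1) b)" a b] g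
    by (simp add: B prod.reindex[OF inj] * inner_axis)
qed

text \<open>A total derivative with all partials named lets \<open>pd\<close> be read off; as it
  holds at every point, the notion can be applied again to \<open>D i\<close> for second
  derivatives.\<close>

definition has_grad :: "(real^3 \<Rightarrow> 'b::real_normed_vector) \<Rightarrow> (3 \<Rightarrow> real^3 \<Rightarrow> 'b) \<Rightarrow> bool" where
  "has_grad g D \<longleftrightarrow> (\<forall>x. (g has_derivative (\<lambda>h. \<Sum>i\<in>UNIV. h $ i *\<^sub>R D i x)) (at x))"

lemma has_grad_pd: assumes "has_grad g D" shows "pd i g = D i"
proof
  fix x
  have "frechet_derivative g (at x) = (\<lambda>h. \<Sum>i\<in>UNIV. h $ i *\<^sub>R D i x)"
    using assms unfolding has_grad_def by (intro frechet_derivative_at[symmetric]) blast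
  then show "pd i g x = D i x"
    by (simp add: pd_def axis_def if_distrib[of "\<lambda>c. c *\<^sub>R _"] cong: if_cong)
qed

lemma has_grad_continuous: "has_grad g D \<Longrightarrow> continuous_on S g"
  unfolding has_grad_def
  by (meson continuous_at_imp_continuous_on has_derivative_continuous)

lemma has_grad_sum:
  assumes "\<And>n. n \<in> A \<Longrightarrow> has_grad (g n) (D n)"
  shows "has_grad (\<lambda>x. \<Sum>n\<in>A. c n *\<^sub>R g n x) (\<lambda>i x. \<Sum>n\<in>A. c n *\<^sub>R D n i x)"
  unfolding has_grad_def
proof
  fix x
  have "((\<lambda>x. \<Sum>n\<in>A. c n *\<^sub>R g n x) has_derivative
      (\<lambda>h. \<Sum>n\<in>A. c n *\<^sub>R (\<Sum>i\<in>UNIV. h $ i *\<^sub>R D n i x))) (at x)"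
    using assms by (intro has_derivative_sum has_derivative_scaleR_right) (auto simp: has_grad_def)
  also have "(\<lambda>h::real^3. \<Sum>n\<in>A. c n *\<^sub>R (\<Sum>i\<in>UNIV. h $ i *\<^sub>R D n i x)) =
      (\<lambda>h. \<Sum>i\<in>UNIV. h $ i *\<^sub>R (\<Sum>n\<in>A. c n *\<^sub>R D n i x))"
    by (simp add: scaleR_sum_right mult.commute) (subst sum.swap, rule refl)
  finally show "((\<lambda>x. \<Sum>n\<in>A. c n *\<^sub>R g n x) has_derivative
      (\<lambda>h. \<Sum>i\<in>UNIV. h $ i *\<^sub>R (\<Sum>n\<in>A. c n *\<^sub>R D n i x))) (at x)" .
qed

lemma has_grad_vec:
  fixes g :: "3 \<Rightarrow> real^3 \<Rightarrow> real"
  assumes "\<And>k. has_grad (g k) (D k)"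
  shows "has_grad (\<lambda>x. \<chi> k. c k * g k x) (\<lambda>i x. \<chi> k. c k * D k i x)"
  unfolding has_grad_def
proof
  fix x
  have vec: "(\<chi> k. f k) = (\<Sum>k\<in>UNIV. f k *\<^sub>R axis k 1)" for f :: "3 \<Rightarrow> real"
    by (simp add: vec_eq_iff axis_def if_distrib[of "\<lambda>c. _ * c"] cong: if_cong)
  have "((\<lambda>x. \<Sum>k\<in>UNIV. (c k * g k x) *\<^sub>R axis k (1::real)) has_derivative
      (\<lambda>h. \<Sum>k\<in>UNIV. (c k * (\<Sum>i\<in>UNIV. h $ i *\<^sub>R D k i x)) *\<^sub>R axis k 1)) (at x)"
    using assms
    by (intro has_derivative_sum has_derivative_scaleR_left has_derivative_mult_right)
       (auto simp: has_grad_def)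
  moreover have "(\<Sum>k\<in>UNIV. (c k * (\<Sum>i\<in>UNIV. h $ i *\<^sub>R D k i x)) *\<^sub>R axis k 1) =
      (\<Sum>i\<in>UNIV. h $ i *\<^sub>R (\<chi> k. c k * D k i x))" for h :: "real^3"
    by (simp add: vec[symmetric] vec_eq_iff sum_distrib_left mult_ac)
  ultimately show "((\<lambda>x. \<chi> k. c k * g k x) has_derivative
      (\<lambda>h. \<Sum>i\<in>UNIV. h $ i *\<^sub>R (\<chi> k. c k * D k i x))) (at x)"
    unfolding vec[of "\<lambda>k. c k * g k _"] by simp
qed

text \<open>Integration over a box and partial differentiation both act on such products factor by
  factor.\<close>

definition sep :: "(3 \<Rightarrow> real \<Rightarrow> real) \<Rightarrow> real^3 \<Rightarrow> real" where
  "sep \<phi> x = (\<Prod>j\<in>UNIV. \<phi> j (x $ j))"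

lemma sep_mult: "sep \<phi> x * sep \<psi> x = sep (\<lambda>j s. \<phi> j s * \<psi> j s) x"
  by (simp add: sep_def prod.distrib)

lemma sep_upd: "sep (\<phi>(i := \<xi>)) x = \<xi> (x $ i) * (\<Prod>j\<in>UNIV - {i}. \<phi> j (x $ j))"
proof -
  have "(\<Prod>j\<in>UNIV. (\<phi>(i := \<xi>)) j (x $ j)) = \<xi> (x $ i) * (\<Prod>j\<in>UNIV - {i}. (\<phi>(i := \<xi>)) j (x $ j))"
    by (subst prod.remove[of _ i]) auto
  also have "(\<Prod>j\<in>UNIV - {i}. (\<phi>(i := \<xi>)) j (x $ j)) = (\<Prod>j\<in>UNIV - {i}. \<phi> j (x $ j))"
    by (rule prod.cong) auto
  finally show ?thesis by (simp add: sep_def)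
qed

lemma has_grad_sep:
  assumes "\<And>j s. (\<phi> j has_real_derivative \<phi>' j s) (at s)"
  shows "has_grad (sep \<phi>) (\<lambda>i. sep (\<phi>(i := \<phi>' i)))"
  unfolding has_grad_def
proof
  fix x
  have "((\<lambda>x. \<phi> j (x $ j)) has_derivative (\<lambda>h. \<phi>' j (x $ j) * h $ j)) (at x)" for j
    using has_derivative_compose[OF bounded_linear_imp_has_derivative[OF bounded_linear_vec_nth[of j]]
      assms[of j "x $ j", unfolded has_field_derivative_def]] by simp
  then have "((\<lambda>x. \<Prod>j\<in>UNIV. \<phi> j (x $ j)) has_derivative
      (\<lambda>h. \<Sum>i\<in>UNIV. \<phi>' i (x $ i) * h $ i * (\<Prod>j\<in>UNIV - {i}. \<phi> j (x $ j)))) (at x)"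
    by (intro has_derivative_prod)
  then show "(sep \<phi> has_derivative (\<lambda>h. \<Sum>i\<in>UNIV. h $ i *\<^sub>R sep (\<phi>(i := \<phi>' i)) x)) (at x)"
    by (simp add: sep_upd sep_def[of \<phi>, abs_def] mult_ac)
qed

section \<open>One-dimensional trigonometric integrals\<close>

lemma trig_parity: "even p = even q \<Longrightarrow> trig m p x = trig m q x"
  by (simp add: trig_def)

text \<open>Differentiation raises the phase by one, with sign -1 from the cosine and +1 from the
  sine.\<close>

lemma trig_deriv:
  "((\<lambda>s. trig m p (k * s)) has_real_derivative real m * k * (-1) ^ (p + 1) * trig m (p + 1) (k * s)) (at s within S)"
  unfolding trig_def by (cases "even p") (auto intro!: derivative_eq_intros)

lemma continuous_on_trig: "continuous_on S (\<lambda>s. trig m p (k * s))"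
  by (rule DERIV_continuous_on) (rule trig_deriv)

lemma trig_period: "trig m p (2 * pi) = trig m p 0"
proof -
  have "sin (real m * (2 * pi)) = 0" "cos (real m * (2 * pi)) = 1"
    using sin_2npi[of m] cos_2npi[of m] by (simp_all add: mult_ac)
  then show ?thesis by (simp add: trig_def)
qed

lemma trig_half_period: "odd p \<Longrightarrow> trig m p pi = 0" "odd p \<Longrightarrow> trig m p 0 = 0"
  by (simp_all add: trig_def)

lemma integral_derivative_eq_0:
  fixes f :: "real \<Rightarrow> real"
  assumes "0 \<le> L" "\<And>s. (f has_real_derivative f' s) (at s)" "f L = f 0"
  shows "integral {0..L} f' = 0"
proof -
  have "(f' has_integral f L - f 0) {0..L}"
    by (rule fundamental_theorem_of_calculus[OF assms(1)])
       (simp add: has_real_derivative_iff_has_vector_derivative[symmetric]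
         has_field_derivative_at_within[OF assms(2)])
  then show ?thesis using assms(3) by (simp add: integral_unique)
qed

text \<open>Green's identity for the two oscillators, so that both kinds of boundary
  conditions (periodic, and Neumann/Dirichlet on half a period) are treated alike.\<close>

lemma integral_trig_eq_0:
  assumes L: "0 \<le> L" and k: "k \<noteq> 0" and m: "m \<noteq> n"
    and bc: "trig m (p + 1) (k * L) * trig n q (k * L) = trig m (p + 1) 0 * trig n q 0"
      "trig m p (k * L) * trig n (q + 1) (k * L) = trig m p 0 * trig n (q + 1) 0"
  shows "integral {0..L} (\<lambda>s. trig m p (k * s) * trig n q (k * s)) = 0"
proof -
  \<comment> \<open>The Wronskian of the two factors. Both solve oscillator equations, so its
    derivative is \<open>((real n)\<^sup>2 - (real m)\<^sup>2) * k\<^sup>2\<close> times their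
    product; \<open>bc\<close> matches its two terms at the ends.\<close>
  define f where "f s = real m * k * (-1) ^ (p + 1) * (trig m (p + 1) (k * s) * trig n q (k * s))
      - real n * k * (-1) ^ (q + 1) * (trig m p (k * s) * trig n (q + 1) (k * s))" for s
  have par: "trig m (Suc (Suc p)) = trig m p" "trig n (Suc (Suc q)) = trig n q" for m p n q
    by (auto simp: trig_def)
  have "integral {0..L} (\<lambda>s. ((real n)\<^sup>2 - (real m)\<^sup>2) * k\<^sup>2 * (trig m p (k * s) * trig n q (k * s))) = 0"
  proof (rule integral_derivative_eq_0[where f=f])
    show "(f has_real_derivative ((real n)\<^sup>2 - (real m)\<^sup>2) * k\<^sup>2 * (trig m p (k * s) * trig n q (k * s))) (at s)" for s
      unfolding f_def
      by (rule derivative_eq_intros trig_deriv refl)+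
         (simp add: par algebra_simps power2_eq_square power_add[symmetric] mult_2[symmetric])
    show "f L = f 0" using bc by (simp add: f_def)
  qed (rule L)
  then have "((real n)\<^sup>2 - (real m)\<^sup>2) * k\<^sup>2 * integral {0..L} (\<lambda>s. trig m p (k * s) * trig n q (k * s)) = 0"
    by simp
  moreover have "(real n)\<^sup>2 \<noteq> (real m)\<^sup>2" using m by (simp add: power2_eq_iff)
  ultimately show ?thesis using k by simp
qed

text \<open>At equal frequencies the Wronskian gives nothing; here sine times cosine is, up to a
  constant, the derivative of the squared sine.\<close>

lemma integral_trig_opposite:
  assumes L: "0 \<le> L" and k: "k \<noteq> 0" and pq: "odd (p + q)"
    and bc: "(trig m 1 (k * L))\<^sup>2 = (trig m 1 0)\<^sup>2"
  shows "integral {0..L} (\<lambda>s. trig m p (k * s) * trig m q (k * s)) = 0"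
proof -
  have eq: "trig m p (k * s) * trig m q (k * s) = trig m 0 (k * s) * trig m 1 (k * s)" for s
    using pq by (auto simp: trig_def)
  show ?thesis
  proof (cases "m = 0")
    case True
    then show ?thesis unfolding eq by (simp add: trig_def)
  next
    case False
    have "integral {0..L} (\<lambda>s. 2 * real m * k * (trig m 0 (k * s) * trig m 1 (k * s))) = 0"
      by (rule integral_derivative_eq_0[where f="\<lambda>s. (trig m 1 (k * s))\<^sup>2", OF L])
         (use bc in \<open>auto intro!: derivative_eq_intros trig_deriv simp: trig_def\<close>)
    then have "2 * real m * k * integral {0..L} (\<lambda>s. trig m 0 (k * s) * trig m 1 (k * s)) = 0"
      by simp
    then show ?thesis using False k unfolding eq by simp
  qed
qed

text \<open>The derivative of sine times cosine equates the integrals of the two squares, whose sum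
  is \<open>L\<close>. For \<open>m = 0\<close> the cosine contributes \<open>L\<close> and the sine
  0, which the factors with \<open>iota\<close> encode.\<close>

lemma integral_trig_square:
  assumes L: "0 \<le> L" and k: "k \<noteq> 0" and pq: "even (p + q)"
    and bc: "trig m 0 (k * L) * trig m 1 (k * L) = trig m 0 0 * trig m 1 0"
  shows "integral {0..L} (\<lambda>s. trig m p (k * s) * trig m q (k * s)) =
    L * real (iota m) ^ (p mod 2) / 2 ^ iota m"
proof (cases "m = 0")
  case True
  then show ?thesis using pq L
    by (cases "even p") (auto simp: trig_def iota_def even_iff_mod_2_eq_zero odd_iff_mod_2_eq_one)
next
  case False
  define J where "J r = integral {0..L} (\<lambda>s. (trig m r (k * s))\<^sup>2)" for r
  have int: "(\<lambda>s. (trig m r (k * s))\<^sup>2) integrable_on {0..L}" for r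
    by (intro integrable_continuous_real continuous_intros continuous_on_trig)
  have "integral {0..L} (\<lambda>s. real m * k * ((trig m 0 (k * s))\<^sup>2 - (trig m 1 (k * s))\<^sup>2)) = 0"
    by (rule integral_derivative_eq_0[where f="\<lambda>s. trig m 0 (k * s) * trig m 1 (k * s)", OF L])
       (use bc in \<open>auto intro!: derivative_eq_intros simp: trig_def algebra_simps power2_eq_square\<close>)
  then have "real m * k * (J 0 - J 1) = 0"
    by (simp add: J_def integral_diff[OF int int])
  then have "J 0 = J 1" using False k by simp
  moreover have "J 0 + J 1 = integral {0..L} (\<lambda>s. 1)"
    unfolding J_def by (subst integral_add[OF int int, symmetric]) (simp add: trig_def)
  ultimately have J: "J 0 = L / 2" "J 1 = L / 2" using L by auto
  have "trig m p (k * s) * trig m q (k * s) = (trig m (p mod 2) (k * s))\<^sup>2" for s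
    using pq by (auto simp: trig_def power2_eq_square)
  then show ?thesis using J False
    by (cases "even p") (auto simp: J_def iota_def even_iff_mod_2_eq_zero odd_iff_mod_2_eq_one)
qed

section \<open>Trigonometric product modes in three variables\<close>

definition tmode :: "real^3 \<Rightarrow> nat^3 \<Rightarrow> (3 \<Rightarrow> nat) \<Rightarrow> real^3 \<Rightarrow> real" where
  "tmode K m q = sep (\<lambda>j s. trig (m $ j) (q j) (K $ j * s))"

definition tmode_d :: "real^3 \<Rightarrow> nat^3 \<Rightarrow> (3 \<Rightarrow> nat) \<Rightarrow> 3 \<Rightarrow> real^3 \<Rightarrow> real" where
  "tmode_d K m q i x = real (m $ i) * K $ i * (-1) ^ (q i + 1) * tmode K m (q(i := q i + 1)) x"

lemma tmode_cong: "(\<And>j. even (p j) = even (q j)) \<Longrightarrow> tmode K m p = tmode K m q"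
  unfolding tmode_def using trig_parity by (intro arg_cong[of _ _ sep] ext) blast

lemma tmode_d_eq_sep:
  "tmode_d K m q i = sep ((\<lambda>j s. trig (m $ j) (q j) (K $ j * s))
    (i := \<lambda>s. real (m $ i) * K $ i * (-1) ^ (q i + 1) * trig (m $ i) (q i + 1) (K $ i * s)))"
proof
  fix x
  have "tmode K m (q(i := q i + 1)) x = trig (m $ i) (q i + 1) (K $ i * x $ i) *
      (\<Prod>j\<in>UNIV - {i}. trig (m $ j) (q j) (K $ j * x $ j))"
    unfolding tmode_def sep_def by (subst prod.remove[of _ i]) (auto intro!: prod.cong)
  then show "tmode_d K m q i x = sep ((\<lambda>j s. trig (m $ j) (q j) (K $ j * s))
    (i := \<lambda>s. real (m $ i) * K $ i * (-1) ^ (q i + 1) * trig (m $ i) (q i + 1) (K $ i * s))) x"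
    by (simp add: sep_upd tmode_d_def)
qed

lemma has_grad_tmode: "has_grad (tmode K m q) (tmode_d K m q)"
  unfolding tmode_d_eq_sep[abs_def] tmode_def by (rule has_grad_sep) (rule trig_deriv)

lemma continuous_on_tmode: "continuous_on S (tmode K m q)"
  by (rule has_grad_continuous[OF has_grad_tmode])

lemma continuous_on_tmode_d: "continuous_on S (tmode_d K m q i)"
  unfolding tmode_d_def[abs_def] by (intro continuous_intros continuous_on_tmode)

section \<open>The velocity and temperature modes\<close>

lemma wavenum_nth: "wavenum k1 k2 $ 1 = k1" "wavenum k1 k2 $ 2 = k2" "wavenum k1 k2 $ 3 = inverse (k1 * k2)"
  by (simp_all add: wavenum_def)

lemma prod_UNIV_3: "prod f (UNIV :: 3 set) = f 1 * f 2 * f 3"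
  unfolding UNIV_3 by (simp add: ac_simps)

definition side :: "real \<Rightarrow> real \<Rightarrow> 3 \<Rightarrow> real" where
  "side k1 k2 j = (if j = 3 then pi else 2 * pi) / wavenum k1 k2 $ j"

text \<open>As \<open>phase p 3 = 0\<close>, only component 3 carries a sine in the vertical
  variable, so it alone is forced to vanish on the walls.\<close>

definition vphase :: "nat \<times> nat \<Rightarrow> 3 \<Rightarrow> 3 \<Rightarrow> nat" where
  "vphase p i j = phase p j + of_bool (i = j)"

lemma phase_3: "phase p 3 = 0"
  by (cases p) simp

locale wavenumbers =
  fixes k1 k2 :: real
  assumes k1: "k1 > 0" and k2: "k2 > 0"
begin

abbreviation "K \<equiv> wavenum k1 k2"

lemma wavenum_pos: "K $ j > 0"
  using exhaust_3[of j] k1 k2 by (auto simp: wavenum_nth)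

lemma side_nonneg: "side k1 k2 j \<ge> 0"
  using wavenum_pos[of j] by (auto simp: side_def)

lemma wavenum_side: "K $ j * side k1 k2 j = (if j = 3 then pi else 2 * pi)"
  using wavenum_pos[of j] by (auto simp: side_def)

lemma bracket_sep:
  assumes "\<And>j. continuous_on UNIV (\<phi> j)"
  shows "bracket k1 k2 (sep \<phi>) = (\<Prod>j\<in>UNIV. integral {0..side k1 k2 j} (\<phi> j))"
proof -
  have "vector [2 * pi / k1, 2 * pi / k2, pi / (K $ 3)] = (\<chi> j. side k1 k2 j)"
    by (auto simp: vec_eq_iff forall_3 side_def wavenum_nth)
  then show ?thesis
    using integral_cbox_prod[of \<phi> 0 "\<chi> j. side k1 k2 j"] assms
    by (simp add: bracket_def Omega_def sep_def[abs_def])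
qed

text \<open>Here the normalisation \<open>k1 * k2 * k3 = 1\<close> enters: it makes the volume of
  the domain independent of the wave numbers.\<close>

lemma prod_side: "(\<Prod>j\<in>UNIV. side k1 k2 j) = Vconst\<^sup>2"
proof -
  have "side k1 k2 1 = 2 * pi / k1" "side k1 k2 2 = 2 * pi / k2" "side k1 k2 3 = pi * (k1 * k2)"
    unfolding side_def wavenum_nth by (simp_all add: divide_inverse)
  then have "(\<Prod>j\<in>UNIV. side k1 k2 j) = (2 * pi / k1) * (2 * pi / k2) * (pi * (k1 * k2))"
    by (simp add: prod_UNIV_3)
  also have "\<dots> = 4 * pi ^ 3"
    using k1 k2 by (simp add: power3_eq_cube)
  finally show ?thesis by (simp add: Vconst_def)
qed

text \<open>Vertically only half a period is integrated, where sines and cosines need not be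
  orthogonal to each other; hence the parity condition on the third phases.\<close>

lemma bracket_tmode_mult:
  assumes par: "even (q 3 + q' 3)"
  shows "bracket k1 k2 (\<lambda>x. tmode K m q x * tmode K m' q' x) =
    (if m = m' \<and> (\<forall>j. even (q j + q' j))
     then Vconst\<^sup>2 / (eta m)\<^sup>2 * (\<Prod>j\<in>UNIV. real (iota (m $ j)) ^ (q j mod 2)) else 0)"
proof -
  define J where "J j = integral {0..side k1 k2 j} (\<lambda>s. trig (m $ j) (q j) (K $ j * s) * trig (m' $ j) (q' j) (K $ j * s))" for j
  have br: "bracket k1 k2 (\<lambda>x. tmode K m q x * tmode K m' q' x) = (\<Prod>j\<in>UNIV. J j)"
    unfolding tmode_def sep_mult J_def
    by (rule bracket_sep) (intro continuous_intros continuous_on_trig)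
  have J0: "(\<Prod>j\<in>UNIV. J j) = 0" if "J j = 0" for j
    using that by (auto simp: prod_zero_iff)
  \<comment> \<open>For \<open>j = 3\<close> the phases have equal parity, so each boundary term of
    Green's identity contains a sine and vanishes at both ends; the horizontal directions are
    periodic.\<close>
  have J1: "J j = 0" if "m $ j \<noteq> m' $ j" for j
    unfolding J_def
  proof (rule integral_trig_eq_0[OF side_nonneg _ that])
    show "K $ j \<noteq> 0" using wavenum_pos[of j] by simp
  qed (use par in \<open>cases "j = 3"; cases "even (q j)"; auto simp: wavenum_side trig_period trig_half_period\<close>)+
  have J2: "J j = 0" if "m = m'" "odd (q j + q' j)" for j
    unfolding J_def that(1)
  proof (rule integral_trig_opposite[OF side_nonneg _ that(2)])
    show "K $ j \<noteq> 0" using wavenum_pos[of j] by simp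
    show "(trig (m' $ j) 1 (K $ j * side k1 k2 j))\<^sup>2 = (trig (m' $ j) 1 0)\<^sup>2"
      using that par by (auto simp: wavenum_side trig_period)
  qed
  have J3: "(\<Prod>j\<in>UNIV. J j) = Vconst\<^sup>2 / (eta m)\<^sup>2 * (\<Prod>j\<in>UNIV. real (iota (m $ j)) ^ (q j mod 2))"
    if "m = m'" "\<forall>j. even (q j + q' j)"
  proof -
    have "J j = side k1 k2 j * real (iota (m $ j)) ^ (q j mod 2) / 2 ^ iota (m $ j)" for j
      unfolding J_def that(1)[symmetric]
    proof (rule integral_trig_square[OF side_nonneg])
      show "K $ j \<noteq> 0" using wavenum_pos[of j] by simp
      show "even (q j + q' j)" using that by simp
    qed (auto simp: wavenum_side trig_period trig_half_period)
    moreover have "(eta m)\<^sup>2 = (\<Prod>j\<in>UNIV. 2 ^ iota (m $ j))"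
      by (simp add: eta_def prod_power_distrib power_mult[symmetric] mult.commute[of _ 2] power_mult)
    ultimately show ?thesis
      by (simp add: prod_dividef prod.distrib prod_side)
  qed
  show ?thesis
  proof (cases "m = m'")
    case True
    then show ?thesis using br J3 J0[OF J2] by auto
  next
    case False
    then obtain j where "m $ j \<noteq> m' $ j" by (auto simp: vec_eq_iff)
    then show ?thesis using br J0[OF J1] False by auto
  qed
qed

text \<open>The integrand is the \<open>i\<close>-th derivative of a triple product. It integrates
  to 0 horizontally by periodicity, and vertically because the first factor is a sine and vanishes
  at the walls.\<close>

lemma bracket_tmode_flux:
  assumes i: "i = 3 \<Longrightarrow> odd (q 3)"
  shows "bracket k1 k2 (\<lambda>x. tmode_d K m q i x * tmode K m' q' x * tmode K m'' q'' x
     + tmode K m q x * tmode_d K m' q' i x * tmode K m'' q'' x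
     + tmode K m q x * tmode K m' q' x * tmode_d K m'' q'' i x) = 0"
proof -
  define a where "a m q j s = trig (m $ j) (q j) (K $ j * s)" for m :: "nat^3" and q j s
  define a' where "a' m q j s = real (m $ j) * K $ j * (-1) ^ (q j + 1) * trig (m $ j) (q j + 1) (K $ j * s)"
    for m :: "nat^3" and q j s
  define \<phi> where "\<phi> j s = a m q j s * a m' q' j s * a m'' q'' j s" for j s
  define \<phi>' where "\<phi>' j s = a' m q j s * a m' q' j s * a m'' q'' j s
     + a m q j s * a' m' q' j s * a m'' q'' j s + a m q j s * a m' q' j s * a' m'' q'' j s" for j s
  have da: "(a m q j has_real_derivative a' m q j s) (at s)" for m q j s
    unfolding a_def a'_def by (rule trig_deriv)
  have ca: "continuous_on S (a m q j)" "continuous_on S (a' m q j)" for m q j S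
    unfolding a_def a'_def by (intro continuous_intros continuous_on_trig)+
  have d\<phi>: "(\<phi> j has_real_derivative \<phi>' j s) (at s)" for j s
    unfolding \<phi>_def \<phi>'_def
    by (rule derivative_eq_intros da refl)+ (simp add: algebra_simps)
  have tm: "tmode K m q x = a m q i (x $ i) * (\<Prod>j\<in>UNIV - {i}. a m q j (x $ j))" for m q x
    unfolding tmode_def sep_def a_def by (rule prod.remove) auto
  have tmd: "tmode_d K m q i x = a' m q i (x $ i) * (\<Prod>j\<in>UNIV - {i}. a m q j (x $ j))" for m q x
    unfolding tmode_d_eq_sep sep_upd a_def a'_def by simp
  have "(\<lambda>x. tmode_d K m q i x * tmode K m' q' x * tmode K m'' q'' x
     + tmode K m q x * tmode_d K m' q' i x * tmode K m'' q'' x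
     + tmode K m q x * tmode K m' q' x * tmode_d K m'' q'' i x) = sep (\<phi>(i := \<phi>' i))"
    unfolding tm tmd sep_upd by (rule ext) (simp add: \<phi>_def \<phi>'_def prod.distrib algebra_simps)
  moreover have "bracket k1 k2 (sep (\<phi>(i := \<phi>' i))) = 0"
  proof -
    have "continuous_on UNIV (\<phi> j)" "continuous_on UNIV (\<phi>' j)" for j
      unfolding \<phi>_def \<phi>'_def by (intro continuous_intros ca)+
    then have "bracket k1 k2 (sep (\<phi>(i := \<phi>' i))) = (\<Prod>j\<in>UNIV. integral {0..side k1 k2 j} ((\<phi>(i := \<phi>' i)) j))"
      by (intro bracket_sep) auto
    moreover have "integral {0..side k1 k2 i} (\<phi>' i) = 0"
    proof (rule integral_derivative_eq_0[OF side_nonneg d\<phi>])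
      show "\<phi> i (side k1 k2 i) = \<phi> i 0"
        using i by (cases "i = 3") (auto simp: \<phi>_def a_def wavenum_side trig_period trig_half_period)
    qed
    ultimately show ?thesis by (auto simp: prod_zero_iff intro!: bexI[of _ i])
  qed
  ultimately show ?thesis by simp
qed

lemma bracket_add:
  "continuous_on UNIV f \<Longrightarrow> continuous_on UNIV g \<Longrightarrow>
    bracket k1 k2 (\<lambda>x. f x + g x) = bracket k1 k2 f + bracket k1 k2 g"
  unfolding bracket_def Omega_def
  by (intro integral_add integrable_continuous) (auto intro: continuous_on_subset)

lemma bracket_cmult: "bracket k1 k2 (\<lambda>x. c * f x) = c * bracket k1 k2 f"
  by (simp add: bracket_def)

lemma bracket_diff:
  "continuous_on UNIV f \<Longrightarrow> continuous_on UNIV g \<Longrightarrow>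
    bracket k1 k2 (\<lambda>x. f x - g x) = bracket k1 k2 f - bracket k1 k2 g"
  unfolding bracket_def Omega_def
  by (intro integral_diff integrable_continuous) (auto intro: continuous_on_subset)

lemma bracket_sum:
  assumes "finite A" "\<And>n. n \<in> A \<Longrightarrow> continuous_on UNIV (f n)"
  shows "bracket k1 k2 (\<lambda>x. \<Sum>n\<in>A. f n x) = (\<Sum>n\<in>A. bracket k1 k2 (f n))"
  unfolding bracket_def Omega_def
  by (intro integral_sum assms(1) integrable_continuous) (auto intro: continuous_on_subset assms(2))

lemma bracket_nonneg:
  "continuous_on UNIV f \<Longrightarrow> (\<And>x. f x \<ge> 0) \<Longrightarrow> bracket k1 k2 f \<ge> 0"
  unfolding bracket_def Omega_def
  by (intro integral_nonneg integrable_continuous) (auto intro: continuous_on_subset)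

text \<open>\<open>vtrig n k\<close> is the trigonometric factor of the \<open>k\<close>-th component of the velocity mode \<open>n\<close>;
  for \<open>k = 3\<close> it is also that of the temperature mode with the same index.\<close>

definition vcoeff :: "index \<Rightarrow> 3 \<Rightarrow> real" where
  "vcoeff n i = eta (fst n) / (norm (Gmat k1 k2 n *v nu n) * Vconst) * Gmat k1 k2 n $ i $ i * varsig (fst (snd n)) $ i $ i"

definition vtrig :: "index \<Rightarrow> 3 \<Rightarrow> real^3 \<Rightarrow> real" where
  "vtrig n k = tmode K (fst n) (vphase (fst (snd n)) k)"

definition vtrig_d :: "index \<Rightarrow> 3 \<Rightarrow> 3 \<Rightarrow> real^3 \<Rightarrow> real" where
  "vtrig_d n k i = tmode_d K (fst n) (vphase (fst (snd n)) k) i"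

definition vmode_d :: "index \<Rightarrow> 3 \<Rightarrow> real^3 \<Rightarrow> real^3" where
  "vmode_d n i x = (\<chi> k. vcoeff n k * vtrig_d n k i x)"

definition fcoeff :: "index \<Rightarrow> real" where "fcoeff n = eta (fst n) / Vconst"

lemma vmode_eq: "vmode k1 k2 n = (\<lambda>x. \<chi> k. vcoeff n k * vtrig n k x)"
  by (cases n) (auto simp: vcoeff_def vtrig_def vphase_def tmode_def sep_def fun_eq_iff vec_eq_iff)

lemma fmode_eq: "fmode k1 k2 n = (\<lambda>x. fcoeff n * vtrig n 3 x)"
proof -
  obtain m p1 p2 c where "n = (m, (p1, p2), c)" by (metis prod.exhaust)
  then show ?thesis by (simp add: fcoeff_def vtrig_def vphase_def tmode_def sep_def fun_eq_iff prod_UNIV_3)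
qed

lemma has_grad_vtrig: "has_grad (vtrig n k) (vtrig_d n k)"
  unfolding vtrig_def vtrig_d_def[abs_def] by (rule has_grad_tmode)

lemma continuous_on_vtrig: "continuous_on S (vtrig n k)" "continuous_on S (vtrig_d n k i)"
  unfolding vtrig_def vtrig_d_def by (rule continuous_on_tmode continuous_on_tmode_d)+

lemma has_grad_vmode: "has_grad (vmode k1 k2 n) (vmode_d n)"
  unfolding vmode_eq vmode_d_def[abs_def] by (rule has_grad_vec) (rule has_grad_vtrig)

lemma has_grad_cmult: "has_grad g D \<Longrightarrow> has_grad (\<lambda>x. c * g x :: real) (\<lambda>i x. c * D i x)"
  using has_grad_sum[of "{()}" "\<lambda>_. g" "\<lambda>_. D" "\<lambda>_. c"] by simp

lemma has_grad_fmode: "has_grad (fmode k1 k2 n) (\<lambda>i x. fcoeff n * vtrig_d n 3 i x)"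
  unfolding fmode_eq by (rule has_grad_cmult) (rule has_grad_vtrig)

text \<open>Two phase shifts return the same mode with a negative factor. Only the pure second
  derivative is named, since this is what the Laplacian reads.\<close>

lemma has_grad_vtrig_d:
  "\<exists>D. has_grad (vtrig_d n k i) D \<and> D i = (\<lambda>x. - (real (fst n $ i) * K $ i)\<^sup>2 * vtrig n k x)"
proof -
  define q where "q = vphase (fst (snd n)) k"
  define c where "c = real (fst n $ i) * K $ i * (-1) ^ (q i + 1)"
  have "has_grad (vtrig_d n k i) (\<lambda>j x. c * tmode_d K (fst n) (q(i := q i + 1)) j x)"
  proof -
    have "vtrig_d n k i = (\<lambda>x. c * tmode K (fst n) (q(i := q i + 1)) x)"
      by (rule ext) (simp add: vtrig_d_def tmode_d_def q_def c_def)
    then show ?thesis by (simp add: has_grad_cmult[OF has_grad_tmode])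
  qed
  moreover have "c * tmode_d K (fst n) (q(i := q i + 1)) i x = - (real (fst n $ i) * K $ i)\<^sup>2 * vtrig n k x" for x
  proof -
    have "tmode K (fst n) (q(i := Suc (Suc (q i)))) = vtrig n k"
      unfolding vtrig_def q_def[symmetric] by (rule tmode_cong) auto
    then show ?thesis
      by (simp add: tmode_d_def c_def power2_eq_square power_add[symmetric] mult_2[symmetric])
  qed
  ultimately show ?thesis by (intro exI[of _ "\<lambda>j x. c * tmode_d K (fst n) (q(i := q i + 1)) j x"]) auto
qed

lemma Kvec_nth: "Kvec k1 k2 m $ i = real (m $ i) * K $ i"
  by (simp add: Kvec_def Kmat_def diag3_def matrix_vector_mult_def
    if_distrib[of "\<lambda>c. c * _"] cong: if_cong)

lemma norm_Kvec: "(norm (Kvec k1 k2 m))\<^sup>2 = (\<Sum>i\<in>UNIV. (real (m $ i) * K $ i)\<^sup>2)"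
  by (simp add: norm_vec_def L2_set_def sum_nonneg Kvec_nth)

text \<open>The modes are eigenfunctions, so diffusion stays within the span of the
  truncation.\<close>

lemma laplacian_vmode_sum:
  assumes "finite A"
  shows "laplacian (\<lambda>x. \<Sum>n\<in>A. a n *\<^sub>R vmode k1 k2 n x) x =
    (\<Sum>n\<in>A. (- (norm (Kvec k1 k2 (fst n)))\<^sup>2 * a n) *\<^sub>R vmode k1 k2 n x)"
proof -
  have pd1: "pd i (\<lambda>x. \<Sum>n\<in>A. a n *\<^sub>R vmode k1 k2 n x) = (\<lambda>x. \<Sum>n\<in>A. a n *\<^sub>R vmode_d n i x)" for i
    by (rule has_grad_pd[OF has_grad_sum[OF has_grad_vmode]])
  have "pd i (\<lambda>x. \<Sum>n\<in>A. a n *\<^sub>R vmode_d n i x) x =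
      (\<Sum>n\<in>A. a n *\<^sub>R (- (real (fst n $ i) * K $ i)\<^sup>2 *\<^sub>R vmode k1 k2 n x))" for i
  proof -
    have "\<forall>n k. \<exists>D. has_grad (vtrig_d n k i) D \<and> D i = (\<lambda>x. - (real (fst n $ i) * K $ i)\<^sup>2 * vtrig n k x)"
      using has_grad_vtrig_d by blast
    then obtain D where D: "\<And>n k. has_grad (vtrig_d n k i) (D n k)"
      "\<And>n k. D n k i = (\<lambda>x. - (real (fst n $ i) * K $ i)\<^sup>2 * vtrig n k x)" by metis
    have "has_grad (vmode_d n i) (\<lambda>j x. \<chi> k. vcoeff n k * D n k j x)" for n
      unfolding vmode_d_def[abs_def] by (rule has_grad_vec) (rule D)
    from has_grad_pd[OF has_grad_sum[where A=A and c=a, OF this], of i]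
    show ?thesis by (simp add: D(2) vmode_eq vec_eq_iff mult_ac)
  qed
  then show ?thesis
    by (simp add: laplacian_def pd1 norm_Kvec sum_distrib_right sum_distrib_left scaleR_sum_left
      sum_negf[symmetric] mult_ac) (subst sum.swap, rule refl)
qed

lemma laplacian_fmode_sum:
  assumes "finite A"
  shows "laplacian (\<lambda>x. \<Sum>n\<in>A. b n * fmode k1 k2 n x) x =
    (\<Sum>n\<in>A. (- (norm (Kvec k1 k2 (fst n)))\<^sup>2 * b n) * fmode k1 k2 n x)"
proof -
  have pd1: "pd i (\<lambda>x. \<Sum>n\<in>A. b n *\<^sub>R fmode k1 k2 n x) = (\<lambda>x. \<Sum>n\<in>A. b n *\<^sub>R (fcoeff n * vtrig_d n 3 i x))" for i
    by (rule has_grad_pd[OF has_grad_sum[OF has_grad_fmode]])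
  have "pd i (\<lambda>x. \<Sum>n\<in>A. b n *\<^sub>R (fcoeff n * vtrig_d n 3 i x)) x =
      (\<Sum>n\<in>A. b n *\<^sub>R (- (real (fst n $ i) * K $ i)\<^sup>2 *\<^sub>R fmode k1 k2 n x))" for i
  proof -
    have "\<forall>n k. \<exists>D. has_grad (vtrig_d n k i) D \<and> D i = (\<lambda>x. - (real (fst n $ i) * K $ i)\<^sup>2 * vtrig n k x)"
      using has_grad_vtrig_d by blast
    then obtain D where D: "\<And>n k. has_grad (vtrig_d n k i) (D n k)"
      "\<And>n k. D n k i = (\<lambda>x. - (real (fst n $ i) * K $ i)\<^sup>2 * vtrig n k x)" by metis
    have "has_grad (\<lambda>x. fcoeff n * vtrig_d n 3 i x) (\<lambda>j x. fcoeff n * D n 3 j x)" for n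
      by (rule has_grad_cmult) (rule D)
    from has_grad_pd[OF has_grad_sum[where A=A and c=b and g="\<lambda>n x. fcoeff n * vtrig_d n 3 i x"
        and D="\<lambda>n j x. fcoeff n * D n 3 j x", OF this], of i]
    show ?thesis by (simp add: D(2) fmode_eq mult_ac)
  qed
  then have "laplacian (\<lambda>x. \<Sum>n\<in>A. b n *\<^sub>R fmode k1 k2 n x) x =
    (\<Sum>n\<in>A. (- (norm (Kvec k1 k2 (fst n)))\<^sup>2 * b n) * fmode k1 k2 n x)"
    unfolding laplacian_def pd1
    by (simp add: norm_Kvec sum_distrib_right sum_distrib_left
      sum_negf[symmetric] mult_ac) (subst sum.swap, rule refl)
  then show ?thesis by simp
qed

text \<open>Both factors are the same component, so its phase shift cancels in the parity test and
  the third phases agree; the remaining product of \<open>iota\<close> powers is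
  \<open>nu n $ k\<close>.\<close>

lemma bracket_vtrig_mult:
  "bracket k1 k2 (\<lambda>x. vtrig n k x * vtrig n' k x) =
    (if fst n = fst n' \<and> (\<forall>j. even (phase (fst (snd n)) j + phase (fst (snd n')) j))
     then Vconst\<^sup>2 / (eta (fst n))\<^sup>2 * nu n $ k else 0)"
proof -
  obtain m p c where n: "n = (m, p, c)" by (metis prod.exhaust)
  have "even (vphase (fst (snd n)) k j + vphase (fst (snd n')) k j) =
      even (phase (fst (snd n)) j + phase (fst (snd n')) j)" for j
    by (auto simp: vphase_def)
  then show ?thesis
    unfolding vtrig_def by (subst bracket_tmode_mult) (auto simp: vphase_def phase_3 n)
qed

lemma Vconst_pos: "Vconst > 0" and eta_pos: "eta m > 0"
  by (auto simp: Vconst_def eta_def intro!: prod_pos)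

lemma nu_01: "nu n $ k \<in> {0, 1}"
proof -
  obtain m p c where n: "n = (m, p, c)" by (metis prod.exhaust)
  have pw: "real (iota (m $ j)) ^ e \<in> {0, 1}" for j e
    by (cases "m $ j = 0") (auto simp: iota_def power_0_left)
  have *: "(\<Prod>j\<in>A. real (iota (m $ j)) ^ e j) \<in> {0, 1}" if "finite A" for e A
    using that
  proof induction
    case (insert x F)
    have "a * b \<in> {0, 1}" if "a \<in> {0, 1}" "b \<in> {0, 1}" for a b :: real using that by auto
    from this[OF pw insert.IH] show ?case by (simp only: prod.insert[OF insert.hyps])
  qed simp
  show ?thesis unfolding n nu.simps vec_lambda_beta by (rule *) simp
qed

lemma Gmat_mult_vec: "Gmat k1 k2 n *v z = (\<chi> k. Gmat k1 k2 n $ k $ k * z $ k)"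
proof -
  obtain m p c where n: "n = (m, p, c)" by (metis prod.exhaust)
  have "diag3 d *v z = (\<chi> k. diag3 d $ k $ k * z $ k)" for d
    by (simp add: diag3_def matrix_vector_mult_def vec_eq_iff
      if_distrib[of "\<lambda>c. c * _"] cong: if_cong)
  then show ?thesis by (simp add: n)
qed

lemma varsig_eq: "varsig p $ k $ k = (-1) ^ phase p k"
  using exhaust_3[of k] by (cases p) (auto simp: diag3_def)

lemma Gmat_diag:
  "Gmat k1 k2 (m, p, c) $ k $ k = (if c = 1 then cross3 gam (Kvec k1 k2 m) $ k
     else cross3 (Kvec k1 k2 m) (cross3 gam (Kvec k1 k2 m)) $ k)"
  by (simp add: diag3_def)

lemma cross_gam: "cross3 gam a = vector [a $ 3 + a $ 2, - a $ 1 - a $ 3, a $ 2 - a $ 1]"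
  by (simp add: cross3_def gam_def vec_eq_iff forall_3)

text \<open>This keeps \<open>vmode\<close> from dividing by zero. If all wave numbers are positive,
  \<open>nu\<close> is 1 throughout and it is enough to find an entry of \<open>Gmat\<close> of
  definite sign; otherwise \<open>phases_u\<close> decides.\<close>

lemma Gmat_nu_nonzero:
  assumes n: "n \<in> N_u"
  shows "norm (Gmat k1 k2 n *v nu n) > 0"
proof -
  obtain m p1 p2 c where nn: "n = (m, (p1, p2), c)" by (metis prod.exhaust)
  define a where "a j = Kvec k1 k2 m $ j" for j
  have a: "a j \<ge> 0" "a j > 0 \<longleftrightarrow> m $ j > 0" "a j = 0 \<longleftrightarrow> m $ j = 0" for j
    using wavenum_pos[of j] by (auto simp: a_def Kvec_nth zero_less_mult_iff)
  have m0: "m $ 1 > 0 \<or> m $ 2 > 0 \<or> m $ 3 > 0"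
    using n by (auto simp: nn N_u_def vec_eq_iff forall_3)
  have nu: "nu n $ i = real (iota (m $ 1)) ^ ((p1 + of_bool (i = 1)) mod 2) *
      real (iota (m $ 2)) ^ ((p2 + of_bool (i = 2)) mod 2) * real (iota (m $ 3)) ^ (of_bool (i = 3))" for i
    using exhaust_3[of i] by (auto simp: nn prod_UNIV_3)
  have p: "(p1, p2) \<in> phases_u m" and c: "c \<in> comps_u m" using n by (auto simp: nn N_u_def)
  have "\<exists>i. nu n $ i \<noteq> 0 \<and> Gmat k1 k2 n $ i $ i \<noteq> 0"
  proof (cases "\<forall>k. m $ k > 0")
    case True
    then have iota: "iota (m $ k) = 1" for k by (simp add: iota_def)
    then have "nu n $ i \<noteq> 0" for i by (simp add: nu)
    moreover have apos: "a 1 > 0" "a 2 > 0" "a 3 > 0" using True a by auto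
    have "Gmat k1 k2 n $ (if c = 1 then 1 else 3) $ (if c = 1 then 1 else 3) \<noteq> 0"
    proof (cases "c = 1")
      case True
      then show ?thesis using apos by (simp add: nn Gmat_diag cross_gam a_def del: Gmat.simps)
    next
      case False
      have "a 1 * (- a 1 - a 3) - a 2 * (a 3 + a 2) < 0"
        using mult_pos_pos[OF apos(1) apos(1)] mult_pos_pos[OF apos(1) apos(3)]
          mult_pos_pos[OF apos(2) apos(3)] mult_pos_pos[OF apos(2) apos(2)]
        by (simp add: algebra_simps)
      then show ?thesis
        using False unfolding nn Gmat_diag cross_gam by (simp add: cross3_def a_def)
    qed
    ultimately show ?thesis by blast
  next
    case False
    then have c1: "c = 1" and zero: "m $ 1 = 0 \<or> m $ 2 = 0 \<or> m $ 3 = 0"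
      using c by (auto simp: comps_u_def forall_3 split: if_splits)
    \<comment> \<open>With \<open>gam\<close> = (1, 1, -1) the first two entries are sums of terms
      of one sign, whereas the third, \<open>a 2 - a 1\<close>, may cancel; the witness is therefore
      sought among the first two.\<close>
    have w: "Gmat k1 k2 n $ 1 $ 1 = a 3 + a 2" "Gmat k1 k2 n $ 2 $ 2 = - a 1 - a 3"
      by (simp_all add: nn Gmat_diag cross_gam a_def c1 del: Gmat.simps)
    have p01: "p1 = 0 \<or> p1 = 1" "p2 = 0 \<or> p2 = 1" using p by (auto simp: phases_u_def split: if_splits)
    have w1: "Gmat k1 k2 n $ 1 $ 1 \<noteq> 0" if "m $ 2 > 0 \<or> m $ 3 > 0"
      using that a(1)[of 2] a(1)[of 3] a(2)[of 2] a(2)[of 3] by (auto simp: w)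
    have w2: "Gmat k1 k2 n $ 2 $ 2 \<noteq> 0" if "m $ 1 > 0 \<or> m $ 3 > 0"
      using that a(1)[of 1] a(1)[of 3] a(2)[of 1] a(2)[of 3] by (auto simp: w)
    \<comment> \<open>The restrictions in \<open>phases_u\<close> ensure that a horizontal component
      survives together with a nonzero entry of \<open>Gmat\<close>.\<close>
    have "(nu n $ 1 \<noteq> 0 \<and> (m $ 2 > 0 \<or> m $ 3 > 0)) \<or> (nu n $ 2 \<noteq> 0 \<and> (m $ 1 > 0 \<or> m $ 3 > 0))"
    proof -
      have *: "nu n $ 1 \<noteq> 0 \<longleftrightarrow> (m $ 1 > 0 \<or> odd p1) \<and> (m $ 2 > 0 \<or> even p2)"
        "nu n $ 2 \<noteq> 0 \<longleftrightarrow> (m $ 1 > 0 \<or> even p1) \<and> (m $ 2 > 0 \<or> odd p2)"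
        unfolding nu using p01 by (auto simp: iota_def)
      show ?thesis
        unfolding * using m0 zero p p01
        by (cases "m $ 1 = 0"; cases "m $ 2 = 0"; cases "m $ 3 = 0") (simp_all add: phases_u_def, auto)
    qed
    then show ?thesis using w1 w2 by blast
  qed
  then obtain i where "(Gmat k1 k2 n *v nu n) $ i \<noteq> 0" by (auto simp: Gmat_mult_vec)
  then show ?thesis by (metis norm_le_zero_iff not_less zero_index)
qed

section \<open>Orthonormality of the modes\<close>

lemma bracket_vmode_inner:
  "bracket k1 k2 (\<lambda>x. vmode k1 k2 n x \<bullet> vmode k1 k2 n' x) =
    (\<Sum>k\<in>UNIV. vcoeff n k * vcoeff n' k * bracket k1 k2 (\<lambda>x. vtrig n k x * vtrig n' k x))"
proof -
  have "vmode k1 k2 n x \<bullet> vmode k1 k2 n' x = (\<Sum>k\<in>UNIV. vcoeff n k * vcoeff n' k * (vtrig n k x * vtrig n' k x))" for x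
    by (simp add: vmode_eq inner_vec_def mult_ac)
  then show ?thesis
    by (simp add: bracket_sum continuous_intros continuous_on_vtrig bracket_cmult)
qed

text \<open>Different wave numbers or phases are separated by the trigonometric factors. If only
  \<open>c\<close> differs, all wave numbers are positive, \<open>nu\<close> is 1, and the inner
  product is that of w with K m x w, hence 0. For equal indices \<open>nu\<close> is its own square,
  so the denominator is exactly the norm.\<close>

lemma vmode_orthonormal:
  assumes n: "n \<in> N_u" and n': "n' \<in> N_u"
  shows "bracket k1 k2 (\<lambda>x. vmode k1 k2 n x \<bullet> vmode k1 k2 n' x) = of_bool (n = n')"
proof -
  obtain m p1 p2 c m' p1' p2' c' where nn: "n = (m, (p1, p2), c)" "n' = (m', (p1', p2'), c')"
    by (metis prod.exhaust)
  have p01: "p1 \<in> {0, 1}" "p2 \<in> {0, 1}" "p1' \<in> {0, 1}" "p2' \<in> {0, 1}"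
    using n n' by (auto simp: nn N_u_def phases_u_def split: if_splits)
  show ?thesis
  proof (cases "m = m' \<and> (p1, p2) = (p1', p2')")
    case False
    have "\<not> (fst n = fst n' \<and> (\<forall>j. even (phase (fst (snd n)) j + phase (fst (snd n')) j)))"
      using False p01 by (auto simp: forall_3 nn)
    moreover have "n \<noteq> n'" using False by (auto simp: nn)
    ultimately show ?thesis
      unfolding bracket_vmode_inner bracket_vtrig_mult by (simp only: if_False) simp
  next
    case True
    define N where "N n = norm (Gmat k1 k2 n *v nu n)" for n
    have N: "N n > 0" "N n' > 0" using Gmat_nu_nonzero n n' by (auto simp: N_def)
    have nu: "nu n' = nu n" using True by (simp add: nn vec_eq_iff)
    have key: "(vcoeff n k * vcoeff n' k) * (Vconst\<^sup>2 / (eta (fst n))\<^sup>2 * nu n $ k) =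
        Gmat k1 k2 n $ k $ k * Gmat k1 k2 n' $ k $ k * nu n $ k / (N n * N n')" for k
    proof -
      have "varsig (p1, p2) $ k $ k * varsig (p1, p2) $ k $ k = 1"
        by (simp add: varsig_eq del: varsig.simps flip: power_add mult_2)
      moreover have "(vcoeff n k * vcoeff n' k) * (Vconst\<^sup>2 / (eta (fst n))\<^sup>2 * nu n $ k) =
          (varsig (p1, p2) $ k $ k * varsig (p1, p2) $ k $ k) *
          (Gmat k1 k2 n $ k $ k * Gmat k1 k2 n' $ k $ k * nu n $ k / (N n * N n'))"
        using True eta_pos[of m] Vconst_pos N
        by (simp add: vcoeff_def nn N_def[symmetric] power2_eq_square field_simps
          del: Gmat.simps nu.simps varsig.simps)
      ultimately show ?thesis by simp
    qed
    have "(fst n = fst n' \<and> (\<forall>j. even (phase (fst (snd n)) j + phase (fst (snd n')) j))) = True"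
      using True by (simp add: nn)
    then have br: "bracket k1 k2 (\<lambda>x. vmode k1 k2 n x \<bullet> vmode k1 k2 n' x) =
        (\<Sum>k\<in>UNIV. Gmat k1 k2 n $ k $ k * Gmat k1 k2 n' $ k $ k * nu n $ k) / (N n * N n')"
      unfolding bracket_vmode_inner bracket_vtrig_mult by (simp only: if_True key sum_divide_distrib)
    show ?thesis
    proof (cases "c = c'")
      case c: True
      then have eq: "n' = n" using True nn by simp
      have "(N n)\<^sup>2 = (\<Sum>k\<in>UNIV. (Gmat k1 k2 n $ k $ k * nu n $ k)\<^sup>2)"
        by (simp add: N_def Gmat_mult_vec norm_vec_def L2_set_def sum_nonneg)
      also have "\<dots> = (\<Sum>k\<in>UNIV. Gmat k1 k2 n $ k $ k * Gmat k1 k2 n' $ k $ k * nu n $ k)"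
      proof (rule sum.cong[OF refl])
        fix k show "(Gmat k1 k2 n $ k $ k * nu n $ k)\<^sup>2 = Gmat k1 k2 n $ k $ k * Gmat k1 k2 n' $ k $ k * nu n $ k"
          using nu_01[of n k] by (auto simp: eq power2_eq_square)
      qed
      finally have S: "(\<Sum>k\<in>UNIV. Gmat k1 k2 n $ k $ k * Gmat k1 k2 n' $ k $ k * nu n $ k) = N n * N n'"
        by (simp add: eq power2_eq_square)
      show ?thesis unfolding br S using N by (simp add: eq)
    next
      case c: False
      then have c12: "{c, c'} = {1, 2}" and pos: "\<forall>k. m $ k > 0"
        using n n' True by (auto simp: nn N_u_def comps_u_def split: if_splits)
      have "iota (m $ j) = 1" for j using pos by (simp add: iota_def)
      then have "nu n $ k = 1" for k by (simp add: nn)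
      moreover have "(\<Sum>k\<in>UNIV. Gmat k1 k2 n $ k $ k * Gmat k1 k2 n' $ k $ k) = 0"
      proof -
        define w where "w = cross3 gam (Kvec k1 k2 m)"
        have "w \<bullet> cross3 (Kvec k1 k2 m) w = 0" by (simp add: dot_cross_self)
        moreover have "(c = 1 \<and> c' = 2) \<or> (c = 2 \<and> c' = 1)" using c12 by (auto simp: doubleton_eq_iff)
        ultimately show ?thesis
          using True by (auto simp: nn Gmat_diag w_def inner_vec_def mult.commute simp del: Gmat.simps)
      qed
      ultimately show ?thesis using c br by (simp add: nn del: Gmat.simps)
    qed
  qed
qed

lemma fmode_orthonormal:
  assumes n: "n \<in> N_theta" and n': "n' \<in> N_theta"
  shows "bracket k1 k2 (\<lambda>x. fmode k1 k2 n x * fmode k1 k2 n' x) = of_bool (n = n')"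
proof -
  obtain m p1 p2 c m' p1' p2' c' where nn: "n = (m, (p1, p2), c)" "n' = (m', (p1', p2'), c')"
    by (metis prod.exhaust)
  have p01: "p1 \<in> {0, 1}" "p2 \<in> {0, 1}" "p1' \<in> {0, 1}" "p2' \<in> {0, 1}" and c: "c = c'"
    using n n' by (auto simp: nn N_theta_def phases1_def split: if_splits)
  have "fmode k1 k2 n x * fmode k1 k2 n' x = (fcoeff n * fcoeff n') * (vtrig n 3 x * vtrig n' 3 x)" for x
    by (simp add: fmode_eq)
  then have br: "bracket k1 k2 (\<lambda>x. fmode k1 k2 n x * fmode k1 k2 n' x) =
      (fcoeff n * fcoeff n') * bracket k1 k2 (\<lambda>x. vtrig n 3 x * vtrig n' 3 x)"
    by (simp only: bracket_cmult)
  show ?thesis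
  proof (cases "n = n'")
    case False
    then have "\<not> (fst n = fst n' \<and> (\<forall>j. even (phase (fst (snd n)) j + phase (fst (snd n')) j)))"
      using p01 c by (auto simp: forall_3 nn)
    then show ?thesis
      unfolding br bracket_vtrig_mult using False by (simp only: if_False) simp
  next
    case True
    \<comment> \<open>\<open>m $ 3 > 0\<close>, and \<open>phases1\<close> forces phase 0 wherever a
      horizontal wave number is 0, so no factor is a sine of 0.\<close>
    have "nu n $ 3 = 1"
      using n by (auto simp: nn prod_UNIV_3 iota_def N_theta_def phases1_def split: if_splits)
    then show ?thesis
      unfolding br bracket_vtrig_mult fcoeff_def
      using True eta_pos[of "fst n"] Vconst_pos by (simp add: power2_eq_square)
  qed
qed

section \<open>Incompressibility and skew-symmetry of advection\<close>

text \<open>Differentiated in its own direction, every component carries the same trigonometric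
  product, and \<open>varsig\<close> cancels the sign of the derivative. What is left is the inner
  product of K m with the diagonal of \<open>Gmat\<close>, a cross product orthogonal to it.\<close>

lemma vmode_divergence_free: "(\<Sum>i\<in>UNIV. vmode_d n i x $ i) = 0"
proof -
  obtain m p c where n: "n = (m, p, c)" by (metis prod.exhaust)
  define C where "C = eta m / (norm (Gmat k1 k2 n *v nu n) * Vconst)"
  have "vmode_d n i x $ i = C * tmode K m (phase p) x * (Gmat k1 k2 n $ i $ i * Kvec k1 k2 m $ i)" for i
  proof -
    have "tmode K m ((vphase p i)(i := Suc (vphase p i i))) = tmode K m (phase p)"
      by (rule tmode_cong) (auto simp: vphase_def)
    moreover have "varsig p $ i $ i * (-1) ^ (vphase p i i + 1) = (1::real)"
      unfolding varsig_eq by (simp add: vphase_def flip: power_add mult_2)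
    moreover have "vmode_d n i x $ i = (varsig p $ i $ i * (-1) ^ (vphase p i i + 1)) *
        (C * tmode K m ((vphase p i)(i := Suc (vphase p i i))) x * (Gmat k1 k2 n $ i $ i * Kvec k1 k2 m $ i))"
      by (simp add: vmode_d_def vcoeff_def vtrig_d_def tmode_d_def n C_def Kvec_nth del: Gmat.simps varsig.simps nu.simps)
    ultimately show ?thesis by simp
  qed
  moreover have "(\<Sum>i\<in>UNIV. Gmat k1 k2 n $ i $ i * Kvec k1 k2 m $ i) = 0"
  proof -
    define d where "d = (if c = 1 then cross3 gam (Kvec k1 k2 m) else cross3 (Kvec k1 k2 m) (cross3 gam (Kvec k1 k2 m)))"
    have "d \<bullet> Kvec k1 k2 m = 0" by (auto simp: d_def dot_cross_self inner_commute)
    then show ?thesis by (simp add: n Gmat_diag d_def inner_vec_def if_distrib[of "\<lambda>v. v $ _"] del: Gmat.simps)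
  qed
  ultimately show ?thesis by (simp flip: sum_distrib_left)
qed

text \<open>Adding the vanishing divergence turns each summand into the derivative of a triple
  product led by a velocity component, so \<open>bracket_tmode_flux\<close> applies. The components
  \<open>k\<close> and \<open>k'\<close> are arbitrary, which serves velocity and temperature
  alike.\<close>

lemma bracket_advection_skew:
  "bracket k1 k2 (\<lambda>x. \<Sum>i\<in>UNIV. vmode k1 k2 l x $ i * (vtrig_d q k i x * vtrig n k' x + vtrig q k x * vtrig_d n k' i x)) = 0"
proof -
  have "(\<Sum>i\<in>UNIV. vmode k1 k2 l x $ i * (vtrig_d q k i x * vtrig n k' x + vtrig q k x * vtrig_d n k' i x)) =
      (\<Sum>i\<in>UNIV. vcoeff l i * (vtrig_d l i i x * vtrig q k x * vtrig n k' x + vtrig l i x * vtrig_d q k i x * vtrig n k' x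
        + vtrig l i x * vtrig q k x * vtrig_d n k' i x))" for x
  proof -
    have "(\<Sum>i\<in>UNIV. vcoeff l i * vtrig_d l i i x) = 0"
      using vmode_divergence_free[of l x] by (simp add: vmode_d_def)
    then have "(\<Sum>i\<in>UNIV. vcoeff l i * vtrig_d l i i x * (vtrig q k x * vtrig n k' x)) = 0"
      by (simp flip: sum_distrib_right)
    then show ?thesis
      by (simp add: vmode_eq algebra_simps sum.distrib)
  qed
  moreover have "bracket k1 k2 (\<lambda>x. \<Sum>i\<in>UNIV. vcoeff l i * (vtrig_d l i i x * vtrig q k x * vtrig n k' x
      + vtrig l i x * vtrig_d q k i x * vtrig n k' x + vtrig l i x * vtrig q k x * vtrig_d n k' i x)) =
      (\<Sum>i\<in>UNIV. vcoeff l i * bracket k1 k2 (\<lambda>x. vtrig_d l i i x * vtrig q k x * vtrig n k' x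
      + vtrig l i x * vtrig_d q k i x * vtrig n k' x + vtrig l i x * vtrig q k x * vtrig_d n k' i x))"
    by (subst bracket_sum) (auto intro!: continuous_intros continuous_on_vtrig simp: bracket_cmult)
  moreover have "bracket k1 k2 (\<lambda>x. vtrig_d l i i x * vtrig q k x * vtrig n k' x
      + vtrig l i x * vtrig_d q k i x * vtrig n k' x + vtrig l i x * vtrig q k x * vtrig_d n k' i x) = 0" for i
    unfolding vtrig_def vtrig_d_def by (rule bracket_tmode_flux) (auto simp: vphase_def phase_3)
  ultimately show ?thesis by simp
qed

definition adv_v :: "index \<Rightarrow> index \<Rightarrow> real^3 \<Rightarrow> real^3" where
  "adv_v l q x = (\<Sum>i\<in>UNIV. vmode k1 k2 l x $ i *\<^sub>R vmode_d q i x)"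

definition adv_f :: "index \<Rightarrow> index \<Rightarrow> real^3 \<Rightarrow> real" where
  "adv_f l q x = (\<Sum>i\<in>UNIV. vmode k1 k2 l x $ i * (fcoeff q * vtrig_d q 3 i x))"

lemma continuous_on_modes:
  "continuous_on S (vmode k1 k2 n)" "continuous_on S (fmode k1 k2 n)"
  "continuous_on S (adv_v l n)" "continuous_on S (adv_f l n)"
proof -
  show v: "continuous_on S (vmode k1 k2 n)" for n by (rule has_grad_continuous[OF has_grad_vmode])
  show "continuous_on S (fmode k1 k2 n)" by (rule has_grad_continuous[OF has_grad_fmode])
  have "continuous_on S (vmode_d n i)" for i
    unfolding vmode_d_def[abs_def] by (intro continuous_intros continuous_on_vtrig)
  then show "continuous_on S (adv_v l n)" "continuous_on S (adv_f l n)"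
    unfolding adv_v_def[abs_def] adv_f_def[abs_def] by (intro continuous_intros v continuous_on_vtrig | assumption)+
qed

text \<open>The sum of the two integrals is, component by component, the transport of a product and
  hence 0; the advecting mode \<open>l\<close> stays fixed.\<close>

lemma bracket_adv_v_skew:
  "bracket k1 k2 (\<lambda>x. adv_v l q x \<bullet> vmode k1 k2 n x) = - bracket k1 k2 (\<lambda>x. adv_v l n x \<bullet> vmode k1 k2 q x)"
proof -
  have "adv_v l q x \<bullet> vmode k1 k2 n x + adv_v l n x \<bullet> vmode k1 k2 q x =
     (\<Sum>k\<in>UNIV. (vcoeff q k * vcoeff n k) * (\<Sum>i\<in>UNIV. vmode k1 k2 l x $ i * (vtrig_d q k i x * vtrig n k x + vtrig q k x * vtrig_d n k i x)))" for x
    unfolding adv_v_def vmode_d_def vmode_eq[of q] vmode_eq[of n]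
    by (simp add: inner_vec_def sum_distrib_left sum_distrib_right sum.distrib[symmetric] algebra_simps)
  moreover have "bracket k1 k2 (\<lambda>x. (\<Sum>k\<in>UNIV. (vcoeff q k * vcoeff n k) * (\<Sum>i\<in>UNIV. vmode k1 k2 l x $ i *
      (vtrig_d q k i x * vtrig n k x + vtrig q k x * vtrig_d n k i x)))) = 0"
    by (subst bracket_sum)
       (auto intro!: continuous_intros continuous_on_vtrig continuous_on_modes simp: bracket_cmult bracket_advection_skew)
  ultimately have "bracket k1 k2 (\<lambda>x. adv_v l q x \<bullet> vmode k1 k2 n x + adv_v l n x \<bullet> vmode k1 k2 q x) = 0"
    by simp
  then show ?thesis
    by (subst (asm) bracket_add) (auto intro!: continuous_intros continuous_on_modes)
qed

lemma bracket_adv_f_skew: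
  "bracket k1 k2 (\<lambda>x. adv_f l q x * fmode k1 k2 n x) = - bracket k1 k2 (\<lambda>x. adv_f l n x * fmode k1 k2 q x)"
proof -
  have "adv_f l q x * fmode k1 k2 n x + adv_f l n x * fmode k1 k2 q x =
     (fcoeff q * fcoeff n) * (\<Sum>i\<in>UNIV. vmode k1 k2 l x $ i * (vtrig_d q 3 i x * vtrig n 3 x + vtrig q 3 x * vtrig_d n 3 i x))" for x
    unfolding adv_f_def fmode_eq
    by (simp add: sum_distrib_left sum_distrib_right sum.distrib[symmetric] algebra_simps)
  then have "bracket k1 k2 (\<lambda>x. adv_f l q x * fmode k1 k2 n x + adv_f l n x * fmode k1 k2 q x) = 0"
    by (simp only: bracket_cmult bracket_advection_skew mult_zero_right)
  then show ?thesis
    by (subst (asm) bracket_add) (auto intro!: continuous_intros continuous_on_modes)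
qed

end

section \<open>The truncated system\<close>

lemma has_vector_derivative_scaleR_const:
  "(f has_real_derivative D) G \<Longrightarrow> ((\<lambda>s. f s *\<^sub>R v) has_vector_derivative D *\<^sub>R v) G"
  unfolding has_real_derivative_iff_has_vector_derivative
  by (rule bounded_linear.has_vector_derivative[OF bounded_linear_scaleR_left])

lemma e3_inner: "e3 \<bullet> w = w $ 3"
  by (simp add: e3_def inner_axis' )

lemma cross_e3_inner: "cross3 e3 u \<bullet> w = u $ 1 * w $ 2 - u $ 2 * w $ 1"
  by (simp add: e3_def cross3_def inner_vec_def sum_3 axis_def)

locale truncation = wavenumbers +
  fixes R S P :: real and Nu Nt :: "index set"
  assumes R: "R \<ge> 0" and P: "P > 0"
    and finNu: "finite Nu" and Nu: "Nu \<subseteq> N_u" and finNt: "finite Nt" and Nt: "Nt \<subseteq> N_theta"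
begin

section \<open>Coefficient form of the equations\<close>

definition decay_rate :: "index \<Rightarrow> real" where
  "decay_rate n = (norm (Kvec k1 k2 (fst n)))\<^sup>2"

text \<open>One matrix for both equations: it acts in \<open>Fu\<close> and its transpose in
  \<open>Ft\<close>, which is why the energy balance sees a single flux.\<close>

definition buoy :: "index \<Rightarrow> index \<Rightarrow> real" where
  "buoy n l = bracket k1 k2 (\<lambda>x. fmode k1 k2 l x * vmode k1 k2 n x $ 3)"

definition cor :: "index \<Rightarrow> index \<Rightarrow> real" where
  "cor n l = bracket k1 k2 (\<lambda>x. cross3 e3 (vmode k1 k2 l x) \<bullet> vmode k1 k2 n x)"

definition Av :: "index \<Rightarrow> index \<Rightarrow> index \<Rightarrow> real" where
  "Av n l q = bracket k1 k2 (\<lambda>x. adv_v l q x \<bullet> vmode k1 k2 n x)"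

definition Af :: "index \<Rightarrow> index \<Rightarrow> index \<Rightarrow> real" where
  "Af n l q = bracket k1 k2 (\<lambda>x. adv_f l q x * fmode k1 k2 n x)"

definition Fu :: "index \<Rightarrow> (index + index \<Rightarrow> real) \<Rightarrow> real" where
  "Fu n z = - P * decay_rate n * z (Inl n) + P * R * (\<Sum>l\<in>Nt. buoy n l * z (Inr l))
     - P * S * (\<Sum>l\<in>Nu. cor n l * z (Inl l))
     - (\<Sum>l\<in>Nu. \<Sum>q\<in>Nu. Av n l q * (z (Inl l) * z (Inl q)))"

definition Ft :: "index \<Rightarrow> (index + index \<Rightarrow> real) \<Rightarrow> real" where
  "Ft n z = - decay_rate n * z (Inr n) + (\<Sum>l\<in>Nu. buoy l n * z (Inl l))
     - (\<Sum>l\<in>Nu. \<Sum>q\<in>Nt. Af n l q * (z (Inl l) * z (Inr q)))"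

definition F :: "index + index \<Rightarrow> (index + index \<Rightarrow> real) \<Rightarrow> real" where
  "F i = (case i of Inl n \<Rightarrow> Fu n | Inr n \<Rightarrow> Ft n)"

text \<open>The sum type merges velocity and temperature coefficients into one family, the shape in
  which \<open>solves_on\<close> treats a system.\<close>

definition I :: "(index + index) set" where "I = Inl ` Nu \<union> Inr ` Nt"

definition enc :: "state \<Rightarrow> index + index \<Rightarrow> real" where "enc Z = case_sum (fst Z) (snd Z)"

lemma enc_simps [simp]: "enc Z (Inl n) = fst Z n" "enc Z (Inr n) = snd Z n"
  by (simp_all add: enc_def)

lemma enc_inj: "enc Z = enc Z' \<Longrightarrow> Z = Z'"
  by (metis enc_simps ext prod_eqI)

lemma enc_surj: "enc (\<lambda>n. z (Inl n), \<lambda>n. z (Inr n)) = z"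
  by (auto simp: enc_def fun_eq_iff split: sum.split)

lemma finite_I: "finite I" using finNu finNt by (simp add: I_def)

lemma I_iff: "Inl n \<in> I \<longleftrightarrow> n \<in> Nu" "Inr n \<in> I \<longleftrightarrow> n \<in> Nt"
  unfolding I_def by blast+

lemma phase_space_iff: "Z \<in> phase_space Nu Nt \<longleftrightarrow> (\<forall>i. i \<notin> I \<longrightarrow> enc Z i = 0)"
proof -
  have "(\<forall>i. i \<notin> I \<longrightarrow> enc Z i = 0) \<longleftrightarrow> (\<forall>n. n \<notin> Nu \<longrightarrow> fst Z n = 0) \<and> (\<forall>n. n \<notin> Nt \<longrightarrow> snd Z n = 0)"
    by (subst split_sum_all) (simp add: I_iff)
  then show ?thesis by (simp add: phase_space_def case_prod_beta mem_Times_iff)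
qed

lemma sum_I: "(\<Sum>i\<in>I. g i) = (\<Sum>n\<in>Nu. g (Inl n)) + (\<Sum>n\<in>Nt. g (Inr n))"
  unfolding I_def using finNu finNt
  by (subst sum.union_disjoint) (auto simp: sum.reindex)

lemma polyfun_F: "polyfun (F i)"
  unfolding F_def Fu_def[abs_def] Ft_def[abs_def]
  by (cases i) (auto intro!: polyfun_diff polyfun_sum polyfun.intros)

lemma u_field_eq: "u_field k1 k2 Nu Z = (\<lambda>x. \<Sum>n\<in>Nu. fst Z n *\<^sub>R vmode k1 k2 n x)"
  by (simp add: u_field_def fun_eq_iff)

lemma theta_field_eq: "theta_field k1 k2 Nt Z = (\<lambda>x. \<Sum>n\<in>Nt. snd Z n * fmode k1 k2 n x)"
  by (simp add: theta_field_def fun_eq_iff)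

lemma advect_u: "advect (u_field k1 k2 Nu Z) (u_field k1 k2 Nu Z) x =
    (\<Sum>l\<in>Nu. \<Sum>q\<in>Nu. (fst Z l * fst Z q) *\<^sub>R adv_v l q x)"
proof -
  have pd: "pd i (u_field k1 k2 Nu Z) x = (\<Sum>q\<in>Nu. fst Z q *\<^sub>R vmode_d q i x)" for i
    unfolding u_field_eq by (simp add: has_grad_pd[OF has_grad_sum[OF has_grad_vmode]])
  have "advect (u_field k1 k2 Nu Z) (u_field k1 k2 Nu Z) x =
      (\<Sum>i\<in>UNIV. \<Sum>l\<in>Nu. \<Sum>q\<in>Nu. (fst Z l * fst Z q) *\<^sub>R (vmode k1 k2 l x $ i *\<^sub>R vmode_d q i x))"
    unfolding advect_def pd by (simp add: u_field_eq scaleR_sum_left) (simp add: scaleR_sum_right mult_ac)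
  also have "\<dots> = (\<Sum>l\<in>Nu. \<Sum>q\<in>Nu. \<Sum>i\<in>UNIV. (fst Z l * fst Z q) *\<^sub>R (vmode k1 k2 l x $ i *\<^sub>R vmode_d q i x))"
    by (subst sum.swap, rule sum.cong[OF refl], rule sum.swap)
  finally show ?thesis by (simp add: adv_v_def scaleR_sum_right)
qed

lemma advect_theta: "advect (u_field k1 k2 Nu Z) (theta_field k1 k2 Nt Z) x =
    (\<Sum>l\<in>Nu. \<Sum>q\<in>Nt. (fst Z l * snd Z q) * adv_f l q x)"
proof -
  have pd: "pd i (theta_field k1 k2 Nt Z) x = (\<Sum>q\<in>Nt. snd Z q * (fcoeff q * vtrig_d q 3 i x))" for i
    using fun_cong[OF has_grad_pd[OF has_grad_sum[where A=Nt and c="snd Z", OF has_grad_fmode]], where x=x]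
    by (simp add: theta_field_eq)
  have "advect (u_field k1 k2 Nu Z) (theta_field k1 k2 Nt Z) x =
      (\<Sum>i\<in>UNIV. \<Sum>l\<in>Nu. \<Sum>q\<in>Nt. (fst Z l * snd Z q) * (vmode k1 k2 l x $ i * (fcoeff q * vtrig_d q 3 i x)))"
    unfolding advect_def pd by (simp add: u_field_eq sum_product mult_ac)
  also have "\<dots> = (\<Sum>l\<in>Nu. \<Sum>q\<in>Nt. \<Sum>i\<in>UNIV. (fst Z l * snd Z q) * (vmode k1 k2 l x $ i * (fcoeff q * vtrig_d q 3 i x)))"
    by (subst sum.swap, rule sum.cong[OF refl], rule sum.swap)
  finally show ?thesis by (simp add: adv_f_def sum_distrib_left)
qed

lemmas cont = continuous_intros continuous_on_modes

lemma bracket_sum_cmult: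
  assumes "finite A" "\<And>n. continuous_on UNIV (f n)"
  shows "bracket k1 k2 (\<lambda>x. \<Sum>n\<in>A. c n * f n x) = (\<Sum>n\<in>A. c n * bracket k1 k2 (f n))"
  by (subst bracket_sum) (auto intro!: continuous_intros assms simp: bracket_cmult)

lemma bracket_sum2_cmult:
  assumes "finite A" "finite B" "\<And>n q. continuous_on UNIV (f n q)"
  shows "bracket k1 k2 (\<lambda>x. \<Sum>n\<in>A. \<Sum>q\<in>B. c n q * f n q x) = (\<Sum>n\<in>A. \<Sum>q\<in>B. c n q * bracket k1 k2 (f n q))"
  by (subst bracket_sum) (auto intro!: continuous_intros assms simp: bracket_sum_cmult assms)

lemma rhs_u_eq: "rhs_u R S P k1 k2 Nu Nt Z x = (\<Sum>n\<in>Nu. Fu n (enc Z) *\<^sub>R vmode k1 k2 n x)"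
proof -
  have "bracket k1 k2 (\<lambda>y. (theta_field k1 k2 Nt Z y *\<^sub>R e3) \<bullet> vmode k1 k2 n y) =
      (\<Sum>l\<in>Nt. buoy n l * snd Z l)" for n
  proof -
    have "(theta_field k1 k2 Nt Z y *\<^sub>R e3) \<bullet> vmode k1 k2 n y =
        (\<Sum>l\<in>Nt. snd Z l * (fmode k1 k2 l y * vmode k1 k2 n y $ 3))" for y
      by (simp add: theta_field_eq e3_inner sum_distrib_left sum_distrib_right mult_ac)
    then show ?thesis
      by (simp add: bracket_sum_cmult[OF finNt] cont buoy_def mult.commute)
  qed
  moreover have "bracket k1 k2 (\<lambda>y. cross3 e3 (u_field k1 k2 Nu Z y) \<bullet> vmode k1 k2 n y) =
      (\<Sum>l\<in>Nu. cor n l * fst Z l)" for n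
  proof -
    have "cross3 e3 (u_field k1 k2 Nu Z y) \<bullet> vmode k1 k2 n y =
        (\<Sum>l\<in>Nu. fst Z l * (cross3 e3 (vmode k1 k2 l y) \<bullet> vmode k1 k2 n y))" for y
      by (simp add: u_field_eq cross_e3_inner sum_distrib_left sum_distrib_right right_diff_distrib sum_subtractf mult_ac)
    moreover have "continuous_on UNIV (\<lambda>y. cross3 e3 (vmode k1 k2 l y) \<bullet> vmode k1 k2 n y)" for l
      unfolding cross_e3_inner by (intro cont)
    ultimately show ?thesis
      by (simp add: bracket_sum_cmult[OF finNu] cor_def mult.commute)
  qed
  moreover have "bracket k1 k2 (\<lambda>y. advect (u_field k1 k2 Nu Z) (u_field k1 k2 Nu Z) y \<bullet> vmode k1 k2 n y) =
      (\<Sum>l\<in>Nu. \<Sum>q\<in>Nu. Av n l q * (fst Z l * fst Z q))" for n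
  proof -
    have "advect (u_field k1 k2 Nu Z) (u_field k1 k2 Nu Z) y \<bullet> vmode k1 k2 n y =
        (\<Sum>l\<in>Nu. \<Sum>q\<in>Nu. (fst Z l * fst Z q) * (adv_v l q y \<bullet> vmode k1 k2 n y))" for y
      by (simp add: advect_u inner_sum_left)
    then show ?thesis
      by (simp add: bracket_sum2_cmult[OF finNu finNu] cont Av_def mult.commute)
  qed
  moreover have "laplacian (u_field k1 k2 Nu Z) x = (\<Sum>n\<in>Nu. (- decay_rate n * fst Z n) *\<^sub>R vmode k1 k2 n x)"
    unfolding u_field_eq laplacian_vmode_sum[OF finNu] decay_rate_def ..
  ultimately show ?thesis
    by (simp add: rhs_u_def Let_def proj_u_def Fu_def scaleR_sum_right sum.distrib[symmetric]
      sum_subtractf[symmetric] scaleR_left_distrib scaleR_left_diff_distrib sum_negf[symmetric] mult_ac)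
qed

lemma rhs_theta_eq: "rhs_theta k1 k2 Nu Nt Z x = (\<Sum>n\<in>Nt. Ft n (enc Z) * fmode k1 k2 n x)"
proof -
  have "bracket k1 k2 (\<lambda>y. u_field k1 k2 Nu Z y $ 3 * fmode k1 k2 n y) =
      (\<Sum>l\<in>Nu. buoy l n * fst Z l)" for n
  proof -
    have "u_field k1 k2 Nu Z y $ 3 * fmode k1 k2 n y =
        (\<Sum>l\<in>Nu. fst Z l * (fmode k1 k2 n y * vmode k1 k2 l y $ 3))" for y
      by (simp add: u_field_eq sum_distrib_left sum_distrib_right mult_ac)
    then show ?thesis
      by (simp add: bracket_sum_cmult[OF finNu] cont buoy_def mult.commute)
  qed
  moreover have "bracket k1 k2 (\<lambda>y. advect (u_field k1 k2 Nu Z) (theta_field k1 k2 Nt Z) y * fmode k1 k2 n y) =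
      (\<Sum>l\<in>Nu. \<Sum>q\<in>Nt. Af n l q * (fst Z l * snd Z q))" for n
  proof -
    have "advect (u_field k1 k2 Nu Z) (theta_field k1 k2 Nt Z) y * fmode k1 k2 n y =
        (\<Sum>l\<in>Nu. \<Sum>q\<in>Nt. (fst Z l * snd Z q) * (adv_f l q y * fmode k1 k2 n y))" for y
      by (simp add: advect_theta sum_distrib_left sum_distrib_right mult_ac)
    then show ?thesis
      by (simp add: bracket_sum2_cmult[OF finNu finNt] cont Af_def mult.commute)
  qed
  moreover have "laplacian (theta_field k1 k2 Nt Z) x = (\<Sum>n\<in>Nt. (- decay_rate n * snd Z n) * fmode k1 k2 n x)"
    unfolding theta_field_eq laplacian_fmode_sum[OF finNt] decay_rate_def ..
  ultimately show ?thesis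
    by (simp add: rhs_theta_def Let_def proj_theta_def Ft_def sum.distrib[symmetric]
      sum_subtractf[symmetric] distrib_right left_diff_distrib sum_negf[symmetric])
qed

lemma bracket_cong: "(\<And>x. x \<in> Omega k1 k2 \<Longrightarrow> f x = g x) \<Longrightarrow> bracket k1 k2 f = bracket k1 k2 g"
  unfolding bracket_def by (rule integral_cong)

lemma bracket_u_field_vmode:
  assumes n: "n \<in> Nu"
  shows "bracket k1 k2 (\<lambda>x. (\<Sum>l\<in>Nu. c l *\<^sub>R vmode k1 k2 l x) \<bullet> vmode k1 k2 n x) = c n"
proof -
  have "bracket k1 k2 (\<lambda>x. (\<Sum>l\<in>Nu. c l *\<^sub>R vmode k1 k2 l x) \<bullet> vmode k1 k2 n x) =
      (\<Sum>l\<in>Nu. c l * bracket k1 k2 (\<lambda>x. vmode k1 k2 l x \<bullet> vmode k1 k2 n x))"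
    by (simp add: inner_sum_left bracket_sum_cmult[OF finNu] cont)
  also have "\<dots> = (\<Sum>l\<in>Nu. if l = n then c l else 0)"
    by (intro sum.cong refl) (simp add: vmode_orthonormal[OF subsetD[OF Nu] subsetD[OF Nu n]])
  finally show ?thesis using finNu n by simp
qed

lemma bracket_theta_field_fmode:
  assumes n: "n \<in> Nt"
  shows "bracket k1 k2 (\<lambda>x. (\<Sum>l\<in>Nt. c l * fmode k1 k2 l x) * fmode k1 k2 n x) = c n"
proof -
  have "bracket k1 k2 (\<lambda>x. (\<Sum>l\<in>Nt. c l * fmode k1 k2 l x) * fmode k1 k2 n x) =
      (\<Sum>l\<in>Nt. c l * bracket k1 k2 (\<lambda>x. fmode k1 k2 l x * fmode k1 k2 n x))"
    by (simp add: sum_distrib_right bracket_sum_cmult[OF finNt] cont mult.assoc)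
  also have "\<dots> = (\<Sum>l\<in>Nt. if l = n then c l else 0)"
    by (intro sum.cong refl) (simp add: fmode_orthonormal[OF subsetD[OF Nt] subsetD[OF Nt n]])
  finally show ?thesis using finNt n by simp
qed

lemma at_within_Ici_neq_bot:
  assumes "0 \<le> (t::real)" shows "at t within {0..} \<noteq> bot"
proof
  assume "at t within {0..} = bot"
  moreover have "at_right t \<le> at t within {0..}" using assms by (intro at_le) auto
  ultimately show False by (simp add: bot_unique)
qed

text \<open>From coefficients to fields this is linearity. Conversely, each field has a derivative
  from the assumed differentiability of the coefficients and one from the equation; these agree
  because one-sided derivatives are unique, and orthonormality extracts the coefficients.\<close>

lemma is_solution_iff:
  "is_solution R S P k1 k2 Nu Nt X \<longleftrightarrow> solves_on {0..} I F (\<lambda>t. enc (X t))"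
proof
  assume X: "solves_on {0..} I F (\<lambda>t. enc (X t))"
  show "is_solution R S P k1 k2 Nu Nt X"
    unfolding is_solution_def
  proof (intro allI impI)
    fix t :: real assume t: "t \<ge> 0"
    have du: "((\<lambda>s. fst (X s) n) has_real_derivative Fu n (enc (X t))) (at t within {0..})" if "n \<in> Nu" for n
      using X t that unfolding solves_on_def I_def F_def by (auto dest!: bspec[of _ _ t] bspec[of _ _ "Inl n"])
    have dt: "((\<lambda>s. snd (X s) n) has_real_derivative Ft n (enc (X t))) (at t within {0..})" if "n \<in> Nt" for n
      using X t that unfolding solves_on_def I_def F_def by (auto dest!: bspec[of _ _ t] bspec[of _ _ "Inr n"])
    have "X t \<in> phase_space Nu Nt" using X t by (auto simp: solves_on_def phase_space_iff)
    moreover have "\<forall>n\<in>Nu. (\<lambda>s. fst (X s) n) differentiable (at t within {0..})"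
      "\<forall>n\<in>Nt. (\<lambda>s. snd (X s) n) differentiable (at t within {0..})"
      using du dt unfolding real_differentiable_def by blast+
    moreover have "((\<lambda>s. u_field k1 k2 Nu (X s) x) has_vector_derivative rhs_u R S P k1 k2 Nu Nt (X t) x) (at t within {0..})" for x
      unfolding u_field_eq rhs_u_eq
      by (intro has_vector_derivative_sum has_vector_derivative_scaleR_const du)
    moreover have "((\<lambda>s. theta_field k1 k2 Nt (X s) x) has_real_derivative rhs_theta k1 k2 Nu Nt (X t) x) (at t within {0..})" for x
      unfolding theta_field_eq rhs_theta_eq
      by (intro DERIV_sum DERIV_cmult_right dt)
    ultimately show "X t \<in> phase_space Nu Nt
        \<and> (\<forall>n\<in>Nu. (\<lambda>s. fst (X s) n) differentiable (at t within {0..}))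
        \<and> (\<forall>n\<in>Nt. (\<lambda>s. snd (X s) n) differentiable (at t within {0..}))
        \<and> (\<forall>x\<in>Omega k1 k2.
             ((\<lambda>s. u_field k1 k2 Nu (X s) x) has_vector_derivative
                rhs_u R S P k1 k2 Nu Nt (X t) x) (at t within {0..})
           \<and> ((\<lambda>s. theta_field k1 k2 Nt (X s) x) has_real_derivative
                rhs_theta k1 k2 Nu Nt (X t) x) (at t within {0..}))" by blast
  qed
next
  assume X: "is_solution R S P k1 k2 Nu Nt X"
  show "solves_on {0..} I F (\<lambda>t. enc (X t))"
    unfolding solves_on_def
  proof (intro ballI conjI)
    fix t :: real assume "t \<in> {0..}"
    then have t: "t \<ge> 0" by simp
    have nb: "at t within {0..} \<noteq> bot" by (rule at_within_Ici_neq_bot[OF t])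
    note X' = X[unfolded is_solution_def, rule_format, OF t]
    from X' show "\<forall>i. i \<notin> I \<longrightarrow> enc (X t) i = 0" by (simp add: phase_space_iff)
    have "\<forall>n\<in>Nu. \<exists>D. ((\<lambda>s. fst (X s) n) has_real_derivative D) (at t within {0..})"
      using X' by (auto simp: real_differentiable_def)
    then obtain du where du: "\<And>n. n \<in> Nu \<Longrightarrow> ((\<lambda>s. fst (X s) n) has_real_derivative du n) (at t within {0..})"
      by metis
    have "\<forall>n\<in>Nt. \<exists>D. ((\<lambda>s. snd (X s) n) has_real_derivative D) (at t within {0..})"
      using X' by (auto simp: real_differentiable_def)
    then obtain dt where dt: "\<And>n. n \<in> Nt \<Longrightarrow> ((\<lambda>s. snd (X s) n) has_real_derivative dt n) (at t within {0..})"
      by metis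
    have "(\<Sum>n\<in>Nu. du n *\<^sub>R vmode k1 k2 n x) = (\<Sum>n\<in>Nu. Fu n (enc (X t)) *\<^sub>R vmode k1 k2 n x)"
      if "x \<in> Omega k1 k2" for x
    proof (rule vector_derivative_unique_within[OF nb])
      show "((\<lambda>s. u_field k1 k2 Nu (X s) x) has_vector_derivative (\<Sum>n\<in>Nu. du n *\<^sub>R vmode k1 k2 n x)) (at t within {0..})"
        unfolding u_field_eq
        by (intro has_vector_derivative_sum has_vector_derivative_scaleR_const du)
      show "((\<lambda>s. u_field k1 k2 Nu (X s) x) has_vector_derivative (\<Sum>n\<in>Nu. Fu n (enc (X t)) *\<^sub>R vmode k1 k2 n x)) (at t within {0..})"
        using X' that by (simp add: rhs_u_eq)
    qed
    \<comment> \<open>The identity is known on \<open>Omega\<close> only, which is exactly the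
      domain of integration; pairing with a mode isolates its coefficient.\<close>
    then have "bracket k1 k2 (\<lambda>x. (\<Sum>l\<in>Nu. du l *\<^sub>R vmode k1 k2 l x) \<bullet> vmode k1 k2 n x) =
        bracket k1 k2 (\<lambda>x. (\<Sum>l\<in>Nu. Fu l (enc (X t)) *\<^sub>R vmode k1 k2 l x) \<bullet> vmode k1 k2 n x)" for n
      by (intro bracket_cong) simp
    then have u: "du n = Fu n (enc (X t))" if "n \<in> Nu" for n
      using bracket_u_field_vmode[OF that, of du] bracket_u_field_vmode[OF that, of "\<lambda>l. Fu l (enc (X t))"] by simp
    have "(\<Sum>n\<in>Nt. dt n * fmode k1 k2 n x) = (\<Sum>n\<in>Nt. Ft n (enc (X t)) * fmode k1 k2 n x)"
      if "x \<in> Omega k1 k2" for x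
    proof (rule vector_derivative_unique_within[OF nb])
      show "((\<lambda>s. theta_field k1 k2 Nt (X s) x) has_vector_derivative (\<Sum>n\<in>Nt. dt n * fmode k1 k2 n x)) (at t within {0..})"
        unfolding theta_field_eq has_real_derivative_iff_has_vector_derivative[symmetric]
        by (intro DERIV_sum DERIV_cmult_right dt)
      show "((\<lambda>s. theta_field k1 k2 Nt (X s) x) has_vector_derivative (\<Sum>n\<in>Nt. Ft n (enc (X t)) * fmode k1 k2 n x)) (at t within {0..})"
        using X' that by (simp add: rhs_theta_eq has_real_derivative_iff_has_vector_derivative[symmetric])
    qed
    then have "bracket k1 k2 (\<lambda>x. (\<Sum>l\<in>Nt. dt l * fmode k1 k2 l x) * fmode k1 k2 n x) =
        bracket k1 k2 (\<lambda>x. (\<Sum>l\<in>Nt. Ft l (enc (X t)) * fmode k1 k2 l x) * fmode k1 k2 n x)" for n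
      by (intro bracket_cong) simp
    then have th: "dt n = Ft n (enc (X t))" if "n \<in> Nt" for n
      using bracket_theta_field_fmode[OF that, of dt] bracket_theta_field_fmode[OF that, of "\<lambda>l. Ft l (enc (X t))"] by simp
    fix i assume "i \<in> I"
    then show "((\<lambda>s. enc (X s) i) has_real_derivative F i (enc (X t))) (at t within {0..})"
      using du dt u th by (auto simp: I_def F_def)
  qed
qed

section \<open>Energy estimates\<close>

lemma cor_skew: "cor n l = - cor l n"
proof -
  have "cross3 e3 (vmode k1 k2 l x) \<bullet> vmode k1 k2 n x = (-1) * (cross3 e3 (vmode k1 k2 n x) \<bullet> vmode k1 k2 l x)" for x
    by (simp add: cross_e3_inner)
  then show ?thesis unfolding cor_def by (simp only: bracket_cmult)
qed

lemma sum_skew_eq_0: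
  fixes a :: "'b \<Rightarrow> real"
  assumes "\<And>n l. M n l = - M l n"
  shows "(\<Sum>n\<in>A. \<Sum>l\<in>A. M n l * (a n * a l)) = 0"
proof -
  have "(\<Sum>n\<in>A. \<Sum>l\<in>A. M n l * (a n * a l)) = (\<Sum>l\<in>A. \<Sum>n\<in>A. M n l * (a n * a l))"
    by (rule sum.swap)
  also have "\<dots> = (\<Sum>l\<in>A. \<Sum>n\<in>A. - (M l n * (a l * a n)))"
  proof (intro sum.cong refl)
    fix l n show "M n l * (a n * a l) = - (M l n * (a l * a n))" using assms[of n l] by simp
  qed
  finally show ?thesis by (simp add: sum_negf)
qed

definition u_energy :: "(index + index \<Rightarrow> real) \<Rightarrow> real" where "u_energy z = (\<Sum>n\<in>Nu. (z (Inl n))\<^sup>2)"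
definition theta_energy :: "(index + index \<Rightarrow> real) \<Rightarrow> real" where "theta_energy z = (\<Sum>n\<in>Nt. (z (Inr n))\<^sup>2)"
definition buoyancy_flux :: "(index + index \<Rightarrow> real) \<Rightarrow> real" where
  "buoyancy_flux z = (\<Sum>n\<in>Nu. \<Sum>l\<in>Nt. buoy n l * (z (Inl n) * z (Inr l)))"

lemma u_energy_nonneg: "u_energy z \<ge> 0" and theta_energy_nonneg: "theta_energy z \<ge> 0"
  by (simp_all add: u_energy_def theta_energy_def sum_nonneg)

text \<open>The weight \<open>1 / P\<close> cancels the Prandtl number in the velocity equation;
  \<open>\<beta>\<close> stays free because existence and decay choose it differently.\<close>

definition energy_wt :: "real \<Rightarrow> index + index \<Rightarrow> real" where
  "energy_wt \<beta> i = (case i of Inl n \<Rightarrow> 1 / P | Inr n \<Rightarrow> \<beta>)"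

lemma weighted_energy: "(\<Sum>i\<in>I. energy_wt \<beta> i * (z i)\<^sup>2) = u_energy z / P + \<beta> * theta_energy z"
  by (simp add: sum_I energy_wt_def u_energy_def theta_energy_def sum_distrib_left sum_divide_distrib)

lemma energy_balance:
  "(\<Sum>i\<in>I. energy_wt \<beta> i * z i * F i z) =
    - (\<Sum>n\<in>Nu. decay_rate n * (z (Inl n))\<^sup>2) - \<beta> * (\<Sum>n\<in>Nt. decay_rate n * (z (Inr n))\<^sup>2) + (R + \<beta>) * buoyancy_flux z"
proof -
  have c0: "(\<Sum>n\<in>Nu. \<Sum>l\<in>Nu. cor n l * (z (Inl n) * z (Inl l))) = 0"
    by (rule sum_skew_eq_0) (rule cor_skew)
  \<comment> \<open>The coefficient of the advecting mode is moved outermost; for each fixed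
    advecting mode the remaining double sum is a skew form in test and advected mode.\<close>
  have u0: "(\<Sum>n\<in>Nu. z (Inl n) * (\<Sum>l\<in>Nu. \<Sum>q\<in>Nu. Av n l q * (z (Inl l) * z (Inl q)))) = 0"
  proof -
    have "(\<Sum>n\<in>Nu. z (Inl n) * (\<Sum>l\<in>Nu. \<Sum>q\<in>Nu. Av n l q * (z (Inl l) * z (Inl q)))) =
        (\<Sum>n\<in>Nu. \<Sum>l\<in>Nu. \<Sum>q\<in>Nu. z (Inl l) * (Av n l q * (z (Inl n) * z (Inl q))))"
      by (simp add: sum_distrib_left mult_ac)
    also have "\<dots> = (\<Sum>l\<in>Nu. \<Sum>n\<in>Nu. \<Sum>q\<in>Nu. z (Inl l) * (Av n l q * (z (Inl n) * z (Inl q))))"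
      by (rule sum.swap)
    also have "\<dots> = (\<Sum>l\<in>Nu. z (Inl l) * (\<Sum>n\<in>Nu. \<Sum>q\<in>Nu. Av n l q * (z (Inl n) * z (Inl q))))"
      by (simp add: sum_distrib_left)
    also have "\<dots> = 0"
    proof -
      have "Av n l q = - Av q l n" for n l q unfolding Av_def by (rule bracket_adv_v_skew)
      then have "(\<Sum>n\<in>Nu. \<Sum>q\<in>Nu. Av n l q * (z (Inl n) * z (Inl q))) = 0" for l
        by (rule sum_skew_eq_0)
      then show ?thesis by simp
    qed
    finally show ?thesis .
  qed
  have t0: "(\<Sum>n\<in>Nt. z (Inr n) * (\<Sum>l\<in>Nu. \<Sum>q\<in>Nt. Af n l q * (z (Inl l) * z (Inr q)))) = 0"
  proof -
    have "(\<Sum>n\<in>Nt. z (Inr n) * (\<Sum>l\<in>Nu. \<Sum>q\<in>Nt. Af n l q * (z (Inl l) * z (Inr q)))) =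
        (\<Sum>n\<in>Nt. \<Sum>l\<in>Nu. \<Sum>q\<in>Nt. z (Inl l) * (Af n l q * (z (Inr n) * z (Inr q))))"
      by (simp add: sum_distrib_left mult_ac)
    also have "\<dots> = (\<Sum>l\<in>Nu. \<Sum>n\<in>Nt. \<Sum>q\<in>Nt. z (Inl l) * (Af n l q * (z (Inr n) * z (Inr q))))"
      by (rule sum.swap)
    also have "\<dots> = (\<Sum>l\<in>Nu. z (Inl l) * (\<Sum>n\<in>Nt. \<Sum>q\<in>Nt. Af n l q * (z (Inr n) * z (Inr q))))"
      by (simp add: sum_distrib_left)
    also have "\<dots> = 0"
    proof -
      have "Af n l q = - Af q l n" for n l q unfolding Af_def by (rule bracket_adv_f_skew)
      then have "(\<Sum>n\<in>Nt. \<Sum>q\<in>Nt. Af n l q * (z (Inr n) * z (Inr q))) = 0" for l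
        by (rule sum_skew_eq_0)
      then show ?thesis by simp
    qed
    finally show ?thesis .
  qed
  have "(\<Sum>n\<in>Nu. z (Inl n) * Fu n z) = - P * (\<Sum>n\<in>Nu. decay_rate n * (z (Inl n))\<^sup>2) + P * R * buoyancy_flux z
      - P * S * (\<Sum>n\<in>Nu. \<Sum>l\<in>Nu. cor n l * (z (Inl n) * z (Inl l)))
      - (\<Sum>n\<in>Nu. z (Inl n) * (\<Sum>l\<in>Nu. \<Sum>q\<in>Nu. Av n l q * (z (Inl l) * z (Inl q))))"
    unfolding Fu_def buoyancy_flux_def
    by (simp add: distrib_left right_diff_distrib sum.distrib sum_subtractf sum_distrib_left
      sum_negf power2_eq_square mult_ac)
  then have "(\<Sum>n\<in>Nu. z (Inl n) * Fu n z) = P * (- (\<Sum>n\<in>Nu. decay_rate n * (z (Inl n))\<^sup>2) + R * buoyancy_flux z)"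
    unfolding c0 u0 by (simp add: algebra_simps)
  moreover have "(\<Sum>n\<in>Nu. 1 / P * z (Inl n) * Fu n z) = (\<Sum>n\<in>Nu. z (Inl n) * Fu n z) / P"
    by (simp add: sum_divide_distrib)
  ultimately have U: "(\<Sum>n\<in>Nu. 1 / P * z (Inl n) * Fu n z) = - (\<Sum>n\<in>Nu. decay_rate n * (z (Inl n))\<^sup>2) + R * buoyancy_flux z"
    using P by simp
  have flux_swap: "buoyancy_flux z = (\<Sum>n\<in>Nt. \<Sum>l\<in>Nu. buoy l n * (z (Inl l) * z (Inr n)))"
    unfolding buoyancy_flux_def by (rule sum.swap)
  have "(\<Sum>n\<in>Nt. z (Inr n) * Ft n z) = - (\<Sum>n\<in>Nt. decay_rate n * (z (Inr n))\<^sup>2) + buoyancy_flux z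
      - (\<Sum>n\<in>Nt. z (Inr n) * (\<Sum>l\<in>Nu. \<Sum>q\<in>Nt. Af n l q * (z (Inl l) * z (Inr q))))"
    unfolding Ft_def flux_swap
    by (simp add: distrib_left right_diff_distrib sum.distrib sum_subtractf sum_distrib_left
      sum_negf power2_eq_square mult_ac)
  then have "(\<Sum>n\<in>Nt. \<beta> * z (Inr n) * Ft n z) = \<beta> * (- (\<Sum>n\<in>Nt. decay_rate n * (z (Inr n))\<^sup>2) + buoyancy_flux z)"
    unfolding t0 by (simp add: mult.assoc flip: sum_distrib_left)
  then show ?thesis
    using U by (simp add: sum_I energy_wt_def F_def algebra_simps)
qed

text \<open>The coupling is bounded by the nonnegativity of the integral of \<open>\<bar>s u - \<theta> e3\<bar>\<^sup>2\<close>.\<close>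

lemma buoyancy_flux_bound: "2 * s * buoyancy_flux z \<le> s\<^sup>2 * u_energy z + theta_energy z"
proof -
  define u where "u x = (\<Sum>n\<in>Nu. z (Inl n) *\<^sub>R vmode k1 k2 n x)" for x
  define \<theta> where "\<theta> x = (\<Sum>n\<in>Nt. z (Inr n) * fmode k1 k2 n x)" for x
  have cu: "continuous_on UNIV u" "continuous_on UNIV \<theta>"
    unfolding u_def \<theta>_def by (intro cont)+
  \<comment> \<open>Parseval: one factor is expanded and the other kept whole, so that
    \<open>bracket_u_field_vmode\<close> yields its coefficients.\<close>
  have "bracket k1 k2 (\<lambda>x. u x \<bullet> u x) = bracket k1 k2 (\<lambda>x. \<Sum>n\<in>Nu. z (Inl n) * (u x \<bullet> vmode k1 k2 n x))"
    by (subst (2) u_def) (simp add: inner_sum_right)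
  also have "\<dots> = (\<Sum>n\<in>Nu. z (Inl n) * bracket k1 k2 (\<lambda>x. u x \<bullet> vmode k1 k2 n x))"
    by (intro bracket_sum_cmult finNu cont cu)
  also have "\<dots> = u_energy z"
    unfolding u_def u_energy_def by (intro sum.cong refl) (simp add: bracket_u_field_vmode power2_eq_square)
  finally have A: "bracket k1 k2 (\<lambda>x. u x \<bullet> u x) = u_energy z" .
  have "bracket k1 k2 (\<lambda>x. \<theta> x * \<theta> x) = bracket k1 k2 (\<lambda>x. \<Sum>n\<in>Nt. z (Inr n) * (\<theta> x * fmode k1 k2 n x))"
    by (subst (2) \<theta>_def) (simp add: sum_distrib_left mult_ac)
  also have "\<dots> = (\<Sum>n\<in>Nt. z (Inr n) * bracket k1 k2 (\<lambda>x. \<theta> x * fmode k1 k2 n x))"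
    by (intro bracket_sum_cmult finNt cont cu)
  also have "\<dots> = theta_energy z"
    unfolding \<theta>_def theta_energy_def by (intro sum.cong refl) (simp add: bracket_theta_field_fmode power2_eq_square)
  finally have B: "bracket k1 k2 (\<lambda>x. \<theta> x * \<theta> x) = theta_energy z" .
  have "\<theta> x * u x $ 3 = (\<Sum>n\<in>Nu. \<Sum>l\<in>Nt. (z (Inl n) * z (Inr l)) * (fmode k1 k2 l x * vmode k1 k2 n x $ 3))" for x
    unfolding u_def \<theta>_def by (simp add: sum_product mult_ac) (rule sum.swap)
  then have C: "bracket k1 k2 (\<lambda>x. \<theta> x * u x $ 3) = buoyancy_flux z"
    by (simp add: bracket_sum2_cmult[OF finNu finNt] cont buoyancy_flux_def buoy_def mult.commute)
  have "0 \<le> bracket k1 k2 (\<lambda>x. s\<^sup>2 * (u x \<bullet> u x) + (\<theta> x * \<theta> x - 2 * s * (\<theta> x * u x $ 3)))"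
  proof (rule bracket_nonneg)
    show "continuous_on UNIV (\<lambda>x. s\<^sup>2 * (u x \<bullet> u x) + (\<theta> x * \<theta> x - 2 * s * (\<theta> x * u x $ 3)))"
      by (intro cont cu)
    fix x
    have "0 \<le> (s *\<^sub>R u x - \<theta> x *\<^sub>R e3) \<bullet> (s *\<^sub>R u x - \<theta> x *\<^sub>R e3)" by simp
    also have "\<dots> = s\<^sup>2 * (u x \<bullet> u x) + (\<theta> x * \<theta> x - 2 * s * (\<theta> x * u x $ 3))"
    proof -
      have "e3 \<bullet> e3 = 1" by (simp add: e3_inner) (simp add: e3_def axis_def)
      moreover have "u x \<bullet> e3 = u x $ 3" by (simp add: inner_commute e3_inner)
      ultimately show ?thesis
        by (simp add: inner_diff_left inner_diff_right e3_inner power2_eq_square algebra_simps)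
    qed
    finally show "0 \<le> s\<^sup>2 * (u x \<bullet> u x) + (\<theta> x * \<theta> x - 2 * s * (\<theta> x * u x $ 3))" .
  qed
  also have "\<dots> = s\<^sup>2 * u_energy z + (theta_energy z - 2 * s * buoyancy_flux z)"
    using A B C by (subst bracket_add, (intro cont cu)+)
      (subst bracket_diff, (intro cont cu)+, simp add: bracket_cmult)
  finally show ?thesis by simp
qed

lemma decay_rate_nonneg: "decay_rate n \<ge> 0" by (simp add: decay_rate_def)

text \<open>Dissipation is dropped and the flux bound is taken at \<open>s = 1\<close>; the factor
  \<open>P + 1\<close> passes from the plain to the weighted energy.\<close>

lemma energy_growth:
  "(\<Sum>i\<in>I. energy_wt 1 i * z i * F i z) \<le> (R + 1) / 2 * (P + 1) * (\<Sum>i\<in>I. energy_wt 1 i * (z i)\<^sup>2)"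
proof -
  have "(\<Sum>i\<in>I. energy_wt 1 i * z i * F i z) \<le> (R + 1) * buoyancy_flux z"
  proof -
    have "0 \<le> (\<Sum>n\<in>Nu. decay_rate n * (z (Inl n))\<^sup>2)" "0 \<le> (\<Sum>n\<in>Nt. decay_rate n * (z (Inr n))\<^sup>2)"
      by (intro sum_nonneg mult_nonneg_nonneg decay_rate_nonneg; simp)+
    then show ?thesis unfolding energy_balance by linarith
  qed
  also have "\<dots> \<le> (R + 1) * ((u_energy z + theta_energy z) / 2)"
    using R buoyancy_flux_bound[of 1 z] by (intro mult_left_mono) auto
  also have "\<dots> \<le> (R + 1) * ((P + 1) * (u_energy z / P + theta_energy z) / 2)"
  proof -
    have "(P + 1) * (u_energy z / P + theta_energy z) = u_energy z + theta_energy z + u_energy z / P + P * theta_energy z"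
      using P by (simp add: field_simps)
    moreover have "0 \<le> u_energy z / P" "0 \<le> P * theta_energy z" using P u_energy_nonneg theta_energy_nonneg by auto
    ultimately show ?thesis using R by (intro mult_left_mono divide_right_mono) auto
  qed
  finally show ?thesis by (simp add: weighted_energy mult_ac)
qed

lemma energy_wt_pos: "\<beta> > 0 \<Longrightarrow> energy_wt \<beta> i > 0"
  using P by (auto simp: energy_wt_def split: sum.split)

section \<open>The solution semigroup and its decay\<close>

lemma solution_exists:
  assumes "X0 \<in> phase_space Nu Nt"
  shows "\<exists>X. is_solution R S P k1 k2 Nu Nt X \<and> X 0 = X0 \<and> smooth_curve X"
proof -
  have "\<exists>x. x 0 = enc X0 \<and> solves_on {0..} I F x"
    by (rule solves_on_exists[OF finite_I polyfun_F energy_wt_pos energy_growth])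
       (use assms R P in \<open>simp_all add: phase_space_iff\<close>)
  then obtain x where x0: "x 0 = enc X0" and x: "solves_on {0..} I F x" by blast
  define X where "X t = ((\<lambda>n. x t (Inl n)), (\<lambda>n. x t (Inr n)))" for t
  have enc: "enc (X t) = x t" for t by (simp add: X_def enc_surj)
  have "is_solution R S P k1 k2 Nu Nt X" using x by (simp add: is_solution_iff enc)
  moreover have "X 0 = X0" by (rule enc_inj) (simp add: enc x0)
  moreover have "smooth_nonneg (\<lambda>t. x t i)" for i
    using solves_on_smooth[OF polyfun_F x, of i] by (simp add: smooth_nonneg_def Ball_def)
  then have "smooth_curve X" by (simp add: smooth_curve_def X_def)
  ultimately show ?thesis by blast
qed

lemma solution_unique:
  assumes X: "is_solution R S P k1 k2 Nu Nt X" and Y: "is_solution R S P k1 k2 Nu Nt Y"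
    and eq: "X 0 = Y 0" and t: "t \<ge> 0"
  shows "X t = Y t"
proof (rule enc_inj, rule solves_on_unique[OF finite_I polyfun_F])
  show "solves_on {0..t} I F (\<lambda>t. enc (X t))" "solves_on {0..t} I F (\<lambda>t. enc (Y t))"
    using X Y unfolding is_solution_iff by (auto intro: solves_on_subset)
qed (use eq t in auto)

abbreviation "flow \<equiv> semiflow R S P k1 k2 Nu Nt"

lemma semiflow_eq:
  assumes X: "is_solution R S P k1 k2 Nu Nt X" and t: "t \<ge> 0"
  shows "flow t (X 0) = X t"
  unfolding semiflow_def
  by (rule the_equality) (use X solution_unique[OF _ X _ t] in blast)+

lemma solution_shift:
  "is_solution R S P k1 k2 Nu Nt X \<Longrightarrow> t \<ge> 0 \<Longrightarrow> is_solution R S P k1 k2 Nu Nt (\<lambda>s. X (s + t))"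
  unfolding is_solution_iff by (rule solves_on_shift)

text \<open>The semigroup law is uniqueness applied to the translated solution, which starts at
  \<open>X t\<close>.\<close>

lemma is_semigroup: "is_semigroup_on (phase_space Nu Nt) flow"
  unfolding is_semigroup_on_def
proof (intro ballI conjI allI impI)
  fix Z assume "Z \<in> phase_space Nu Nt"
  then obtain X where X: "is_solution R S P k1 k2 Nu Nt X" and X0: "X 0 = Z"
    using solution_exists by blast
  show "flow 0 Z = Z" using semiflow_eq[OF X, of 0] X0 by simp
  fix t :: real assume t: "t \<ge> 0"
  have Xt: "flow t Z = X t" using semiflow_eq[OF X t] X0 by simp
  then show "flow t Z \<in> phase_space Nu Nt" using X t by (simp add: is_solution_def)
  fix s :: real assume s: "s \<ge> 0"
  have "flow s (X (0 + t)) = X (s + t)" by (rule semiflow_eq[OF solution_shift[OF X t] s])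
  moreover have "flow (s + t) Z = X (s + t)" using semiflow_eq[OF X, of "s + t"] X0 s t by simp
  ultimately show "flow (s + t) Z = flow s (flow t Z)" using Xt by simp
qed

lemma lambda1_le_decay_rate:
  assumes "n \<in> Nu \<union> Nt"
  shows "(lambda1 k1 k2 Nu Nt)\<^sup>2 \<le> decay_rate n"
proof -
  let ?g = "\<lambda>(m, p, c). norm (Kvec k1 k2 m)"
  have fin: "finite (?g ` (Nu \<union> Nt))" using finNu finNt by simp
  have "lambda1 k1 k2 Nu Nt \<le> norm (Kvec k1 k2 (fst n))"
    unfolding lambda1_def using assms by (intro Min_le fin image_eqI[of _ _ n]) (simp_all add: case_prod_beta)
  moreover have "lambda1 k1 k2 Nu Nt \<ge> 0"
    unfolding lambda1_def using assms fin by (subst Min_ge_iff) auto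
  ultimately show ?thesis unfolding decay_rate_def by (rule power_mono)
qed

lemma state_norm_sq: "(state_norm Nu Nt Z)\<^sup>2 = u_energy (enc Z) + theta_energy (enc Z)"
  by (simp add: state_norm_def u_energy_def theta_energy_def sum_nonneg)

text \<open>With \<open>\<beta>\<close> the mean of \<open>R\<close> and \<open>lambda1 ^ 4\<close> one has \<open>R + \<beta> \<le> 2 * \<beta>\<close> and
  \<open>sqrt \<beta> < lambda1\<^sup>2\<close>, so the dissipation absorbs the coupling.\<close>

lemma energy_decay:
  assumes lam: "R < lambda1 k1 k2 Nu Nt ^ 4"
  shows "\<exists>\<beta>>0. \<exists>\<delta>>0. \<forall>z. (\<Sum>i\<in>I. energy_wt \<beta> i * z i * F i z) \<le> - \<delta> * (u_energy z / P + \<beta> * theta_energy z)"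
proof -
  define L where "L = (lambda1 k1 k2 Nu Nt)\<^sup>2"
  have L4: "L\<^sup>2 = lambda1 k1 k2 Nu Nt ^ 4" by (simp add: L_def)
  \<comment> \<open>The mean is positive even for \<open>R = 0\<close>, so the temperature weight
    does not degenerate, and it stays strictly below \<open>L\<^sup>2\<close>.\<close>
  define \<beta> where "\<beta> = (R + L\<^sup>2) / 2"
  have \<beta>: "\<beta> > 0" "R \<le> \<beta>" "\<beta> < L\<^sup>2" using lam R unfolding \<beta>_def L4 by auto
  define r where "r = sqrt \<beta>"
  have r: "r > 0" "r\<^sup>2 = \<beta>" using \<beta> by (auto simp: r_def)
  have rL: "r < L" using \<beta> r by (intro power_less_imp_less_base[of r 2 L]) (auto simp: L_def)
  \<comment> \<open>The surplus \<open>L - r\<close> multiplies both energies; the factor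
    \<open>min P 1\<close> accounts for the velocity part being weighted by
    \<open>1 / P\<close>.\<close>
  define \<delta> where "\<delta> = (L - r) * min P 1"
  have \<delta>: "\<delta> > 0" "\<delta> \<le> (L - r) * P" "\<delta> \<le> L - r" using rL P by (auto simp: \<delta>_def mult_left_le)
  have "(\<Sum>i\<in>I. energy_wt \<beta> i * z i * F i z) \<le> - \<delta> * (u_energy z / P + \<beta> * theta_energy z)" for z
  proof -
    \<comment> \<open>If both index sets are empty, \<open>lambda1\<close> is an unspecified number,
      but these inequalities then compare empty sums, and \<open>L\<close> is nonnegative as a
      square.\<close>
    have "L * u_energy z \<le> (\<Sum>n\<in>Nu. decay_rate n * (z (Inl n))\<^sup>2)" "L * theta_energy z \<le> (\<Sum>n\<in>Nt. decay_rate n * (z (Inr n))\<^sup>2)"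
      unfolding u_energy_def theta_energy_def sum_distrib_left L_def
      by (intro sum_mono mult_right_mono lambda1_le_decay_rate; simp)+
    then have "(\<Sum>i\<in>I. energy_wt \<beta> i * z i * F i z) \<le> - (L * u_energy z) - \<beta> * (L * theta_energy z) + (R + \<beta>) * buoyancy_flux z"
      unfolding energy_balance using mult_left_mono[of "L * theta_energy z" _ \<beta>] \<beta>(1)
      by (smt (verit, best))
    \<comment> \<open>A nonpositive flux only helps; replacing \<open>R + \<beta>\<close> by
      \<open>2 * \<beta>\<close> relies on a positive one.\<close>
    also have "(R + \<beta>) * buoyancy_flux z \<le> r * u_energy z + \<beta> * (r * theta_energy z)"
    proof (cases "buoyancy_flux z \<le> 0")
      case True
      then have "(R + \<beta>) * buoyancy_flux z \<le> 0" using R \<beta> by (intro mult_nonneg_nonpos) auto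
      moreover have "0 \<le> r * u_energy z + \<beta> * (r * theta_energy z)" using r \<beta> u_energy_nonneg theta_energy_nonneg by simp
      ultimately show ?thesis by linarith
    next
      case False
      then have "(R + \<beta>) * buoyancy_flux z \<le> (2 * \<beta>) * buoyancy_flux z" using \<beta> by (intro mult_right_mono) auto
      \<comment> \<open>\<open>s = 1 / r\<close> in the flux bound splits the coupling in the ratio
        of the dissipation weights, since \<open>\<beta> * r * (1 / r)\<^sup>2 = r\<close>.\<close>
      also have "\<dots> = (\<beta> * r) * (2 * (1 / r) * buoyancy_flux z)" using r by simp
      also have "\<dots> \<le> (\<beta> * r) * ((1 / r)\<^sup>2 * u_energy z + theta_energy z)"
        using r \<beta> by (intro mult_left_mono buoyancy_flux_bound) auto
      also have "\<dots> = r * u_energy z + \<beta> * (r * theta_energy z)"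
        using r by (simp add: r(2)[symmetric] power2_eq_square field_simps)
      finally show ?thesis .
    qed
    also have "- (L * u_energy z) - \<beta> * (L * theta_energy z) + (r * u_energy z + \<beta> * (r * theta_energy z)) =
        - ((L - r) * P * (u_energy z / P) + (L - r) * (\<beta> * theta_energy z))"
      using P by (simp add: algebra_simps)
    also have "\<dots> \<le> - (\<delta> * (u_energy z / P) + \<delta> * (\<beta> * theta_energy z))"
      using \<delta> \<beta> P u_energy_nonneg[of z] theta_energy_nonneg[of z]
      by (intro le_imp_neg_le add_mono mult_right_mono) auto
    finally show ?thesis by (simp add: algebra_simps)
  qed
  then show ?thesis using \<beta>(1) \<delta>(1) by blast
qed

lemma origin_attractive:
  assumes lam: "R < lambda1 k1 k2 Nu Nt ^ 4"
  shows "origin_globally_exp_attractive Nu Nt flow"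
proof -
  from energy_decay[OF lam] obtain \<beta> \<delta> where \<beta>: "\<beta> > 0" and \<delta>: "\<delta> > 0"
    and dec: "\<And>z. (\<Sum>i\<in>I. energy_wt \<beta> i * z i * F i z) \<le> - \<delta> * (u_energy z / P + \<beta> * theta_energy z)" by blast
  define E where "E z = u_energy z / P + \<beta> * theta_energy z" for z
  \<comment> \<open>The product of the two constants that compare the weighted energy with the
    squared state norm, one for each direction.\<close>
  define M where "M = (P + 1 / \<beta>) * (1 / P + \<beta>)"
  have M: "M > 0" using P \<beta> by (simp add: M_def add_pos_pos)
  have "state_norm Nu Nt (flow t Z) \<le> sqrt M * exp (- \<delta> * t) * state_norm Nu Nt Z"
    if Z: "Z \<in> phase_space Nu Nt" and t: "t \<ge> 0" for Z t
  proof -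
    obtain X where X: "is_solution R S P k1 k2 Nu Nt X" and X0: "X 0 = Z"
      using solution_exists[OF Z] by blast
    define x where "x s = enc (X s)" for s
    have x: "solves_on {0..t} I F x"
      using X unfolding is_solution_iff x_def by (rule solves_on_subset) auto
    \<comment> \<open>The energy is quadratic, hence the rate \<open>2 * \<delta>\<close>; the
      square root taken for the norm gives back \<open>\<delta>\<close>.\<close>
    have "E (x t) \<le> exp ((- 2 * \<delta>) * t) * E (x 0)"
    proof (rule gronwall)
      fix s assume s: "0 \<le> s" "s \<le> t"
      show "((\<lambda>s. E (x s)) has_real_derivative (\<Sum>i\<in>I. 2 * (energy_wt \<beta> i * x s i * F i (x s)))) (at s within {0..t})"
        unfolding E_def weighted_energy[symmetric] using x s
        by (auto simp: solves_on_def intro!: derivative_eq_intros sum.cong)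
      show "(\<Sum>i\<in>I. 2 * (energy_wt \<beta> i * x s i * F i (x s))) \<le> - 2 * \<delta> * E (x s)"
        using dec[of "x s"] by (simp add: E_def flip: sum_distrib_left)
    qed (use t in auto)
    also have "exp ((- 2 * \<delta>) * t) = (exp (- \<delta> * t))\<^sup>2"
      by (simp add: power2_eq_square flip: exp_add)
    finally have dE: "E (x t) \<le> (exp (- \<delta> * t))\<^sup>2 * E (x 0)" .
    have "u_energy (x t) + theta_energy (x t) \<le> (P + 1 / \<beta>) * E (x t)"
    proof -
      have "(P + 1 / \<beta>) * E (x t) = u_energy (x t) + theta_energy (x t) + P * \<beta> * theta_energy (x t) + u_energy (x t) / (P * \<beta>)"
        using P \<beta> by (simp add: E_def field_simps)
      then show ?thesis using P \<beta> u_energy_nonneg[of "x t"] theta_energy_nonneg[of "x t"] by simp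
    qed
    also have "\<dots> \<le> (P + 1 / \<beta>) * ((exp (- \<delta> * t))\<^sup>2 * E (x 0))"
      using dE P \<beta> by (intro mult_left_mono) auto
    also have "\<dots> \<le> (P + 1 / \<beta>) * ((exp (- \<delta> * t))\<^sup>2 * ((1 / P + \<beta>) * (u_energy (x 0) + theta_energy (x 0))))"
    proof -
      have "(1 / P + \<beta>) * (u_energy (x 0) + theta_energy (x 0)) = E (x 0) + \<beta> * u_energy (x 0) + theta_energy (x 0) / P"
        by (simp add: E_def algebra_simps)
      then have "E (x 0) \<le> (1 / P + \<beta>) * (u_energy (x 0) + theta_energy (x 0))"
        using P \<beta> u_energy_nonneg[of "x 0"] theta_energy_nonneg[of "x 0"] by simp
      then show ?thesis using P \<beta> by (intro mult_left_mono) auto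
    qed
    also have "\<dots> = M * (exp (- \<delta> * t))\<^sup>2 * (u_energy (x 0) + theta_energy (x 0))"
      by (simp add: M_def mult_ac)
    finally have sq: "(state_norm Nu Nt (X t))\<^sup>2 \<le> (sqrt M * exp (- \<delta> * t) * state_norm Nu Nt Z)\<^sup>2"
      using M by (simp add: state_norm_sq power_mult_distrib X0[symmetric] x_def)
    have "0 \<le> sqrt M * exp (- \<delta> * t) * state_norm Nu Nt Z"
      using M by (simp add: state_norm_def sum_nonneg)
    moreover have "flow t Z = X t" using semiflow_eq[OF X t] X0 by simp
    ultimately show ?thesis using power2_le_imp_le[OF sq] by simp
  qed
  moreover have "sqrt M > 0" using M by simp
  ultimately show ?thesis unfolding origin_globally_exp_attractive_def using \<delta> by blast
qed

end

theorem lemma2p2: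
  fixes R S P k1 k2 :: real and Nu Nt :: "index set"
  assumes "R \<ge> 0" and "S \<ge> 0" and "P > 0" and "k1 > 0" and "k2 > 0"
    and "finite Nu" and "Nu \<subseteq> N_u"
    and "finite Nt" and "Nt \<subseteq> N_theta"
  shows "(\<forall>X0\<in>phase_space Nu Nt.
            \<exists>X. is_solution R S P k1 k2 Nu Nt X \<and> X 0 = X0 \<and> smooth_curve X
              \<and> (\<forall>Y. is_solution R S P k1 k2 Nu Nt Y \<and> Y 0 = X0 \<longrightarrow> (\<forall>t\<ge>0. Y t = X t))
              \<and> (\<forall>t\<ge>0. semiflow R S P k1 k2 Nu Nt t X0 = X t))
       \<and> is_semigroup_on (phase_space Nu Nt) (semiflow R S P k1 k2 Nu Nt)
       \<and> (R < lambda1 k1 k2 Nu Nt ^ 4 \<longrightarrow>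
            origin_globally_exp_attractive Nu Nt (semiflow R S P k1 k2 Nu Nt))"
proof -
  interpret truncation k1 k2 R S P Nu Nt
    using assms by unfold_locales
  have "\<exists>X. is_solution R S P k1 k2 Nu Nt X \<and> X 0 = X0 \<and> smooth_curve X
      \<and> (\<forall>Y. is_solution R S P k1 k2 Nu Nt Y \<and> Y 0 = X0 \<longrightarrow> (\<forall>t\<ge>0. Y t = X t))
      \<and> (\<forall>t\<ge>0. semiflow R S P k1 k2 Nu Nt t X0 = X t)" if X0: "X0 \<in> phase_space Nu Nt" for X0
  proof -
    obtain X where X: "is_solution R S P k1 k2 Nu Nt X" "X 0 = X0" "smooth_curve X"
      using solution_exists[OF X0] by blast
    then show ?thesis using solution_unique[OF _ X(1)] semiflow_eq[OF X(1)] by blast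
  qed
  then show ?thesis using is_semigroup origin_attractive by blast
qed

end
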